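(* There exists an algorithm that, given a graph $G$ on $n$ vertices and a weight function $w : V(G) \rightarrow \mathbb{N}$, outputs the weight of a maximum weight independent set of $G$ (i.e. $\max\{w(S) : S \subseteq V(G) \text{ independent}\}$, where $w(S)=\sum_{v\in S} w(v)$). If $G$ is $P_k$-free, then the algorithm runs in time $n^{O(k^2 \log^3 n)}$.
   Context: All graphs are finite, simple and undirected. An independent set is a set of pairwise non-adjacent vertices. $P_k$ denotes the path on $k$ vertices; a graph $G$ is $P_k$-free if it contains no induced subgraph isomorphic to $P_k$. Arithmetic operations on weights are assumed to take constant time. *)

theory Defs
  imports Complex_Main
begin

section \<open>Finite simple graphs\<close>

record 'a ugraph =
  vertices :: "'a set"
  edges :: "'a set set"

definition simple_graph :: "'a ugraph \<Rightarrow> bool" where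
  "simple_graph G \<longleftrightarrow> finite (vertices G) \<and> edges G \<subseteq> {e. e \<subseteq> vertices G \<and> card e = 2}"

definition independent_set :: "'a ugraph \<Rightarrow> 'a set \<Rightarrow> bool" where
  "independent_set G S \<longleftrightarrow> S \<subseteq> vertices G \<and> (\<forall>u\<in>S. \<forall>v\<in>S. {u, v} \<notin> edges G)"

definition max_weight_independent_set :: "'a ugraph \<Rightarrow> ('a \<Rightarrow> nat) \<Rightarrow> nat" where
  "max_weight_independent_set G w = Max {sum w S | S. independent_set G S}"

definition induced_subgraph :: "'a ugraph \<Rightarrow> 'a set \<Rightarrow> 'a ugraph" where
  "induced_subgraph G W = \<lparr>vertices = W, edges = {e \<in> edges G. e \<subseteq> W}\<rparr>"

definition isomorphic :: "'a ugraph \<Rightarrow> 'b ugraph \<Rightarrow> bool" where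
  "isomorphic G H \<longleftrightarrow> (\<exists>f. bij_betw f (vertices G) (vertices H) \<and>
     (\<forall>u\<in>vertices G. \<forall>v\<in>vertices G. {u, v} \<in> edges G \<longleftrightarrow> {f u, f v} \<in> edges H))"

definition path_graph :: "nat \<Rightarrow> nat ugraph" where
  "path_graph k = \<lparr>vertices = {..<k}, edges = {{i, Suc i} | i. Suc i < k}\<rparr>"

definition path_free :: "nat \<Rightarrow> 'a ugraph \<Rightarrow> bool" where
  "path_free k G \<longleftrightarrow>
     \<not> (\<exists>W \<subseteq> vertices G. isomorphic (induced_subgraph G W) (path_graph k))"


section \<open>Unit-cost random access programs\<close>

text \<open>
  The machine model is a random access machine in structured form. The memory consists of
  arrays of natural numbers, one for each name; a scalar variable is cell 0 of an array.
  Array indices may be computed, so there is indirect addressing. The unit-cost operations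
  are reading and writing a cell, addition, truncated subtraction and comparison.
  Multiplication is left out on purpose: with unit-cost multiplication, numbers of
  exponential length could be built in polynomially many steps.

  A program is a finite list of parameterless, possibly recursive procedures that all work
  on the same memory, and procedure 0 is its entry point. Programs are finite syntactic
  objects, so one program serves inputs of all sizes.
\<close>

type_synonym vname = string

type_synonym state = "vname \<Rightarrow> nat \<Rightarrow> nat"

datatype aexp =
    Const nat
  | Read vname aexp
  | Plus aexp aexp
  | Minus aexp aexp

primrec aval :: "aexp \<Rightarrow> state \<Rightarrow> nat" where
  "aval (Const k) s = k"
| "aval (Read x a) s = s x (aval a s)"
| "aval (Plus a b) s = aval a s + aval b s"
| "aval (Minus a b) s = aval a s - aval b s"

primrec acost :: "aexp \<Rightarrow> nat" where
  "acost (Const k) = 1"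
| "acost (Read x a) = acost a + 1"
| "acost (Plus a b) = acost a + acost b + 1"
| "acost (Minus a b) = acost a + acost b + 1"

text \<open>
  \<open>Assign x a b\<close> stores the value of \<open>b\<close> in cell \<open>a\<close> of \<open>x\<close>. The condition of
  \<open>IfLess a b\<close> and \<open>WhileLess a b\<close> is that the value of \<open>a\<close> is less than that of \<open>b\<close>.
\<close>

datatype com =
    Skip
  | Assign vname aexp aexp
  | Seq com com
  | IfLess aexp aexp com com
  | WhileLess aexp aexp com
  | Call nat

type_synonym program = "com list"

text \<open>\<open>exec P c s t s'\<close>: started in \<open>s\<close>, command \<open>c\<close> halts in \<open>s'\<close> after exactly \<open>t\<close> steps.\<close>

inductive exec :: "program \<Rightarrow> com \<Rightarrow> state \<Rightarrow> nat \<Rightarrow> state \<Rightarrow> bool" for P :: program where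
  Skip: "exec P Skip s 1 s"
| Assign: "exec P (Assign x a b) s (acost a + acost b + 1)
             (s(x := (s x)(aval a s := aval b s)))"
| Seq: "exec P c s t s' \<Longrightarrow> exec P d s' u s'' \<Longrightarrow> exec P (Seq c d) s (t + u) s''"
| IfTrue: "aval a s < aval b s \<Longrightarrow> exec P c s t s' \<Longrightarrow>
     exec P (IfLess a b c d) s (acost a + acost b + 1 + t) s'"
| IfFalse: "\<not> aval a s < aval b s \<Longrightarrow> exec P d s t s' \<Longrightarrow>
     exec P (IfLess a b c d) s (acost a + acost b + 1 + t) s'"
| WhileFalse: "\<not> aval a s < aval b s \<Longrightarrow>
     exec P (WhileLess a b c) s (acost a + acost b + 1) s"
| WhileTrue: "aval a s < aval b s \<Longrightarrow> exec P c s t s' \<Longrightarrow>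
     exec P (WhileLess a b c) s' u s'' \<Longrightarrow>
     exec P (WhileLess a b c) s (acost a + acost b + 1 + t + u) s''"
| Call: "i < length P \<Longrightarrow> exec P (P ! i) s t s' \<Longrightarrow> exec P (Call i) s (t + 1) s'"

inductive_cases SkipE: "exec P Skip s t s'"
inductive_cases AssignE: "exec P (Assign x a b) s t s'"
inductive_cases SeqE: "exec P (Seq c d) s t s'"
inductive_cases IfLessE: "exec P (IfLess a b c d) s t s'"
inductive_cases WhileLessE: "exec P (WhileLess a b c) s t s'"
inductive_cases CallE: "exec P (Call i) s t s'"

lemma exec_deterministic:
  assumes "exec P c s t s'" and "exec P c s u s''"
  shows "u = t \<and> s'' = s'"
  using assms
proof (induction arbitrary: u s'' rule: exec.induct)
  case (Skip s)
  from Skip.prems show ?case by (elim SkipE) simp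
next
  case (Assign x a b s)
  from Assign.prems show ?case by (elim AssignE) simp
next
  case (Seq c s t s' d v r)
  from Seq.prems obtain t1 m t2 where
    *: "exec P c s t1 m" "exec P d m t2 s''" "u = t1 + t2" by (elim SeqE)
  from Seq.IH(1)[OF *(1)] Seq.IH(2)[of t2 s''] * show ?case by simp
next
  case (IfTrue a s b c t s' d)
  from IfTrue.prems IfTrue.hyps obtain t1 where
    *: "exec P c s t1 s''" "u = acost a + acost b + 1 + t1" by (elim IfLessE) simp_all
  from IfTrue.IH[OF *(1)] *(2) show ?case by simp
next
  case (IfFalse a s b d t s' c)
  from IfFalse.prems IfFalse.hyps obtain t1 where
    *: "exec P d s t1 s''" "u = acost a + acost b + 1 + t1" by (elim IfLessE) simp_all
  from IfFalse.IH[OF *(1)] *(2) show ?case by simp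
next
  case (WhileFalse a s b c)
  from WhileFalse.prems show ?case
    by (rule WhileLessE) (simp_all add: WhileFalse.hyps)
next
  case (WhileTrue a s b c t s' v r)
  from WhileTrue.prems obtain t1 m t2 where
    *: "exec P c s t1 m" "exec P (WhileLess a b c) m t2 s''"
       "u = acost a + acost b + 1 + t1 + t2"
    by (rule WhileLessE) (simp_all add: WhileTrue.hyps)
  from WhileTrue.IH(1)[OF *(1)] WhileTrue.IH(2)[of t2 s''] * show ?case by simp
next
  case (Call i s t s')
  from Call.prems obtain t1 where *: "exec P (P ! i) s t1 s''" "u = t1 + 1" by (elim CallE) simp
  from Call.IH[OF *(1)] *(2) show ?case by simp
qed

definition run :: "program \<Rightarrow> state \<Rightarrow> nat \<Rightarrow> state \<Rightarrow> bool" where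
  "run P s t s' \<longleftrightarrow> exec P (Call 0) s t s'"

text \<open>
  A graph with vertex set \<open>{..<n}\<close> is presented by \<open>n\<close>, its adjacency matrix (row by row)
  and the list of its vertex weights; the rest of the memory is zero.
\<close>

definition input_state :: "nat \<Rightarrow> nat ugraph \<Rightarrow> (nat \<Rightarrow> nat) \<Rightarrow> state" where
  "input_state n G w = (\<lambda>x i.
     if x = ''n'' \<and> i = 0 then n
     else if x = ''adj'' \<and> i < n * n then (if {i div n, i mod n} \<in> edges G then 1 else 0)
     else if x = ''w'' \<and> i < n then w i
     else 0)"

definition result :: "state \<Rightarrow> nat" where
  "result s = s ''out'' 0"


section \<open>The running time\<close>

text \<open>
  The bound \<open>n ^ O(k\<^sup>2 log\<^sup>3 n)\<close> with the constant of the exponent made explicit.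
  The maximum only affects \<open>n < 2\<close>, where the expression itself degenerates (to 1 if
  \<open>n = 1\<close>) and cannot absorb the constant number of steps any program needs.
\<close>

definition time_bound :: "real \<Rightarrow> nat \<Rightarrow> nat \<Rightarrow> real" where
  "time_bound c k n =
     (let m = real (max 2 n) in m powr (c * (real k)\<^sup>2 * (log 2 m) ^ 3))"

end

theory Submission
  imports Defs
begin

text \<open>
  Let \<open>N = 4n\<^sup>2\<close>, and let \<open>W U u v\<close> count the walks of length \<open>n\<close> from \<open>u\<close> to \<open>v\<close> inside \<open>U\<close> when
  every vertex carries \<open>N\<close> extra loops. Loops are so cheap that \<open>N ^ (n - k) \<le> W \<le> 3 * N ^ n\<close> for
  connected pairs of a \<open>P\<^sub>k\<close>-free graph (shortest paths are induced), although \<open>k\<close> does not occur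
  in \<open>W\<close>; so \<open>ln W\<close> ranges over an interval of length \<open>O(k log n)\<close>.

  The algorithm splits off a component \<open>C\<close> and branches on the vertex \<open>x\<close> whose closed neighbourhood
  meets, summed over all pairs in \<open>C\<close>, the largest fraction of these walks. A Gyarfas path \<open>X\<close> of at
  most \<open>k\<close> vertices has a neighbourhood that separates half of all pairs, and then every walk between
  a separated pair meets the neighbourhood of some \<open>x \<in> X\<close>. Hence taking \<open>x\<close> into the independent
  set lowers the potential \<open>\<Sum> ln W\<close> by at least \<open>|C|\<^sup>2 / 4k\<close>. The potential is \<open>O(|C|\<^sup>2 k log n)\<close>,
  so there are \<open>O(k\<^sup>2 log n)\<close> such branchings before the size of the component halves, and
  \<open>O(k\<^sup>2 log\<^sup>2 n)\<close> on each branch of the recursion tree.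
\<close>

section \<open>Induced paths and balanced separators\<close>

text \<open>One program has to serve every \<open>k\<close>, so it can neither search for a Gyarfas
  path nor cut off a count at \<open>k\<close>. Hence the measure must be computable without
  \<open>k\<close>, with \<open>k\<close> entering only through bounds on its range. Walks qualify
  where induced paths would not: a linear recurrence counts them with polynomially many additions.
  Their counts are exponentially large, which unit-cost addition tolerates; multiplication and
  division by counts become \<open>N\<close> rounds of adding and subtracting.

  The value of \<open>N\<close> serves two estimates. Against \<open>N\<close> loops the at most
  \<open>n\<close> edges at a vertex raise the count by a factor of at most
  \<open>(1 + n / N) ^ n\<close>, which is bounded. And rounding the lost fraction of walks to a
  multiple of \<open>1 / N\<close> costs at most half of what averaging over the separator
  guarantees.

  A vertex destroys a fraction of the walks, and fractions turn into differences of logarithms; this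
  is why the potential is a sum of logarithms. Only the call that takes \<open>x\<close> lowers it
  by a guaranteed amount; the other two calls share the vertices between them and are paid by a
  linear factor. The exponent obtained is \<open>O(k^2 log^2 n)\<close>, one logarithm below the
  target.\<close>

definition induced_path :: "(nat \<Rightarrow> nat \<Rightarrow> bool) \<Rightarrow> (nat \<Rightarrow> nat) \<Rightarrow> nat \<Rightarrow> bool" where
  "induced_path E f l \<longleftrightarrow> inj_on f {..<l} \<and>
     (\<forall>i<l. \<forall>j<l. E (f i) (f j) \<longleftrightarrow> j = Suc i \<or> i = Suc j)"

locale nat_graph =
  fixes n :: nat and E :: "nat \<Rightarrow> nat \<Rightarrow> bool"
  assumes sym: "E u v \<Longrightarrow> E v u" and irrefl: "\<not> E u u"
begin

definition no_path :: "nat \<Rightarrow> bool" where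
  "no_path k \<longleftrightarrow> \<not> (\<exists>f. f ` {..<k} \<subseteq> {..<n} \<and> induced_path E f k)"

definition rel :: "nat set \<Rightarrow> (nat \<times> nat) set" where
  "rel S = {(a, b). a \<in> S \<and> b \<in> S \<and> E a b}"

definition comp :: "nat set \<Rightarrow> nat \<Rightarrow> nat set" where
  "comp S v = {u. (v, u) \<in> (rel S)\<^sup>*}"

text \<open>Stated by cuts and not by paths, because the separator argument asks for an edge that
  leaves a proper subset.\<close>

definition conn :: "nat set \<Rightarrow> bool" where
  "conn D \<longleftrightarrow> (\<forall>A. A \<subseteq> D \<longrightarrow> A \<noteq> {} \<longrightarrow> A \<noteq> D \<longrightarrow> (\<exists>a\<in>A. \<exists>b\<in>D - A. E a b))"

definition nbh :: "nat \<Rightarrow> nat set" where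
  "nbh x = {y. y = x \<or> E x y}"

lemma sym_rel: "sym (rel S)"
  using sym by (auto simp: rel_def sym_def)

lemma comp_subset: "v \<in> S \<Longrightarrow> comp S v \<subseteq> S"
proof
  fix u assume v: "v \<in> S" and "u \<in> comp S v"
  then have "(v, u) \<in> (rel S)\<^sup>*" by (simp add: comp_def)
  then show "u \<in> S" by (induction rule: rtrancl_induct) (use v in \<open>auto simp: rel_def\<close>)
qed

lemma comp_refl: "v \<in> comp S v"
  by (simp add: comp_def)

lemma comp_closed:
  assumes "v \<in> S" "a \<in> comp S v" "b \<in> S" "E a b"
  shows "b \<in> comp S v"
proof -
  have "a \<in> S" using comp_subset assms by blast
  then have "(a, b) \<in> rel S" using assms by (simp add: rel_def)
  then show ?thesis using assms(2) by (auto simp: comp_def)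
qed

lemma conn_comp:
  assumes "v \<in> S"
  shows "conn (comp S v)"
  unfolding conn_def
proof (intro allI impI)
  fix A assume A: "A \<subseteq> comp S v" "A \<noteq> {}" "A \<noteq> comp S v"
  then obtain a b where ab: "a \<in> A" "b \<in> comp S v" "b \<notin> A" by blast
  have "sym ((rel S)\<^sup>*)" using sym_rel by (rule sym_rtrancl)
  then have "(a, v) \<in> (rel S)\<^sup>*" using ab A unfolding comp_def sym_def by blast
  then have r: "(a, b) \<in> (rel S)\<^sup>*" using ab unfolding comp_def by (auto intro: rtrancl_trans)
  show "\<exists>a\<in>A. \<exists>b\<in>comp S v - A. E a b"
  proof (rule ccontr)
    assume neg: "\<not> ?thesis"
    from r have "b \<in> A"
    proof (induction rule: rtrancl_induct)
      case (step y z)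
      then have "z \<in> comp S v"
        using A(1) assms comp_closed unfolding rel_def by blast
      then show ?case using step neg unfolding rel_def by blast
    qed (use ab in simp)
    then show False using ab by simp
  qed
qed

lemma conn_reach:
  assumes "conn D" "u \<in> D" "v \<in> D"
  shows "(u, v) \<in> (rel D)\<^sup>*"
proof (rule ccontr)
  assume neg: "\<not> ?thesis"
  let ?A = "comp D u"
  have "?A \<subseteq> D" "?A \<noteq> {}" "?A \<noteq> D"
    using comp_subset[OF assms(2)] comp_refl neg assms(3) by (auto simp: comp_def)
  then obtain a b where "a \<in> ?A" "b \<in> D - ?A" "E a b"
    using assms(1) unfolding conn_def by blast
  then show False using comp_closed[OF assms(2)] by blast
qed

lemma shortest_path:
  assumes "(u, v) \<in> (rel S)\<^sup>*" "u \<in> S"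
  obtains d f where "(u, v) \<in> rel S ^^ d" "induced_path E f (Suc d)" "f ` {..<Suc d} \<subseteq> S"
proof -
  define d where "d = (LEAST d. (u, v) \<in> rel S ^^ d)"
  obtain d' where "(u, v) \<in> rel S ^^ d'" using assms rtrancl_imp_relpow by blast
  then have d: "(u, v) \<in> rel S ^^ d" unfolding d_def by (rule LeastI)
  have least: "d \<le> e" if "(u, v) \<in> rel S ^^ e" for e
    unfolding d_def using that by (rule Least_le)
  obtain f where f: "f 0 = u" "f d = v" "\<And>i. i < d \<Longrightarrow> (f i, f (Suc i)) \<in> rel S"
    using d relpow_fun_conv by metis
  have seg: "(f i, f (i + l)) \<in> rel S ^^ l" if "i + l \<le> d" for i l
    using that by (induction l) (auto intro!: relcompI f(3))
  \<comment> \<open>A repeated vertex is such a shortcut with \<open>e = 0\<close>, a chord one with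
    \<open>e = 1\<close>; both contradict the minimality of \<open>d\<close>.\<close>
  have short: False if "i \<le> j" "j \<le> d" "(f i, f j) \<in> rel S ^^ e" "i + e < j" for i j e
  proof -
    have "(f 0, f i) \<in> rel S ^^ i" using seg[of 0 i] that by simp
    moreover have "(f j, f d) \<in> rel S ^^ (d - j)" using seg[of j "d - j"] that by simp
    ultimately have "(u, v) \<in> rel S ^^ (i + e + (d - j))"
      using that(3) f(1,2) relpow_trans by metis
    then show False using least that by fastforce
  qed
  have inS: "f i \<in> S" if "i \<le> d" for i
  proof (cases i)
    case (Suc j)
    then show ?thesis using f(3)[of j] that by (simp add: rel_def)
  qed (use f(1) assms(2) in simp)
  have ne: "f i \<noteq> f j" if "i < j" "j \<le> d" for i j
    using short[of i j 0] that by (metis less_imp_le add_0_right relpow_0_I)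
  have ee: "\<not> E (f i) (f j)" if "Suc i < j" "j \<le> d" for i j
  proof
    assume "E (f i) (f j)"
    then have "(f i, f j) \<in> rel S ^^ 1" using inS[of i] inS[of j] that by (simp add: rel_def)
    then show False using short[of i j 1] that by simp
  qed
  have es: "E (f i) (f (Suc i))" if "i < d" for i
    using f(3)[OF that] by (simp add: rel_def)
  have "induced_path E f (Suc d)"
    unfolding induced_path_def
  proof (intro conjI allI impI)
    show "inj_on f {..<Suc d}"
      by (rule linorder_inj_onI) (use ne in auto)
    fix i j assume ij: "i < Suc d" "j < Suc d"
    consider "i = j" | "j = Suc i" | "i = Suc j" | "Suc i < j" | "Suc j < i" by linarith
    then show "E (f i) (f j) \<longleftrightarrow> j = Suc i \<or> i = Suc j"
      by cases (use ee[of i j] ee[of j i] es[of i] es[of j] ij sym irrefl in auto)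
  qed
  moreover have "f ` {..<Suc d} \<subseteq> S" using inS by auto
  ultimately show ?thesis using d that by blast
qed

lemma induced_path_mono: "induced_path E f l \<Longrightarrow> k \<le> l \<Longrightarrow> induced_path E f k"
  unfolding induced_path_def by (auto intro: inj_on_subset)

lemma no_pathD: "no_path k \<Longrightarrow> f ` {..<k} \<subseteq> {..<n} \<Longrightarrow> \<not> induced_path E f k"
  unfolding no_path_def by simp

text \<open>A shortest walk is an induced path on \<open>d + 1\<close> vertices, and for
  \<open>d \<ge> k\<close> its first \<open>k\<close> vertices would be a forbidden path. One
  \<open>d\<close> serves all \<open>k\<close>, since the walk counts do not know
  \<open>k\<close>.\<close>

lemma short_walk:
  assumes "(u, v) \<in> (rel S)\<^sup>*" "u \<in> S" "S \<subseteq> {..<n}" 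
  obtains d where "(u, v) \<in> rel S ^^ d" "d < n" "\<And>k. no_path k \<Longrightarrow> d < k"
proof -
  obtain d f where df: "(u, v) \<in> rel S ^^ d" "induced_path E f (Suc d)" "f ` {..<Suc d} \<subseteq> S"
    by (rule shortest_path[OF assms(1,2)])
  have "card (f ` {..<Suc d}) = Suc d"
    using df(2) card_image[of f "{..<Suc d}"] unfolding induced_path_def by (metis card_lessThan)
  moreover have "card (f ` {..<Suc d}) \<le> card {..<n}"
    using df(3) assms(3) by (intro card_mono) auto
  ultimately have dn: "d < n" by simp
  have dk: "d < k" if "no_path k" for k
  proof (rule ccontr)
    assume "\<not> d < k"
    then have k: "k \<le> Suc d" by simp
    have "f ` {..<k} \<subseteq> f ` {..<Suc d}" using k by (intro image_mono) simp
    then have "f ` {..<k} \<subseteq> {..<n}" using df(3) assms(3) by (rule subset_trans[OF _ subset_trans])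
    from no_pathD[OF that this] show False using induced_path_mono[OF df(2) k] by (rule notE)
  qed
  show ?thesis by (rule that[OF df(1) dn dk])
qed

section \<open>Balanced separators made of few closed neighbourhoods\<close>

definition balanced :: "nat set \<Rightarrow> nat set \<Rightarrow> bool" where
  "balanced C X \<longleftrightarrow>
     (\<forall>v\<in>C - (\<Union>x\<in>X. nbh x). 2 * card (comp (C - (\<Union>x\<in>X. nbh x)) v) \<le> card C)"

text \<open>The Gyarfas path argument. If no set works, the closed neighbourhoods of the path built
  so far always leave a component with more than half of \<open>C\<close>. The path is extended by a
  neighbour of its end that touches this component, and so it grows to a forbidden length.\<close>

lemma gyarfas:
  assumes C: "conn C" "C \<noteq> {}" "C \<subseteq> {..<n}" and k: "no_path k"
  obtains X where "X \<subseteq> C" "X \<noteq> {}" "card X \<le> k" "balanced C X"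
proof (rule ccontr)
  assume "\<not> thesis"
  then have neg: "\<And>X. X \<subseteq> C \<Longrightarrow> X \<noteq> {} \<Longrightarrow> card X \<le> k \<Longrightarrow> \<not> balanced C X"
    using that by blast
  have finC: "finite C" using C finite_subset by blast
  define S where "S f i = C - (\<Union>x\<in>f ` {..<i}. nbh x)" for f :: "nat \<Rightarrow> nat" and i :: nat
  \<comment> \<open>The neighbourhood of the last vertex \<open>f i\<close> is not yet removed from
    \<open>S f i\<close>. \<open>D\<close> is the large component of \<open>S f i\<close>, and
    \<open>D \<inter> nbh (f i) \<noteq> {}\<close> forces it to shrink in the next round.\<close>
  have ex: "\<exists>f D. f ` {..<Suc i} \<subseteq> C \<and> induced_path E f (Suc i) \<and> D \<subseteq> S f i \<and> conn D \<and>
      (\<forall>a\<in>D. \<forall>b\<in>S f i. E a b \<longrightarrow> b \<in> D) \<and> card C < 2 * card D \<and> D \<inter> nbh (f i) \<noteq> {}"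
    if "Suc i \<le> k" for i
    using that
  proof (induction i)
    case 0
    obtain v where v: "v \<in> C" using C by blast
    define f :: "nat \<Rightarrow> nat" where "f = (\<lambda>_. v)"
    have "card C < 2 * card C" using finC C by (simp add: card_gt_0_iff)
    moreover have "f ` {..<Suc 0} \<subseteq> C" "induced_path E f (Suc 0)" "C \<inter> nbh (f 0) \<noteq> {}"
      using v irrefl by (auto simp: f_def induced_path_def nbh_def inj_on_def)
    moreover have "S f 0 = C" by (simp add: S_def)
    ultimately show ?case using C(1) by (intro exI[of _ f] exI[of _ C]) simp
  next
    case (Suc i)
    have "Suc i \<le> k" using Suc.prems by simp
    from Suc.IH[OF this] obtain f D where fD: "f ` {..<Suc i} \<subseteq> C \<and> induced_path E f (Suc i) \<and>
      D \<subseteq> S f i \<and> conn D \<and> (\<forall>a\<in>D. \<forall>b\<in>S f i. E a b \<longrightarrow> b \<in> D) \<and> card C < 2 * card D \<and>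
      D \<inter> nbh (f i) \<noteq> {}" by (elim exE)
    have f: "f ` {..<Suc i} \<subseteq> C" "induced_path E f (Suc i)" using fD by simp_all
    have D: "D \<subseteq> S f i" "conn D" "card C < 2 * card D" "D \<inter> nbh (f i) \<noteq> {}" using fD by simp_all
    have Dcl: "b \<in> D" if "a \<in> D" "b \<in> S f i" "E a b" for a b using fD that by blast
    have "card (f ` {..<Suc i}) \<le> k"
      using Suc.prems card_image_le[of "{..<Suc i}" f] by simp
    moreover have "f ` {..<Suc i} \<noteq> {}" unfolding lessThan_Suc by simp
    ultimately have "\<not> balanced C (f ` {..<Suc i})" using neg[OF f(1)] by blast
    then have "\<not> (\<forall>v\<in>S f (Suc i). 2 * card (comp (S f (Suc i)) v) \<le> card C)"
      unfolding balanced_def S_def .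
    then obtain v where v: "v \<in> S f (Suc i)" and big: "\<not> 2 * card (comp (S f (Suc i)) v) \<le> card C"
      by blast
    define D' where "D' = comp (S f (Suc i)) v"
    have S': "S f (Suc i) = S f i - nbh (f i)"
      unfolding S_def lessThan_Suc[of i] image_insert by auto
    have D': "D' \<subseteq> S f (Suc i)" "conn D'"
      "\<And>a b. a \<in> D' \<Longrightarrow> b \<in> S f (Suc i) \<Longrightarrow> E a b \<Longrightarrow> b \<in> D'"
      unfolding D'_def
        apply (rule comp_subset[OF v])
       apply (rule conn_comp[OF v])
      apply (rule comp_closed[OF v], assumption+)
      done
    have SC: "S f i \<subseteq> C" "S f (Suc i) \<subseteq> C" unfolding S_def by blast+
    then have DC: "D \<subseteq> C" "D' \<subseteq> C" using D(1) D'(1) by simp_all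
    \<comment> \<open>Both contain more than half of \<open>C\<close>. Since \<open>D'\<close> is
      connected and \<open>D\<close> is closed in \<open>S f i\<close>, meeting already implies
      \<open>D' \<subseteq> D\<close>.\<close>
    have meet: "D \<inter> D' \<noteq> {}"
    proof
      assume "D \<inter> D' = {}"
      then have "card (D \<union> D') = card D + card D'"
        using card_Un_disjoint[OF finite_subset[OF DC(1) finC] finite_subset[OF DC(2) finC]] by simp
      moreover have "card (D \<union> D') \<le> card C" using DC finC by (intro card_mono) auto
      ultimately show False using big D(3) unfolding D'_def by linarith
    qed
    have sub: "D' \<subseteq> D"
    proof (rule ccontr)
      assume "\<not> D' \<subseteq> D"
      then have "D' \<inter> D \<noteq> D'" by blast
      moreover have "D' \<inter> D \<subseteq> D'" "D' \<inter> D \<noteq> {}" using meet by blast+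
      ultimately have "\<exists>a\<in>D' \<inter> D. \<exists>b\<in>D' - D' \<inter> D. E a b"
        using D'(2) unfolding conn_def by presburger
      then obtain a b where "a \<in> D' \<inter> D" "b \<in> D' - D' \<inter> D" "E a b" by blast
      then show False using Dcl[of a b] D'(1) S' by blast
    qed
    have "D' \<noteq> D" using D(4) D'(1) S' by blast
    moreover have "D' \<noteq> {}" using meet by blast
    ultimately have "\<exists>a\<in>D'. \<exists>b\<in>D - D'. E a b"
      using D(2) sub unfolding conn_def by presburger
    then obtain a b where ab: "a \<in> D'" "b \<in> D - D'" "E a b" by blast
    \<comment> \<open>Otherwise \<open>b\<close> would survive in \<open>S f (Suc i)\<close> and be
      absorbed by \<open>D'\<close>. It avoids all earlier neighbourhoods because it lies in
      \<open>D\<close>, which keeps the extended path induced.\<close>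
    have bi: "b \<in> nbh (f i)" using ab D'(3)[of a b] D(1) S' by blast
    have "b \<noteq> f i"
    proof
      assume "b = f i"
      then have "a \<in> nbh (f i)" using ab sym by (auto simp: nbh_def)
      then show False using ab D'(1) S' by blast
    qed
    then have eb: "E (f i) b" using bi by (simp add: nbh_def)
    have nb: "b \<notin> nbh (f j)" if "j < i" for j
      using ab D(1) that unfolding S_def by blast
    define g where "g = f(Suc i := b)"
    have gf: "g ` {..<Suc i} = f ` {..<Suc i}" unfolding g_def by auto
    have SS: "S g (Suc i) = S f (Suc i)" unfolding S_def gf ..
    have "g ` {..<Suc (Suc i)} \<subseteq> C"
      using f(1) ab DC unfolding g_def by (auto simp: less_Suc_eq)
    moreover have "induced_path E g (Suc (Suc i))"
      unfolding induced_path_def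
    proof (intro conjI allI impI)
      have fb: "f j \<noteq> b" if "j < Suc i" for j
        using nb[of j] \<open>b \<noteq> f i\<close> that by (auto simp: nbh_def less_Suc_eq)
      show "inj_on g {..<Suc (Suc i)}"
      proof -
        have "inj_on f {..<Suc i}" using f(2) unfolding induced_path_def by blast
        then show ?thesis using fb unfolding g_def lessThan_Suc[of "Suc i"]
          by (subst inj_on_insert) (auto simp: inj_on_def)
      qed
      fix p q assume pq: "p < Suc (Suc i)" "q < Suc (Suc i)"
      have new: "E (f j) b \<longleftrightarrow> j = i" "E b (f j) \<longleftrightarrow> j = i" if "j < Suc i" for j
        using nb[of j] eb sym that by (auto simp: nbh_def less_Suc_eq)
      have old: "E (f p) (f q) \<longleftrightarrow> q = Suc p \<or> p = Suc q" if "p < Suc i" "q < Suc i"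
        using f(2) that unfolding induced_path_def by blast
      consider "p < Suc i" "q < Suc i" | "p < Suc i" "q = Suc i" | "p = Suc i" "q < Suc i"
        | "p = Suc i" "q = Suc i" using pq by linarith
      then show "E (g p) (g q) \<longleftrightarrow> q = Suc p \<or> p = Suc q"
        by cases (use old new[of p] new[of q] irrefl[of b] in \<open>auto simp: g_def\<close>)
    qed
    moreover have "D' \<inter> nbh (g (Suc i)) \<noteq> {}"
      using ab sym unfolding g_def by (auto simp: nbh_def)
    moreover have "\<forall>a\<in>D'. \<forall>b\<in>S g (Suc i). E a b \<longrightarrow> b \<in> D'" using D'(3) SS by blast
    moreover have "D' \<subseteq> S g (Suc i)" "card C < 2 * card D'" using D'(1) SS big D'_def by auto
    ultimately show ?case using D'(2) by (intro exI[of _ g] exI[of _ D']) simp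
  qed
  show False
  proof (cases k)
    case 0
    then show False using k by (simp add: no_path_def induced_path_def)
  next
    case (Suc i)
    then obtain f where "f ` {..<k} \<subseteq> C" "induced_path E f k" using ex[of i] by blast
    moreover from this have "f ` {..<k} \<subseteq> {..<n}" using C(3) by simp
    ultimately show False using no_pathD[OF k] by simp
  qed
qed

end

section \<open>Weighted walks and the potential\<close>

context nat_graph
begin

definition N :: nat where
  "N = 4 * n * n"

text \<open>The recurrence peels off the last step, so for a fixed source one array per length
  suffices; the program fills exactly these arrays.\<close>

primrec wk :: "nat set \<Rightarrow> nat \<Rightarrow> nat \<Rightarrow> nat \<Rightarrow> nat" where
  "wk U u 0 v = (if u = v \<and> v \<in> U then 1 else 0)"
| "wk U u (Suc j) v =
     (if v \<in> U then N * wk U u j v + (\<Sum>y | y < n \<and> E v y. wk U u j y) else 0)"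

abbreviation W :: "nat set \<Rightarrow> nat \<Rightarrow> nat \<Rightarrow> nat" where
  "W U u v \<equiv> wk U u n v"

lemma wk_outside: "v \<notin> U \<Longrightarrow> wk U u j v = 0"
  by (cases j) auto

lemma wk_outside_source: "u \<notin> U \<Longrightarrow> wk U u j v = 0"
  by (induction j arbitrary: v) auto

lemma wk_mono: "U' \<subseteq> U \<Longrightarrow> wk U' u j v \<le> wk U u j v"
proof (induction j arbitrary: v)
  case (Suc j)
  then show ?case by (auto intro!: add_mono sum_mono mult_le_mono2)
qed auto

lemma wk_upper: "wk U u j v \<le> (N + n) ^ j"
proof (induction j arbitrary: v)
  case (Suc j)
  have "card {y. y < n \<and> E v y} \<le> card {..<n}" by (intro card_mono) auto
  then have "(\<Sum>y | y < n \<and> E v y. wk U u j y) \<le> n * (N + n) ^ j"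
    using sum_bounded_above[of "{y. y < n \<and> E v y}" "wk U u j" "(N + n) ^ j"] Suc.IH
    by (simp add: order_trans)
  moreover have "N * wk U u j v \<le> N * (N + n) ^ j" using Suc.IH by (rule mult_le_mono2)
  ultimately have "N * wk U u j v + (\<Sum>y | y < n \<and> E v y. wk U u j y)
      \<le> N * (N + n) ^ j + n * (N + n) ^ j" by linarith
  then show ?case by (auto simp: add_mult_distrib)
qed auto

lemma wk_walk:
  assumes "(u, v) \<in> rel U ^^ d" "u \<in> U" "U \<subseteq> {..<n}"
  shows "1 \<le> wk U u d v"
  using assms(1)
proof (induction d arbitrary: v)
  case 0
  then show ?case using assms(2) by simp
next
  case (Suc d)
  then obtain y where y: "(u, y) \<in> rel U ^^ d" "(y, v) \<in> rel U" by auto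
  then have v: "v \<in> U" "E v y" "y < n" using assms(3) sym by (auto simp: rel_def)
  have "wk U u d y \<le> (\<Sum>y | y < n \<and> E v y. wk U u d y)"
    by (rule member_le_sum) (use v in auto)
  then show ?case using Suc.IH[OF y(1)] v by simp
qed

lemma wk_lower:
  assumes "(u, v) \<in> rel U ^^ d" "u \<in> U" "v \<in> U" "U \<subseteq> {..<n}"
  shows "N ^ i \<le> wk U u (d + i) v"
proof (induction i)
  case 0
  then show ?case using wk_walk[OF assms(1,2,4)] by simp
next
  case (Suc i)
  have "N * N ^ i \<le> N * wk U u (d + i) v" using Suc by (rule mult_le_mono2)
  then show ?case using assms(3) by (simp add: trans_le_add1)
qed

lemma wk_reach: "0 < wk U u j v \<Longrightarrow> (u, v) \<in> (rel U)\<^sup>*"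
proof (induction j arbitrary: v)
  case 0
  then show ?case by (simp split: if_splits)
next
  case (Suc j)
  then have v: "v \<in> U" by (simp split: if_splits)
  show ?case
  proof (cases "0 < wk U u j v")
    case False
    then have "0 < (\<Sum>y | y < n \<and> E v y. wk U u j y)" using Suc.prems v by simp
    then obtain y where y: "E v y" "0 < wk U u j y"
      by (metis (mono_tags, lifting) less_irrefl mem_Collect_eq neq0_conv sum.neutral)
    then have "y \<in> U" using wk_outside by (metis less_irrefl)
    then have "(y, v) \<in> rel U" using y v sym by (auto simp: rel_def)
    then show ?thesis using Suc.IH[OF y(2)] by simp
  qed (use Suc.IH in blast)
qed

text \<open>A shortest walk of length \<open>d\<close> is padded with \<open>n - d\<close> loop
  steps of \<open>N\<close> choices each. The lower bound is multiplied out because \<open>k\<close>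
  may exceed \<open>n\<close>.\<close>

lemma W_bounds:
  assumes "(u, v) \<in> (rel U)\<^sup>*" "u \<in> U" "U \<subseteq> {..<n}"
  shows "0 < W U u v" "no_path k \<Longrightarrow> N ^ n \<le> W U u v * N ^ k"
proof -
  obtain d where d: "(u, v) \<in> rel U ^^ d" "d < n" "\<And>k. no_path k \<Longrightarrow> d < k"
    by (rule short_walk[OF assms]) blast
  have v: "v \<in> U" using comp_subset[OF assms(2)] assms(1) by (auto simp: comp_def)
  have N: "0 < N" using d(2) by (simp add: N_def)
  have low: "N ^ (n - d) \<le> W U u v"
    using wk_lower[OF d(1) assms(2) v assms(3), of "n - d"] d(2) by simp
  then show "0 < W U u v" using N by (metis gr0I less_le_trans zero_less_power not_less_zero)
  show "N ^ n \<le> W U u v * N ^ k" if "no_path k"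
  proof -
    have "N ^ n = N ^ (n - d) * N ^ d" using d(2) by (simp flip: power_add)
    also have "\<dots> \<le> W U u v * N ^ k"
      using low d(3)[OF that] N by (intro mult_le_mono power_increasing) auto
    finally show ?thesis .
  qed
qed

text \<open>Padding by loops lets walks of length exactly \<open>n\<close> reach the whole
  component. The table that measures gains therefore also finds the components.\<close>

lemma comp_W:
  assumes "u \<in> U" "U \<subseteq> {..<n}"
  shows "comp U u = {v \<in> U. 0 < W U u v}"
  using comp_subset[OF assms(1)] W_bounds(1)[OF _ assms] wk_reach unfolding comp_def by blast

text \<open>
  A walk that meets \<open>\<Union>x\<in>X. S x\<close> is lost from \<open>U - S x\<close> for at least one \<open>x \<in> X\<close>.
\<close>

lemma wk_separation:
  assumes "finite X"
  shows "real (wk U u j v) \<le> real (wk (U - (\<Union>x\<in>X. S x)) u j v) +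
           (\<Sum>x\<in>X. real (wk U u j v) - real (wk (U - S x) u j v))"
proof (induction j arbitrary: v)
  case (0 v)
  show ?case
  proof (cases "\<exists>x\<in>X. v \<in> S x")
    case True
    then obtain x where x: "x \<in> X" "v \<in> S x" by blast
    have "real (wk U u 0 v) - real (wk (U - S x) u 0 v)
      \<le> (\<Sum>x\<in>X. real (wk U u 0 v) - real (wk (U - S x) u 0 v))"
      by (rule member_le_sum[OF x(1)]) (use assms in auto)
    then show ?thesis using x by (auto simp del: sum_subtractf)
  next
    case False
    then show ?thesis by (auto intro!: sum_nonneg)
  qed
next
  case (Suc j v)
  let ?a = "\<lambda>j v. real (wk U u j v)"
  let ?b = "\<lambda>x j v. real (wk (U - S x) u j v)"
  let ?c = "\<lambda>j v. real (wk (U - (\<Union>x\<in>X. S x)) u j v)"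
  have nonneg: "0 \<le> ?a j v - ?b x j v" for x j v
    using wk_mono[of "U - S x" U u j v] by (simp del: wk.simps)
  show ?case
  proof (cases "v \<in> U \<and> (\<forall>x\<in>X. v \<notin> S x)")
    case True
    let ?nb = "{y. y < n \<and> E v y}"
    \<comment> \<open>No \<open>S x\<close> contains \<open>v\<close>, so all the masked counts obey
      the same linear recurrence at \<open>v\<close>, with nonnegative coefficients. The inequality
      for \<open>j\<close> at \<open>v\<close> and at its neighbours adds up to the one for
      \<open>Suc j\<close>.\<close>
    have "?a (Suc j) v = N * ?a j v + (\<Sum>y\<in>?nb. ?a j y)"
      using True by simp
    also have "\<dots> \<le> N * (?c j v + (\<Sum>x\<in>X. ?a j v - ?b x j v)) +
        (\<Sum>y\<in>?nb. ?c j y + (\<Sum>x\<in>X. ?a j y - ?b x j y))"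
      by (intro add_mono mult_left_mono sum_mono Suc.IH) auto
    also have "\<dots> = (N * ?c j v + (\<Sum>y\<in>?nb. ?c j y)) +
        (\<Sum>x\<in>X. N * (?a j v - ?b x j v) + (\<Sum>y\<in>?nb. ?a j y - ?b x j y))"
      unfolding sum.distrib sum_distrib_left[symmetric]
      using sum.swap[of "\<lambda>y x. ?a j y - ?b x j y" X ?nb] by (simp add: algebra_simps)
    also have "N * ?c j v + (\<Sum>y\<in>?nb. ?c j y) = ?c (Suc j) v"
      using True by simp
    also have "(\<Sum>x\<in>X. N * (?a j v - ?b x j v) + (\<Sum>y\<in>?nb. ?a j y - ?b x j y)) =
        (\<Sum>x\<in>X. ?a (Suc j) v - ?b x (Suc j) v)"
      using True by (intro sum.cong) (auto simp: algebra_simps sum_subtractf)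
    finally show ?thesis .
  next
    case False
    show ?thesis
    proof (cases "v \<in> U")
      case True
      then obtain x where x: "x \<in> X" "v \<in> S x" using False by blast
      \<comment> \<open>This \<open>x\<close> deletes \<open>v\<close>, so its summand alone is the
        whole count.\<close>
      have "?a (Suc j) v - ?b x (Suc j) v \<le> (\<Sum>x\<in>X. ?a (Suc j) v - ?b x (Suc j) v)"
        by (rule member_le_sum[OF x(1)]) (use assms nonneg in \<open>auto simp del: wk.simps\<close>)
      moreover have "?b x (Suc j) v = 0" using x by simp
      ultimately show ?thesis by linarith
    qed auto
  qed
qed

text \<open>
  Up to rounding, the term of the sum is \<open>N\<close> times the fraction of the walks that meet \<open>nbh x\<close>.
\<close>

definition gain :: "nat set \<Rightarrow> nat \<Rightarrow> nat" where
  "gain C x = (\<Sum>u\<in>C. \<Sum>v\<in>C. N - N * W (C - nbh x) u v div W C u v)"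

text \<open>\<open>ln W\<close> is shifted so that the lower bound on \<open>W\<close> reads
  \<open>phi \<ge> 1\<close>; a pair that becomes disconnected then loses at least 1, however small
  its count was.\<close>

definition phi :: "nat \<Rightarrow> nat set \<Rightarrow> nat \<Rightarrow> nat \<Rightarrow> real" where
  "phi k U u v = (if W U u v = 0 then 0
     else k * ln N + 1 + ln (W U u v) - n * ln N)"

definition pot :: "nat \<Rightarrow> nat set \<Rightarrow> real" where
  "pot k U = (\<Sum>u\<in>U. \<Sum>v\<in>U. phi k U u v)"

lemma phi_bounds:
  assumes "no_path k" "U \<subseteq> {..<n}" "0 < W U u v"
  shows "1 \<le> phi k U u v" "phi k U u v \<le> k * ln N + 2"
proof -
  have u: "u \<in> U" using assms(3) wk_outside_source by (metis less_irrefl)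
  then have n: "0 < n" using assms(2) by auto
  then have N: "0 < N" by (simp add: N_def)
  have "N ^ n \<le> W U u v * N ^ k"
    using W_bounds(2)[OF wk_reach[OF assms(3)] u assms(2,1)] .
  then have "real N ^ n \<le> real (W U u v) * real N ^ k"
    by (metis of_nat_le_iff of_nat_mult of_nat_power)
  then have "ln (real N ^ n) \<le> ln (real (W U u v) * real N ^ k)"
    using N assms(3) by (subst ln_le_cancel_iff) auto
  then have "n * ln N \<le> ln (W U u v) + k * ln N"
    using N assms(3) by (simp add: ln_mult ln_realpow)
  then show "1 \<le> phi k U u v" using assms(3) by (simp add: phi_def)
  have "real (W U u v) \<le> real (N + n) ^ n"
    using wk_upper[of U u n v] by (metis of_nat_le_iff of_nat_power)
  then have "ln (W U u v) \<le> n * ln (N + n)"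
    using assms(3) n by (metis ln_le_cancel_iff ln_realpow of_nat_0_less_iff trans_less_add2 zero_less_power)
  also have "ln (N + n) = ln N + ln (1 + n / N)"
  proof -
    have "real (N + n) = N * (1 + n / N)" using N by (simp add: field_simps)
    moreover have "1 + real n / N > 0" by (simp add: add_pos_nonneg)
    ultimately show ?thesis using N by (simp add: ln_mult)
  qed
  \<comment> \<open>Here \<open>n * (n / N) = 1 / 4\<close>: the quadratic size of \<open>N\<close>
    keeps the surplus over \<open>N ^ n\<close> constant.\<close>
  also have "n * (ln N + ln (1 + n / N)) \<le> n * (ln N + n / N)"
    by (intro mult_left_mono add_left_mono ln_add_one_self_le_self) auto
  also have "\<dots> \<le> n * ln N + 1"
    using n by (simp add: N_def algebra_simps)
  finally show "phi k U u v \<le> k * ln N + 2" using assms(3) by (simp add: phi_def)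
qed

lemma phi_nonneg: "no_path k \<Longrightarrow> U \<subseteq> {..<n} \<Longrightarrow> 0 \<le> phi k U u v"
  using phi_bounds(1)[of k U u v] by (cases "W U u v = 0") (auto simp: phi_def)

lemma phi_le: "no_path k \<Longrightarrow> U \<subseteq> {..<n} \<Longrightarrow> phi k U u v \<le> k * ln N + 2"
proof (cases "W U u v = 0")
  case True
  then show ?thesis by (cases "N = 0") (auto simp: phi_def intro!: add_nonneg_nonneg mult_nonneg_nonneg)
qed (use phi_bounds(2)[of k U u v] in auto)

text \<open>With \<open>t\<close> the surviving fraction of the walks this is
  \<open>1 - t \<le> - ln t\<close>. If no walk survives, the lost fraction is 1 and
  \<open>phi\<close> falls from at least 1 to 0.\<close>

lemma phi_decrease:
  assumes "no_path k" "U \<subseteq> {..<n}" "U' \<subseteq> U" "0 < W U u v"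
  shows "1 - W U' u v / W U u v \<le> phi k U u v - phi k U' u v"
proof (cases "W U' u v = 0")
  case True
  then show ?thesis using phi_bounds(1)[OF assms(1,2,4)] by (simp add: phi_def)
next
  case False
  then have "ln (W U' u v / W U u v) \<le> W U' u v / W U u v - 1"
    using assms(4) by (intro ln_le_minus_one) auto
  then show ?thesis using False assms(4) by (simp add: phi_def ln_div)
qed

lemma phi_mono:
  assumes "no_path k" "U \<subseteq> {..<n}" "U' \<subseteq> U"
  shows "phi k U' u v \<le> phi k U u v"
proof (cases "W U u v = 0")
  case True
  then have "W U' u v = 0" using wk_mono[OF assms(3), of u n v] by simp
  then show ?thesis using True by (simp add: phi_def)
next
  case False
  then have "W U' u v / W U u v \<le> 1" using wk_mono[OF assms(3), of u n v] by (simp add: field_simps)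
  then show ?thesis using phi_decrease[OF assms, of u v] False by linarith
qed

text \<open>Pairs with an end outside \<open>U'\<close> have \<open>phi = 0\<close> there, so
  potentials of nested sets can be compared term by term.\<close>

lemma pot_extend:
  assumes "U' \<subseteq> U" "finite U"
  shows "pot k U' = (\<Sum>u\<in>U. \<Sum>v\<in>U. phi k U' u v)"
proof -
  have "(\<Sum>v\<in>U'. phi k U' u v) = (\<Sum>v\<in>U. phi k U' u v)" for u
    by (rule sum.mono_neutral_left) (use assms wk_outside in \<open>auto simp: phi_def\<close>)
  moreover have "(\<Sum>u\<in>U'. \<Sum>v\<in>U. phi k U' u v) = (\<Sum>u\<in>U. \<Sum>v\<in>U. phi k U' u v)"
    by (rule sum.mono_neutral_left)
      (use assms wk_outside_source in \<open>auto simp: phi_def intro!: sum.neutral\<close>)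
  ultimately show ?thesis by (simp add: pot_def)
qed

lemma pot_mono:
  assumes "no_path k" "U \<subseteq> {..<n}" "U' \<subseteq> U"
  shows "pot k U' \<le> pot k U"
proof -
  have "finite U" using assms(2) finite_subset by blast
  then show ?thesis unfolding pot_extend[OF assms(3) \<open>finite U\<close>]
    unfolding pot_def by (intro sum_mono phi_mono[OF assms])
qed

lemma pot_nonneg: "no_path k \<Longrightarrow> U \<subseteq> {..<n} \<Longrightarrow> 0 \<le> pot k U"
  unfolding pot_def by (intro sum_nonneg phi_nonneg)

lemma pot_upper:
  assumes "no_path k" "U \<subseteq> {..<n}"
  shows "pot k U \<le> (k * ln N + 2) * (card U)\<^sup>2"
proof -
  have "pot k U \<le> (\<Sum>u\<in>U. \<Sum>v\<in>U. k * ln N + 2)"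
    unfolding pot_def by (intro sum_mono phi_le assms)
  then show ?thesis by (simp add: power2_eq_square algebra_simps)
qed

text \<open>A source deleted by \<open>X\<close> has no walks left, and any other source reaches
  only its own small component. Summed over the sources this gives half of all ordered
  pairs.\<close>

lemma separated_half:
  assumes "balanced C X" "finite C" "u \<in> C"
  defines "S \<equiv> C - (\<Union>x\<in>X. nbh x)"
  shows "card C \<le> 2 * card {v \<in> C. W S u v = 0}"
proof (cases "u \<in> S")
  case False
  then have "{v \<in> C. W S u v = 0} = C" using wk_outside_source by auto
  then show ?thesis by simp
next
  case True
  have "{v \<in> C. W S u v \<noteq> 0} \<subseteq> comp S u"
    using wk_reach[of S u n] by (auto simp: comp_def)
  moreover have "finite (comp S u)"
    using comp_subset[OF True] assms(2) finite_subset unfolding S_def by blast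
  ultimately have "card {v \<in> C. W S u v \<noteq> 0} \<le> card (comp S u)" by (metis card_mono)
  then have "2 * card {v \<in> C. W S u v \<noteq> 0} \<le> card C"
    using assms(1) True unfolding balanced_def S_def[symmetric] by fastforce
  moreover have "card C = card {v \<in> C. W S u v = 0} + card {v \<in> C. W S u v \<noteq> 0}"
    using assms(2) by (subst card_Un_disjoint[symmetric]) (auto intro!: arg_cong[of _ _ card])
  ultimately show ?thesis by linarith
qed

text \<open>Averaging over the separator \<open>X\<close>, which the program never computes. The
  fractions \<open>F y\<close> for \<open>y \<in> X\<close> sum to at least
  \<open>(card C)^2 / 2\<close>, so some \<open>F y\<close> is at least
  \<open>(card C)^2 / (2 * card X)\<close>; since \<open>x\<close> maximizes the rounded gain,
  \<open>F x\<close> is smaller by at most the rounding error.\<close>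

lemma progress:
  assumes C: "conn C" "C \<subseteq> {..<n}" and k: "no_path k"
    and x: "x \<in> C" "\<And>y. y \<in> C \<Longrightarrow> gain C y \<le> gain C x"
  shows "pot k (C - nbh x) \<le> pot k C - (card C)\<^sup>2 / (4 * k)"
proof -
  have finC: "finite C" using C finite_subset by blast
  have Cpos: "0 < card C" using x finC card_gt_0_iff by blast
  have n: "0 < n" using x C by auto
  then have N: "0 < N" by (simp add: N_def)
  obtain X where X: "X \<subseteq> C" "X \<noteq> {}" "card X \<le> k" "balanced C X"
    by (rule gyarfas[OF C(1) _ C(2) k]) (use x in auto)
  have finX: "finite X" using X(1) finC finite_subset by blast
  have Xpos: "0 < card X" using X finX by (simp add: card_gt_0_iff)
  have pos: "0 < W C u v" if "u \<in> C" "v \<in> C" for u v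
    using W_bounds(1)[OF conn_reach[OF C(1) that] that(1) C(2)] .
  define fr where "fr y u v = 1 - W (C - nbh y) u v / W C u v" for y u v
  define F where "F y = (\<Sum>u\<in>C. \<Sum>v\<in>C. fr y u v)" for y
  define q where "q y u v = N - N * W (C - nbh y) u v div W C u v" for y u v
  \<comment> \<open>\<open>q\<close> is \<open>N * fr\<close> rounded up, because the division
    rounds the subtracted part down; the error is at most 1 per pair.\<close>
  have q: "N * fr y u v \<le> real (q y u v)" "real (q y u v) \<le> N * fr y u v + 1"
    if "u \<in> C" "v \<in> C" for y u v
  proof -
    let ?a = "W (C - nbh y) u v" and ?b = "W C u v"
    have b: "0 < ?b" using pos that .
    have "?a \<le> ?b" by (rule wk_mono) auto
    then have "N * ?a div ?b \<le> N" using b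
      by (metis div_le_mono mult_le_mono2 nonzero_mult_div_cancel_right less_irrefl)
    then have "real (q y u v) = N - real (N * ?a div ?b)" by (simp add: q_def of_nat_diff)
    moreover have "real (N * ?a div ?b) \<le> real (N * ?a) / real ?b"
      by (rule of_nat_div_le_of_nat)
    moreover have "real (N * ?a) / real ?b \<le> real (N * ?a div ?b) + 1"
    proof -
      have "N * ?a < ?b + N * ?a div ?b * ?b" using b by (rule dividend_less_div_times)
      then have "real (N * ?a) < ?b + real (N * ?a div ?b) * ?b"
        by (metis of_nat_add of_nat_less_iff of_nat_mult)
      then show ?thesis using b by (simp add: field_simps)
    qed
    ultimately show "N * fr y u v \<le> real (q y u v)" "real (q y u v) \<le> N * fr y u v + 1"
      by (simp_all add: fr_def right_diff_distrib)
  qed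
  have gain: "real (gain C y) = (\<Sum>u\<in>C. \<Sum>v\<in>C. real (q y u v))" for y
    by (simp add: gain_def q_def)
  have gain_lower: "N * F y \<le> gain C y" for y
    unfolding gain F_def sum_distrib_left by (intro sum_mono q)
  have "(\<Sum>u\<in>C. \<Sum>v\<in>C. real (q x u v)) \<le> (\<Sum>u\<in>C. \<Sum>v\<in>C. N * fr x u v + 1)"
    by (intro sum_mono q)
  then have gain_upper: "gain C x \<le> N * F x + (card C)\<^sup>2"
    unfolding gain F_def by (simp add: sum.distrib sum_distrib_left power2_eq_square)
  have Fle: "F y \<le> F x + (card C)\<^sup>2 / N" if "y \<in> X" for y
  proof -
    have "N * F y \<le> N * F x + (card C)\<^sup>2"
      using gain_lower[of y] gain_upper x(2)[of y] that X(1) by (smt (verit) of_nat_le_iff subsetD)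
    then show ?thesis using N by (simp add: field_simps)
  qed
  define S where "S = C - (\<Union>x\<in>X. nbh x)"
  have sep: "(if W S u v = 0 then 1 else 0) \<le> (\<Sum>y\<in>X. fr y u v)" if "u \<in> C" "v \<in> C" for u v
  proof -
    have b: "0 < W C u v" using pos that .
    have nn: "0 \<le> fr y u v" for y
      using wk_mono[of "C - nbh y" C u n v] b by (simp add: fr_def)
    show ?thesis
    proof (cases "W S u v = 0")
      case True
      then have "W C u v \<le> (\<Sum>y\<in>X. real (W C u v) - real (W (C - nbh y) u v))"
        using wk_separation[OF finX, of C u n v nbh] unfolding S_def by simp
      also have "\<dots> = (\<Sum>y\<in>X. W C u v * fr y u v)"
        using b by (intro sum.cong) (auto simp: fr_def right_diff_distrib)
      also have "\<dots> = W C u v * (\<Sum>y\<in>X. fr y u v)" by (simp add: sum_distrib_left)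
      finally show ?thesis using True b by simp
    qed (use nn in \<open>simp add: sum_nonneg\<close>)
  qed
  have "(card C)\<^sup>2 / 2 = (\<Sum>u\<in>C. card C / 2)" by (simp add: power2_eq_square)
  also have "\<dots> \<le> (\<Sum>u\<in>C. real (card {v \<in> C. W S u v = 0}))"
  proof (rule sum_mono)
    fix u assume "u \<in> C"
    then have "real (card C) \<le> real (2 * card {v \<in> C. W S u v = 0})"
      using separated_half[OF X(4) finC] unfolding S_def[symmetric] of_nat_le_iff by blast
    then show "card C / 2 \<le> real (card {v \<in> C. W S u v = 0})" by simp
  qed
  also have "\<dots> = (\<Sum>u\<in>C. \<Sum>v\<in>C. if W S u v = 0 then 1 else 0)"
    using finC by (simp add: sum.If_cases Int_def)
  also have "\<dots> \<le> (\<Sum>u\<in>C. \<Sum>v\<in>C. \<Sum>y\<in>X. fr y u v)"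
    by (intro sum_mono sep)
  also have "\<dots> = (\<Sum>y\<in>X. F y)"
  proof -
    have "(\<Sum>v\<in>C. \<Sum>y\<in>X. fr y u v) = (\<Sum>y\<in>X. \<Sum>v\<in>C. fr y u v)" for u by (rule sum.swap)
    then show ?thesis unfolding F_def by (simp only:) (rule sum.swap)
  qed
  also have "\<dots> \<le> card X * (F x + (card C)\<^sup>2 / N)"
    using sum_bounded_above[of X F] Fle by simp
  finally have "(card C)\<^sup>2 / (2 * card X) \<le> F x + (card C)\<^sup>2 / N"
    using Xpos by (simp add: field_simps)
  \<comment> \<open>\<open>4 * card X \<le> N\<close> is where the factor 4 in \<open>N\<close>
    matters: rounding takes at most half of the averaged gain.\<close>
  moreover have "(card C)\<^sup>2 / N \<le> (card C)\<^sup>2 / (4 * card X)"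
  proof (rule divide_left_mono)
    have "card X \<le> card {..<n}" using X(1) C(2) by (intro card_mono) auto
    also have "\<dots> \<le> n * n" using n by simp
    finally show "real (4 * card X) \<le> real N" unfolding N_def of_nat_le_iff by simp
  qed (use N Xpos in auto)
  moreover have "(card C)\<^sup>2 / (2 * card X) = (card C)\<^sup>2 / (4 * card X) + (card C)\<^sup>2 / (4 * real (card X))"
    by simp
  moreover have "(card C)\<^sup>2 / (4 * real k) \<le> (card C)\<^sup>2 / (4 * card X)"
    using X(3) Xpos by (intro divide_left_mono) auto
  ultimately have "(card C)\<^sup>2 / (4 * real k) \<le> F x" by linarith
  also have "F x \<le> (\<Sum>u\<in>C. \<Sum>v\<in>C. phi k C u v - phi k (C - nbh x) u v)"
    unfolding F_def fr_def by (intro sum_mono phi_decrease[OF k C(2)] pos) auto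
  also have "\<dots> = pot k C - pot k (C - nbh x)"
    unfolding pot_extend[OF Diff_subset finC] by (simp add: pot_def sum_subtractf)
  finally show ?thesis by simp
qed

section \<open>Size levels, the rescaled potential and the cost recurrence\<close>

definition lev :: "nat set \<Rightarrow> nat" where
  "lev U = (LEAST j. card U \<le> 2 ^ j)"

text \<open>
  Dropping to a lower level lets the scaled potential jump back up, but by at most the
  coefficient of \<open>lev\<close>; so \<open>rho\<close> is monotone.
\<close>

definition rho :: "nat \<Rightarrow> nat set \<Rightarrow> real" where
  "rho k U = (k * ln N + 2) * lev U + pot k U / 4 ^ lev U"

text \<open>Taking \<open>x\<close> lowers \<open>rho\<close> by at least
  \<open>1 / (16 * k)\<close>, hence this exponent by at least 1, and the base \<open>4 * n\<close>
  then pays for the factor \<open>4 * card U\<close> of that call. The other two calls are paid by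
  the linear factor itself.\<close>

definition cost_bound :: "nat \<Rightarrow> nat set \<Rightarrow> real" where
  "cost_bound k U = 4 * card U * (4 * real n) powr (16 * k * rho k U) + 1"

text \<open>
  The time of the recursion up to a factor. It is abstracted from \<open>k\<close> because the program, and
  hence the vertex it selects, is the same for all \<open>k\<close>.
\<close>

definition dominates :: "(nat set \<Rightarrow> real) \<Rightarrow> bool" where
  "dominates g \<longleftrightarrow> 1 \<le> g {} \<and>
     (\<forall>U u C x. U \<subseteq> {..<n} \<longrightarrow> u \<in> U \<longrightarrow> C = comp U u \<longrightarrow> x \<in> C \<longrightarrow>
        (\<forall>y\<in>C. gain C y \<le> gain C x) \<longrightarrow>
        1 + g (U - C) + g (C - {x}) + g (C - nbh x) \<le> g U)"

lemma card_le_lev: "card U \<le> 2 ^ lev U"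
  unfolding lev_def by (rule LeastI[of _ "card U"]) simp

lemma lev_le: "card U \<le> 2 ^ j \<Longrightarrow> lev U \<le> j"
  unfolding lev_def by (rule Least_le)

lemma lev_mono: "finite U \<Longrightarrow> U' \<subseteq> U \<Longrightarrow> lev U' \<le> lev U"
  using card_le_lev[of U] card_mono[of U U'] by (intro lev_le) simp

text \<open>By minimality a set at level \<open>j + 1\<close> has more than \<open>2 ^ j\<close>
  elements, so \<open>4 ^ lev U\<close> exceeds the squared size at most by the factor 4.\<close>

lemma lev_lower:
  assumes "0 < card U"
  shows "4 ^ lev U \<le> 4 * (card U)\<^sup>2"
proof (cases "lev U")
  case 0
  then show ?thesis using assms by (simp add: Suc_le_eq)
next
  case (Suc j)
  then have "2 ^ j < card U" using lev_le[of U j] by fastforce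
  then have "(2 ^ j)\<^sup>2 \<le> (card U)\<^sup>2" by (intro power_mono) auto
  moreover have "(2 ^ j :: nat)\<^sup>2 = 4 ^ j" by (simp add: power2_eq_square flip: power_mult_distrib)
  ultimately show ?thesis using Suc by simp
qed

lemma ln_N_nonneg: "0 \<le> ln (real N)"
  by (cases "N = 0") auto

lemma pot_scaled:
  assumes "no_path k" "U \<subseteq> {..<n}"
  shows "pot k U / 4 ^ lev U \<le> k * ln N + 2"
proof -
  have "(card U)\<^sup>2 \<le> (2 ^ lev U)\<^sup>2" using card_le_lev[of U] by (rule power_mono) simp
  also have "(2 ^ lev U :: nat)\<^sup>2 = 4 ^ lev U" by (simp add: power2_eq_square flip: power_mult_distrib)
  finally have "real ((card U)\<^sup>2) \<le> real (4 ^ lev U)" by (simp only: of_nat_le_iff)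
  then have "(k * ln N + 2) * real ((card U)\<^sup>2) \<le> (k * ln N + 2) * 4 ^ lev U"
    using ln_N_nonneg by (intro mult_left_mono) auto
  then have "pot k U \<le> (k * ln N + 2) * 4 ^ lev U" using pot_upper[OF assms] by simp
  then show ?thesis by (simp add: field_simps)
qed

text \<open>On an unchanged level the scaled potential itself drops by \<open>d / 4\<close>. On a
  lower level the term with \<open>lev\<close> loses a full coefficient, which covers the new scaled
  potential, while the old one vanishes; the old one was at least \<open>d / 4\<close> because
  \<open>pot k U'\<close> is nonnegative.\<close>

lemma rho_step:
  fixes d :: real
  assumes k: "no_path k" and U: "U \<subseteq> {..<n}" "U' \<subseteq> U" "0 < card U"
    and d: "pot k U' \<le> pot k U - d * (card U)\<^sup>2" "0 \<le> d"
  shows "rho k U' \<le> rho k U - d / 4"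
proof -
  have finU: "finite U" using U finite_subset by blast
  have U': "U' \<subseteq> {..<n}" using U by simp
  have "real (4 ^ lev U) \<le> real (4 * (card U)\<^sup>2)"
    using lev_lower[OF U(3)] by (simp only: of_nat_le_iff)
  then have s: "d / 4 \<le> d * (card U)\<^sup>2 / 4 ^ lev U"
    using d(2) by (simp add: field_simps mult_left_mono)
  show ?thesis
  proof (cases "lev U' = lev U")
    case True
    have "pot k U' / 4 ^ lev U \<le> (pot k U - d * (card U)\<^sup>2) / 4 ^ lev U"
      by (intro divide_right_mono d) simp
    then show ?thesis using s True by (simp add: rho_def diff_divide_distrib)
  next
    case False
    then have "real (lev U') + 1 \<le> lev U" using lev_mono[OF finU U(2)] by linarith
    then have "(k * ln N + 2) * (real (lev U') + 1) \<le> (k * ln N + 2) * lev U"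
      using ln_N_nonneg by (intro mult_left_mono) auto
    then have "rho k U' \<le> (k * ln N + 2) * lev U"
      using pot_scaled[OF k U'] by (simp add: rho_def algebra_simps)
    moreover have "d * (card U)\<^sup>2 / 4 ^ lev U \<le> pot k U / 4 ^ lev U"
      using d(1) pot_nonneg[OF k U'] by (intro divide_right_mono) auto
    ultimately show ?thesis using s unfolding rho_def[of k U] by linarith
  qed
qed

lemma rho_mono:
  assumes "no_path k" "U \<subseteq> {..<n}" "U' \<subseteq> U"
  shows "rho k U' \<le> rho k U"
proof (cases "card U = 0")
  case True
  then have "U' = U" using assms finite_subset by fastforce
  then show ?thesis by simp
next
  case False
  then show ?thesis using rho_step[OF assms, of 0] pot_mono[OF assms] by simp
qed

lemma rho_nonneg: "no_path k \<Longrightarrow> U \<subseteq> {..<n} \<Longrightarrow> 0 \<le> rho k U"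
  using pot_nonneg ln_N_nonneg unfolding rho_def by simp

text \<open>Every graph contains the empty path, so \<open>no_path 0\<close> is false; the estimates
  below may divide by \<open>k\<close>.\<close>

lemma no_path_pos: "no_path k \<Longrightarrow> 0 < k"
  by (cases k) (auto simp: no_path_def induced_path_def)

text \<open>\<open>U - C\<close> and \<open>C - {x}\<close> together have one vertex less than
  \<open>U\<close>, which frees \<open>4 * Y U\<close>. The call on \<open>C - nbh x\<close> takes
  at most \<open>Y U + 1\<close>, and the additive constants of the four summands fit into the
  remaining \<open>3 * Y U\<close>, as \<open>Y U \<ge> 1\<close>.\<close>

lemma dominates_cost_bound:
  assumes k: "no_path k"
  shows "dominates (cost_bound k)"
  unfolding dominates_def
proof (intro conjI allI impI)
  show "1 \<le> cost_bound k {}" by (simp add: cost_bound_def)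
  fix U u C x
  assume U: "U \<subseteq> {..<n}" "u \<in> U" "C = comp U u" and x: "x \<in> C" "\<forall>y\<in>C. gain C y \<le> gain C x"
  have CU: "C \<subseteq> U" using comp_subset U by simp
  then have Cn: "C \<subseteq> {..<n}" using U by simp
  have finU: "finite U" using U finite_subset by blast
  have finC: "finite C" using Cn finite_subset by blast
  have n: "1 \<le> n" using U by auto
  have Cpos: "0 < card C" using x finC card_gt_0_iff by blast
  define Y where "Y S = (4 * real n) powr (16 * k * rho k S)" for S
  have Ymono: "Y S \<le> Y U" if "S \<subseteq> U" for S
    using rho_mono[OF k U(1) that] n unfolding Y_def by (intro powr_mono mult_left_mono) auto
  have Y1: "1 \<le> Y U"
    using rho_nonneg[OF k U(1)] n unfolding Y_def by (intro ge_one_powr_ge_zero) auto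
  have "pot k (C - nbh x) \<le> pot k C - (card C)\<^sup>2 / (4 * k)"
    using progress[OF _ Cn k x(1)] conn_comp[OF U(2)] U(3) x(2) by simp
  then have "pot k (C - nbh x) \<le> pot k C - 1 / (4 * k) * (card C)\<^sup>2" by simp
  then have "rho k (C - nbh x) \<le> rho k C - 1 / (4 * k) / 4"
    by (intro rho_step[OF k Cn _ Cpos]) auto
  then have "16 * k * rho k (C - nbh x) \<le> 16 * k * (rho k C - 1 / (4 * k) / 4)"
    by (intro mult_left_mono) auto
  also have "\<dots> = 16 * k * rho k C - 1"
    using no_path_pos[OF k] by (simp add: field_simps)
  also have "\<dots> \<le> 16 * k * rho k U - 1"
    using rho_mono[OF k U(1) CU] by (simp add: mult_left_mono)
  finally have "Y (C - nbh x) \<le> (4 * real n) powr (16 * k * rho k U - 1)"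
    using n unfolding Y_def by (intro powr_mono) auto
  also have "\<dots> = Y U / (4 * n)"
    using n unfolding Y_def by (simp add: powr_diff)
  finally have Ys: "4 * n * Y (C - nbh x) \<le> Y U" using n by (simp add: field_simps)
  have "card (C - nbh x) \<le> card {..<n}" using Cn by (intro card_mono) auto
  then have "4 * real (card (C - nbh x)) * Y (C - nbh x) \<le> 4 * real n * Y (C - nbh x)"
    unfolding Y_def by (intro mult_right_mono) auto
  then have c1: "cost_bound k (C - nbh x) \<le> Y U + 1"
    using Ys unfolding cost_bound_def Y_def by (simp add: order_trans)
  have "real (card (C - {x})) = card C - 1"
    using x finC Cpos by (simp add: card_Diff_singleton of_nat_diff)
  moreover have "4 * real (card (C - {x})) * Y (C - {x}) \<le> 4 * real (card (C - {x})) * Y U"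
    using CU by (intro mult_left_mono Ymono) auto
  ultimately have c2: "cost_bound k (C - {x}) \<le> 4 * (card C - 1) * Y U + 1"
    unfolding cost_bound_def Y_def by simp
  have "real (card (U - C)) = real (card U) - card C"
    using CU finC finU by (simp add: card_Diff_subset card_mono of_nat_diff)
  moreover have "4 * real (card (U - C)) * Y (U - C) \<le> 4 * real (card (U - C)) * Y U"
    by (intro mult_left_mono Ymono) auto
  ultimately have c3: "cost_bound k (U - C) \<le> 4 * (real (card U) - card C) * Y U + 1"
    unfolding cost_bound_def Y_def by simp
  have "cost_bound k U = 4 * card U * Y U + 1" by (simp add: cost_bound_def Y_def)
  moreover have "real (card C - 1) = real (card C) - 1" using Cpos by (simp add: of_nat_diff)
  ultimately show "1 + cost_bound k (U - C) + cost_bound k (C - {x}) + cost_bound k (C - nbh x)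
      \<le> cost_bound k U"
    using c1 c2 c3 Y1 by (simp add: algebra_simps)
qed

end

section \<open>For-programs\<close>

text \<open>
  In \<open>FFor x y c\<close> the scalar \<open>x\<close> runs from \<open>0\<close> below the value that \<open>y\<close> has at the start.
\<close>

datatype fcom =
    FSkip
  | FAsg vname aexp aexp
  | FSeq fcom fcom  (infixr ";;" 60)
  | FIf aexp aexp fcom fcom
  | FFor vname vname fcom

primrec compile :: "fcom \<Rightarrow> com" where
  "compile FSkip = Skip"
| "compile (FAsg x a b) = Assign x a b"
| "compile (c ;; d) = Seq (compile c) (compile d)"
| "compile (FIf a b c d) = IfLess a b (compile c) (compile d)"
| "compile (FFor x y c) = Seq (Assign x (Const 0) (Const 0))
     (WhileLess (Read x (Const 0)) (Read y (Const 0))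
       (Seq (compile c) (Assign x (Const 0) (Plus (Read x (Const 0)) (Const 1)))))"

definition incr :: "vname \<Rightarrow> state \<Rightarrow> state" where
  "incr x s = s(x := (s x)(0 := Suc (s x 0)))"

text \<open>With bounded loops only, every command is a total state transformer. Its correctness is
  proved on \<open>sem\<close> alone, and step counts enter only through
  \<open>exec_compile\<close>.\<close>

primrec sem :: "fcom \<Rightarrow> state \<Rightarrow> state" where
  "sem FSkip s = s"
| "sem (FAsg x a b) s = s(x := (s x)(aval a s := aval b s))"
| "sem (c ;; d) s = sem d (sem c s)"
| "sem (FIf a b c d) s = (if aval a s < aval b s then sem c s else sem d s)"
| "sem (FFor x y c) s = ((\<lambda>s. incr x (sem c s)) ^^ s y 0) (s(x := (s x)(0 := 0)))"

primrec mods :: "fcom \<Rightarrow> vname set" where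
  "mods FSkip = {}"
| "mods (FAsg x a b) = {x}"
| "mods (c ;; d) = mods c \<union> mods d"
| "mods (FIf a b c d) = mods c \<union> mods d"
| "mods (FFor x y c) = insert x (mods c)"

primrec bounds :: "fcom \<Rightarrow> vname set" where
  "bounds FSkip = {}"
| "bounds (FAsg x a b) = {}"
| "bounds (c ;; d) = bounds c \<union> bounds d"
| "bounds (FIf a b c d) = bounds c \<union> bounds d"
| "bounds (FFor x y c) = insert y (bounds c)"

primrec wf_for :: "fcom \<Rightarrow> bool" where
  "wf_for FSkip = True"
| "wf_for (FAsg x a b) = True"
| "wf_for (c ;; d) = (wf_for c \<and> wf_for d)"
| "wf_for (FIf a b c d) = (wf_for c \<and> wf_for d)"
| "wf_for (FFor x y c) = (x \<notin> mods c \<and> wf_for c)"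

text \<open>\<open>K\<close> stands for a bound on all loop bounds. A round costs 5 for the test and
  6 for the increment; outside the rounds there are 3 for the reset of the counter and 5 for the
  failing test. Adding both branches of \<open>FIf\<close> avoids a maximum.\<close>

primrec ftime :: "nat \<Rightarrow> fcom \<Rightarrow> nat" where
  "ftime K FSkip = 1"
| "ftime K (FAsg x a b) = acost a + acost b + 1"
| "ftime K (c ;; d) = ftime K c + ftime K d"
| "ftime K (FIf a b c d) = acost a + acost b + 1 + ftime K c + ftime K d"
| "ftime K (FFor x y c) = K * (ftime K c + 11) + 8"

lemma sem_frame: "y \<notin> mods c \<Longrightarrow> sem c s y = s y"
proof (induction c arbitrary: s)
  case (FFor x z c)
  have "((\<lambda>s. incr x (sem c s)) ^^ i) s' y = s' y" for i s'
    by (induction i) (use FFor in \<open>auto simp: incr_def\<close>)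
  then show ?case using FFor.prems by simp
qed auto

text \<open>The compiled loop reads its bound again at each test, whereas \<open>sem\<close> reads
  it once; they agree because no loop bound is ever assigned.\<close>

lemma exec_compile:
  assumes "wf_for c" "bounds c \<inter> mods c = {}" "\<And>y. y \<in> bounds c \<Longrightarrow> s y 0 \<le> K"
  shows "\<exists>t\<le>ftime K c. exec P (compile c) s t (sem c s)"
  using assms
proof (induction c arbitrary: s)
  case FSkip
  show ?case using exec.Skip[of P s] by (intro exI[of _ 1]) simp
next
  case (FAsg x a b)
  show ?case using exec.Assign[of P x a b s]
    by (intro exI[of _ "acost a + acost b + 1"]) (simp del: fun_upd_apply)
next
  case (FSeq c d)
  obtain t where t: "t \<le> ftime K c" "exec P (compile c) s t (sem c s)"
    using FSeq.IH(1)[of s] FSeq.prems by auto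
  have "\<exists>t\<le>ftime K d. exec P (compile d) (sem c s) t (sem d (sem c s))"
  proof (rule FSeq.IH(2))
    fix y assume "y \<in> bounds d"
    moreover from this have "y \<notin> mods c" using FSeq.prems(2) by auto
    ultimately show "sem c s y 0 \<le> K" using FSeq.prems(3) sem_frame[of y c s] by simp
  qed (use FSeq.prems in auto)
  then obtain u where u: "u \<le> ftime K d" "exec P (compile d) (sem c s) u (sem d (sem c s))"
    by blast
  show ?case using exec.Seq[OF t(2) u(2)] t(1) u(1) by (auto intro: add_mono)
next
  case (FIf a b c d)
  obtain t where t: "t \<le> ftime K c" "exec P (compile c) s t (sem c s)"
    using FIf.IH(1)[of s] FIf.prems by auto
  obtain u where u: "u \<le> ftime K d" "exec P (compile d) s u (sem d s)"
    using FIf.IH(2)[of s] FIf.prems by auto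
  show ?case
  proof (cases "aval a s < aval b s")
    case True
    then show ?thesis using exec.IfTrue[OF True t(2)] t(1)
      by (intro exI[of _ "acost a + acost b + 1 + t"]) simp
  next
    case False
    then show ?thesis using exec.IfFalse[OF False u(2)] u(1)
      by (intro exI[of _ "acost a + acost b + 1 + u"]) simp
  qed
next
  case (FFor x y c)
  let ?while = "WhileLess (Read x (Const 0)) (Read y (Const 0))
       (Seq (compile c) (Assign x (Const 0) (Plus (Read x (Const 0)) (Const 1))))"
  define m where "m = s y 0"
  have xy: "x \<noteq> y" "y \<notin> mods c" and x: "x \<notin> mods c" using FFor.prems by auto
  have loop: "\<exists>t\<le>i * (ftime K c + 11) + 5. exec P ?while s' t (((\<lambda>s. incr x (sem c s)) ^^ i) s')"
    if "i \<le> m" "s' x 0 = m - i" "\<forall>z\<in>insert y (bounds c). s' z 0 = s z 0" for i s'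
    using that
  proof (induction i arbitrary: s')
    case 0
    then have "\<not> aval (Read x (Const 0)) s' < aval (Read y (Const 0)) s'" by (simp add: m_def)
    from exec.WhileFalse[OF this] show ?case by (intro exI[of _ 5]) (simp add: eval_nat_numeral)
  next
    case (Suc i)
    have less: "aval (Read x (Const 0)) s' < aval (Read y (Const 0)) s'"
      using Suc.prems by (simp add: m_def)
    have "\<exists>t\<le>ftime K c. exec P (compile c) s' t (sem c s')"
      by (rule FFor.IH) (use FFor.prems Suc.prems in auto)
    then obtain t where t: "t \<le> ftime K c" "exec P (compile c) s' t (sem c s')" by blast
    let ?body = "Seq (compile c) (Assign x (Const 0) (Plus (Read x (Const 0)) (Const 1)))"
    have body: "exec P ?body s' (t + 6) (incr x (sem c s'))"
      using exec.Seq[OF t(2) exec.Assign[of P x "Const 0" "Plus (Read x (Const 0)) (Const 1)"]]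
      by (simp add: incr_def eval_nat_numeral)
    have "\<exists>u\<le>i * (ftime K c + 11) + 5. exec P ?while (incr x (sem c s')) u
        (((\<lambda>s. incr x (sem c s)) ^^ i) (incr x (sem c s')))"
    proof (rule Suc.IH)
      show "incr x (sem c s') x 0 = m - i"
        using Suc.prems sem_frame[OF x, of s'] by (simp add: incr_def)
      have "z \<noteq> x \<and> z \<notin> mods c" if "z \<in> insert y (bounds c)" for z
        using FFor.prems that by auto
      then show "\<forall>z\<in>insert y (bounds c). incr x (sem c s') z 0 = s z 0"
        using Suc.prems(3) sem_frame[of _ c s'] by (auto simp: incr_def)
    qed (use Suc.prems in simp)
    then obtain u where u: "u \<le> i * (ftime K c + 11) + 5" "exec P ?while (incr x (sem c s')) u
        (((\<lambda>s. incr x (sem c s)) ^^ i) (incr x (sem c s')))" by blast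
    have "exec P ?while s' (5 + (t + 6) + u) (((\<lambda>s. incr x (sem c s)) ^^ Suc i) s')"
      using exec.WhileTrue[OF less body u(2)] by (simp add: funpow_Suc_right eval_nat_numeral del: funpow.simps)
    moreover have "5 + (t + 6) + u \<le> Suc i * (ftime K c + 11) + 5" using t(1) u(1) by simp
    ultimately show ?case by blast
  qed
  let ?s = "s(x := (s x)(0 := 0))"
  have "\<exists>t\<le>m * (ftime K c + 11) + 5. exec P ?while ?s t (((\<lambda>s. incr x (sem c s)) ^^ m) ?s)"
    by (rule loop) (use FFor.prems xy in auto)
  then obtain t where t: "t \<le> m * (ftime K c + 11) + 5"
    "exec P ?while ?s t (((\<lambda>s. incr x (sem c s)) ^^ m) ?s)" by blast
  have "exec P (compile (FFor x y c)) s (3 + t) (sem (FFor x y c) s)"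
    using exec.Seq[OF exec.Assign[of P x "Const 0" "Const 0" s], of ?while t] t(2)
    by (simp add: m_def eval_nat_numeral)
  moreover have "m * (ftime K c + 11) \<le> K * (ftime K c + 11)"
    using FFor.prems(3)[of y] unfolding m_def by (intro mult_le_mono1) simp
  then have "3 + t \<le> ftime K (FFor x y c)" using t(1) unfolding ftime.simps by linarith
  ultimately show ?case by blast
qed

text \<open>The counter value and the unassigned names are supplied by the rule, so \<open>I\<close>
  only has to describe what the loop changes.\<close>

lemma sem_For:
  assumes "x \<notin> mods c" "s y 0 = m" "x \<noteq> y"
    and "I 0 (s(x := (s x)(0 := 0)))"
    and "\<And>i s'. i < m \<Longrightarrow> I i s' \<Longrightarrow> s' x 0 = i \<Longrightarrow>
           (\<And>z. z \<notin> insert x (mods c) \<Longrightarrow> s' z = s z) \<Longrightarrow>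
           I (Suc i) ((sem c s')(x := (s' x)(0 := Suc i)))"
  shows "I m (sem (FFor x y c) s)"
proof -
  let ?s = "s(x := (s x)(0 := 0))"
  define f where "f i = ((\<lambda>s. incr x (sem c s)) ^^ i) ?s" for i
  have f_Suc: "f (Suc i) = incr x (sem c (f i))" for i by (simp add: f_def)
  have "I i (f i) \<and> f i x 0 = i \<and> (\<forall>z. z \<notin> insert x (mods c) \<longrightarrow> f i z = s z)" if "i \<le> m" for i
    using that
  proof (induction i)
    case 0
    have eq: "f 0 = ?s" by (simp add: f_def)
    have "I 0 (f 0)" unfolding eq by (rule assms(4))
    moreover have "f 0 x 0 = 0" "\<forall>z. z \<notin> insert x (mods c) \<longrightarrow> f 0 z = s z"
      by (simp_all add: eq)
    ultimately show ?case by (intro conjI)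
  next
    case (Suc i)
    have "sem c (f i) x = f i x" using assms(1) by (rule sem_frame)
    then have eq: "f (Suc i) = (sem c (f i))(x := (f i x)(0 := Suc i))"
      using Suc f_Suc by (simp add: incr_def)
    have "I (Suc i) (f (Suc i))" unfolding eq by (rule assms(5)) (use Suc in auto)
    moreover have "f (Suc i) x 0 = Suc i" "\<forall>z. z \<notin> insert x (mods c) \<longrightarrow> f (Suc i) z = s z"
      using Suc sem_frame[of _ c "f i"] by (simp_all add: eq)
    ultimately show ?case by (intro conjI)
  qed
  from this[of m] show ?thesis using assms(2,3) by (simp add: f_def)
qed

text \<open>The base \<open>K + 2\<close> is at least 2 even for \<open>K = 0\<close>, so every
  constant is absorbed by a larger exponent, which depends on the command alone.\<close>

lemma ftime_poly: "\<exists>e. \<forall>K. ftime K c \<le> (K + 2) ^ e"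
proof (induction c)
  case FSkip
  show ?case by (intro exI[of _ 0]) simp
next
  case (FAsg x a b)
  have "acost a + acost b + 1 \<le> (K + 2) ^ (acost a + acost b + 1)" for K
    using less_exp[of "acost a + acost b + 1"] power_mono[of 2 "K + 2" "acost a + acost b + 1"]
    by linarith
  then show ?case by (metis ftime.simps(2))
next
  case (FSeq c d)
  then obtain e f where ef: "\<And>K. ftime K c \<le> (K + 2) ^ e" "\<And>K. ftime K d \<le> (K + 2) ^ f" by blast
  have "ftime K (c ;; d) \<le> (K + 2) ^ Suc (e + f)" for K
  proof -
    have "(K + 2) ^ e \<le> (K + 2) ^ (e + f)" "(K + 2) ^ f \<le> (K + 2) ^ (e + f)"
      by (intro power_increasing; simp)+
    then have "ftime K (c ;; d) \<le> 2 * (K + 2) ^ (e + f)"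
      using ef(1)[of K] ef(2)[of K] unfolding ftime.simps by linarith
    also have "\<dots> \<le> (K + 2) * (K + 2) ^ (e + f)" by (intro mult_le_mono1) simp
    finally show ?thesis by simp
  qed
  then show ?case by blast
next
  case (FIf a b c d)
  then obtain e f where ef: "\<And>K. ftime K c \<le> (K + 2) ^ e" "\<And>K. ftime K d \<le> (K + 2) ^ f" by blast
  define g where "g = acost a + acost b + 1"
  have "ftime K (FIf a b c d) \<le> (K + 2) ^ (2 + (e + f + g))" for K
  proof -
    have "(K + 2) ^ e \<le> (K + 2) ^ (e + f + g)" "(K + 2) ^ f \<le> (K + 2) ^ (e + f + g)"
      "(K + 2) ^ g \<le> (K + 2) ^ (e + f + g)"
      by (intro power_increasing; simp)+
    moreover have "g \<le> (K + 2) ^ g"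
      using less_exp[of g] power_mono[of 2 "K + 2" g] by linarith
    ultimately have "ftime K (FIf a b c d) \<le> 4 * (K + 2) ^ (e + f + g)"
      using ef(1)[of K] ef(2)[of K] unfolding ftime.simps g_def[symmetric] by linarith
    also have "\<dots> \<le> (K + 2) ^ 2 * (K + 2) ^ (e + f + g)"
      using power_mono[of 2 "K + 2" 2] by (intro mult_le_mono1) simp
    finally show ?thesis by (simp only: power_add)
  qed
  then show ?case by blast
next
  case (FFor x y c)
  then obtain e where e: "\<And>K. ftime K c \<le> (K + 2) ^ e" by blast
  have "ftime K (FFor x y c) \<le> (K + 2) ^ (Suc 5 + e)" for K
  proof -
    have p: "1 \<le> (K + 2) ^ e" by simp
    have "ftime K (FFor x y c) \<le> K * ((K + 2) ^ e + 11) + 8" using e[of K] by simp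
    also have "\<dots> \<le> K * (12 * (K + 2) ^ e) + 8 * (K + 2) ^ e"
      using p by (intro add_mono mult_le_mono2) linarith+
    also have "\<dots> \<le> (12 * (K + 2)) * (K + 2) ^ e" by (simp add: algebra_simps)
    also have "\<dots> \<le> (K + 2) ^ Suc 5 * (K + 2) ^ e"
    proof (rule mult_le_mono1)
      have "12 * (K + 2) \<le> 2 ^ 5 * (K + 2)" by simp
      also have "\<dots> \<le> (K + 2) ^ 5 * (K + 2)" by (intro mult_le_mono1 power_mono) auto
      finally show "12 * (K + 2) \<le> (K + 2) ^ Suc 5" unfolding power_Suc2 .
    qed
    finally show ?thesis by (simp only: power_add)
  qed
  then show ?case by blast
qed

section \<open>Selecting the branching vertex\<close>

declare sem.simps(5) [simp del]

text \<open>The step may still read the cells of \<open>arr\<close> that are not yet written. This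
  is what loops need that copy or rewrite rows within the single array \<open>U\<close>.\<close>

lemma sem_For_array:
  assumes "x \<notin> mods c" "s y 0 = m" "x \<noteq> y" "x \<noteq> arr"
    and step: "\<And>i s'. i < m \<Longrightarrow> s' x 0 = i \<Longrightarrow>
      (\<And>z. z \<notin> insert x (mods c) \<Longrightarrow> s' z = s z) \<Longrightarrow>
      (\<And>p. p < off \<or> off + i \<le> p \<Longrightarrow> s' arr p = s arr p) \<Longrightarrow>
      sem c s' arr = (s' arr)(off + i := f i)"
  shows "sem (FFor x y c) s arr p = (if off \<le> p \<and> p < off + m then f (p - off) else s arr p)"
proof -
  define I where
    "I i s' \<longleftrightarrow> (\<forall>p. s' arr p = (if off \<le> p \<and> p < off + i then f (p - off) else s arr p))"
    for i :: nat and s' :: state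
  have "I m (sem (FFor x y c) s)"
  proof (rule sem_For[where I = I])
    show "I 0 (s(x := (s x)(0 := 0)))" using assms(4) by (auto simp: I_def)
    fix i s'
    assume s': "i < m" "I i s'" "s' x 0 = i" "\<And>z. z \<notin> insert x (mods c) \<Longrightarrow> s' z = s z"
    have "sem c s' arr = (s' arr)(off + i := f i)"
      by (rule step[OF s'(1,3,4)]) (use s'(2) in \<open>auto simp: I_def\<close>)
    then show "I (Suc i) ((sem c s')(x := (s' x)(0 := Suc i)))"
      using s'(2) assms(4) by (auto simp: I_def)
  qed (use assms in auto)
  then show ?thesis by (simp add: I_def)
qed

abbreviation sc :: "vname \<Rightarrow> aexp" where
  "sc x \<equiv> Read x (Const 0)"

abbreviation set_sc :: "vname \<Rightarrow> aexp \<Rightarrow> fcom" where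
  "set_sc x a \<equiv> FAsg x (Const 0) a"

text \<open>
  Multiplication is not available, so \<open>row\<close> holds a table of the multiples of \<open>n\<close>. The array \<open>U\<close>
  is a stack: its row \<open>d\<close> is the characteristic vector of the vertex set at recursion depth \<open>d\<close>.
\<close>

abbreviation at_row :: "aexp \<Rightarrow> aexp \<Rightarrow> aexp" where
  "at_row r a \<equiv> Plus (Read ''row'' r) a"

abbreviation inc_sc :: "vname \<Rightarrow> aexp" where
  "inc_sc x \<equiv> Plus (sc x) (Const 1)"

definition add_loops :: fcom where
  "add_loops = FFor ''i'' ''N'' (set_sc ''t'' (Plus (sc ''t'') (Read ''a'' (sc ''v''))))"

definition add_neighbours :: fcom where
  "add_neighbours = FFor ''y'' ''n'' (FIf (Const 0) (Read ''adj'' (at_row (sc ''v'') (sc ''y'')))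
     (set_sc ''t'' (Plus (sc ''t'') (Read ''a'' (sc ''y'')))) FSkip)"

definition walk_cell :: fcom where
  "walk_cell = set_sc ''t'' (Const 0) ;;
     FIf (Const 0) (Read ''m'' (sc ''v'')) (add_loops ;; add_neighbours) FSkip ;;
     FAsg ''c'' (sc ''v'') (sc ''t'')"

definition walk :: fcom where
  "walk = FFor ''v'' ''n'' (FAsg ''a'' (sc ''v'') (Const 0)) ;;
     FAsg ''a'' (sc ''u'') (Read ''m'' (sc ''u'')) ;;
     FFor ''j'' ''n'' (FFor ''v'' ''n'' walk_cell ;;
       FFor ''v'' ''n'' (FAsg ''a'' (sc ''v'') (Read ''c'' (sc ''v''))))"

definition load_mask :: fcom where
  "load_mask = FFor ''v'' ''n'' (FAsg ''m'' (sc ''v'') (Read ''U'' (at_row (sc ''d'') (sc ''v''))))"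

definition load_mask_nbh :: fcom where
  "load_mask_nbh = FFor ''v'' ''n''
     (FIf (Const 0) (Read ''adj'' (at_row (sc ''x'') (sc ''v'')))
       (FAsg ''m'' (sc ''v'') (Const 0))
       (FAsg ''m'' (sc ''v'') (Read ''U'' (at_row (sc ''d'') (sc ''v''))))) ;;
     FAsg ''m'' (sc ''x'') (Const 0)"

text \<open>
  Since \<open>e \<le> a\<close>, each of the \<open>N\<close> additions of \<open>e\<close> is followed by at most one subtraction of \<open>a\<close>;
  the number of subtractions is \<open>N * e div a\<close>, and \<open>g\<close> counts the other rounds.
\<close>

definition add_gain :: fcom where
  "add_gain = set_sc ''t'' (Const 0) ;;
     FFor ''i'' ''N'' (set_sc ''t'' (Plus (sc ''t'') (Read ''e'' (sc ''v''))) ;;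
       FIf (sc ''t'') (Read ''a'' (sc ''v'')) (set_sc ''g'' (inc_sc ''g''))
         (set_sc ''t'' (Minus (sc ''t'') (Read ''a'' (sc ''v'')))))"

definition source_gain :: fcom where
  "source_gain = load_mask_nbh ;; walk ;;
     FFor ''v'' ''n'' (FAsg ''e'' (sc ''v'') (Read ''a'' (sc ''v''))) ;;
     load_mask ;; walk ;;
     FFor ''v'' ''n'' (FIf (Const 0) (Read ''U'' (at_row (sc ''d'') (sc ''v''))) add_gain FSkip)"

definition vertex_gain :: fcom where
  "vertex_gain = set_sc ''g'' (Const 0) ;;
     FFor ''u'' ''n'' (FIf (Const 0) (Read ''U'' (at_row (sc ''d'') (sc ''u''))) source_gain FSkip)"

text \<open>Comparing \<open>best\<close> with \<open>g + 1\<close> also accepts equality, so the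
  first vertex is taken without knowing that its gain is positive.\<close>

definition select :: fcom where
  "select = set_sc ''best'' (Const 0) ;;
     FFor ''x'' ''n'' (FIf (Const 0) (Read ''U'' (at_row (sc ''d'') (sc ''x'')))
       (vertex_gain ;;
        FIf (sc ''best'') (inc_sc ''g'')
          (set_sc ''best'' (sc ''g'') ;; set_sc ''bx'' (sc ''x'')) FSkip)
       FSkip)"

lemma mods_defs:
  "mods add_loops = {''i'', ''t''}" "mods add_neighbours = {''y'', ''t''}"
  "mods walk_cell = {''t'', ''i'', ''y'', ''c''}"
  "mods walk = {''v'', ''a'', ''j'', ''t'', ''i'', ''y'', ''c''}"
  "mods load_mask = {''v'', ''m''}" "mods load_mask_nbh = {''v'', ''m''}"
  "mods add_gain = {''t'', ''i'', ''g''}"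
  "mods source_gain = {''v'', ''m'', ''a'', ''j'', ''t'', ''i'', ''y'', ''c'', ''e'', ''g''}"
  "mods vertex_gain = {''u'', ''v'', ''m'', ''a'', ''j'', ''t'', ''i'', ''y'', ''c'', ''e'', ''g''}"
  "mods select = {''x'', ''best'', ''bx'', ''u'', ''v'', ''m'', ''a'', ''j'', ''t'', ''i'', ''y'', ''c'', ''e'', ''g''}"
  by (auto simp: add_loops_def add_neighbours_def walk_cell_def walk_def load_mask_def
      load_mask_nbh_def add_gain_def source_gain_def vertex_gain_def select_def)

lemma sem_add_loops:
  "sem add_loops s ''t'' 0 = s ''t'' 0 + s ''N'' 0 * s ''a'' (s ''v'' 0)"
  unfolding add_loops_def
  by (rule sem_For[where I = "\<lambda>i s'. s' ''t'' 0 = s ''t'' 0 + i * s ''a'' (s ''v'' 0)"]) auto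

lemma sum_less_Suc:
  fixes f :: "nat \<Rightarrow> nat"
  assumes "finite C"
  shows "(\<Sum>v | v \<in> C \<and> v < Suc i. f v) = (\<Sum>v | v \<in> C \<and> v < i. f v) + (if i \<in> C then f i else 0)"
proof (cases "i \<in> C")
  case True
  then have "{v. v \<in> C \<and> v < Suc i} = insert i {v. v \<in> C \<and> v < i}" by auto
  then show ?thesis using True assms by simp
next
  case False
  then have "{v. v \<in> C \<and> v < Suc i} = {v. v \<in> C \<and> v < i}" by (auto simp: less_Suc_eq)
  then show ?thesis using False by simp
qed

lemma sum_less_n: "C \<subseteq> {..<n} \<Longrightarrow> {v. v \<in> C \<and> v < n} = (C :: nat set)"
  by auto

section \<open>Correctness of the walk tables and of the selected vertex\<close>

context nat_graph
begin

text \<open>The table \<open>row\<close> includes entry \<open>n\<close>, because a call at depth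
  \<open>n - 1\<close> passes its arguments in row \<open>n\<close>.\<close>

definition glob :: "(nat \<Rightarrow> nat) \<Rightarrow> state \<Rightarrow> bool" where
  "glob w s \<longleftrightarrow> s ''n'' 0 = n \<and> s ''N'' 0 = N \<and> (\<forall>i\<le>n. s ''row'' i = i * n) \<and>
     (\<forall>v<n. \<forall>y<n. 0 < s ''adj'' (v * n + y) \<longleftrightarrow> E v y) \<and> (\<forall>v<n. s ''w'' v = w v)"

lemma glob_frame:
  assumes "glob w s" "\<And>z. z \<in> {''n'', ''N'', ''row'', ''adj'', ''w''} \<Longrightarrow> s' z = s z"
  shows "glob w s'"
  using assms(1) unfolding glob_def by (simp add: assms(2))

definition mask :: "nat \<Rightarrow> state \<Rightarrow> nat set \<Rightarrow> bool" where
  "mask d s C \<longleftrightarrow> C \<subseteq> {..<n} \<and> (\<forall>v<n. s ''U'' (d * n + v) = (if v \<in> C then 1 else 0))"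

definition mask_m :: "state \<Rightarrow> nat set \<Rightarrow> bool" where
  "mask_m s M \<longleftrightarrow> (\<forall>v<n. s ''m'' v = (if v \<in> M then 1 else 0))"

lemma sem_add_neighbours:
  assumes "glob w s" "s ''v'' 0 < n"
  shows "sem add_neighbours s ''t'' 0 = s ''t'' 0 + (\<Sum>y | y < n \<and> E (s ''v'' 0) y. s ''a'' y)"
proof -
  let ?v = "s ''v'' 0"
  define A where "A = {y. y < n \<and> E ?v y}"
  have finA: "finite A" by (simp add: A_def)
  have "sem add_neighbours s ''t'' 0 = s ''t'' 0 + (\<Sum>y | y \<in> A \<and> y < n. s ''a'' y)"
    unfolding add_neighbours_def
  proof (rule sem_For[where I = "\<lambda>i s'. s' ''t'' 0 = s ''t'' 0 + (\<Sum>y | y \<in> A \<and> y < i. s ''a'' y)"])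
    fix i s'
    assume s': "i < n" "s' ''t'' 0 = s ''t'' 0 + (\<Sum>y | y \<in> A \<and> y < i. s ''a'' y)" "s' ''y'' 0 = i"
      "\<And>z. z \<notin> insert ''y'' (mods (FIf (Const 0) (Read ''adj'' (at_row (sc ''v'') (sc ''y'')))
     (set_sc ''t'' (Plus (sc ''t'') (Read ''a'' (sc ''y'')))) FSkip)) \<Longrightarrow> s' z = s z"
    have eqs: "s' ''v'' = s ''v''" "s' ''adj'' = s ''adj''" "s' ''row'' = s ''row''" "s' ''a'' = s ''a''"
      by (rule s'(4); simp)+
    have "0 < s ''adj'' (s ''row'' ?v + i) \<longleftrightarrow> i \<in> A"
      using assms s'(1) by (simp add: glob_def A_def)
    then show "((sem (FIf (Const 0) (Read ''adj'' (at_row (sc ''v'') (sc ''y'')))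
     (set_sc ''t'' (Plus (sc ''t'') (Read ''a'' (sc ''y'')))) FSkip) s')
      (''y'' := (s' ''y'')(0 := Suc i))) ''t'' 0 = s ''t'' 0 + (\<Sum>y | y \<in> A \<and> y < Suc i. s ''a'' y)"
      using s'(1-3) by (simp add: sum_less_Suc[OF finA] eqs)
  qed (use assms in \<open>auto simp: glob_def\<close>)
  moreover have "{y. y \<in> A \<and> y < n} = A" by (auto simp: A_def)
  ultimately show ?thesis by (simp add: A_def)
qed

lemma sem_walk_cell:
  assumes "glob w s" "mask_m s M" "s ''v'' 0 = v" "v < n" "\<forall>y<n. s ''a'' y = wk M u j y"
  shows "sem walk_cell s ''c'' = (s ''c'')(v := wk M u (Suc j) v)"
proof -
  let ?s0 = "s(''t'' := (s ''t'')(0 := 0))"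
  let ?s1 = "sem add_loops ?s0"
  let ?s2 = "sem add_neighbours ?s1"
  have m: "s ''m'' v = (if v \<in> M then 1 else 0)" using assms by (simp add: mask_m_def)
  have g0: "glob w ?s0" by (rule glob_frame[OF assms(1)]) auto
  have g1: "glob w ?s1" by (rule glob_frame[OF g0]) (auto simp: sem_frame mods_defs)
  have t1: "?s1 ''t'' 0 = N * wk M u j v"
    using assms by (simp add: sem_add_loops glob_def)
  have "?s2 ''t'' 0 = N * wk M u j v + (\<Sum>y | y < n \<and> E v y. s ''a'' y)"
    using sem_add_neighbours[OF g1] t1 assms(3,4) by (simp add: sem_frame mods_defs)
  also have "(\<Sum>y | y < n \<and> E v y. s ''a'' y) = (\<Sum>y | y < n \<and> E v y. wk M u j y)"
    using assms(5) by (intro sum.cong) auto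
  finally have t2: "?s2 ''t'' 0 = N * wk M u j v + (\<Sum>y | y < n \<and> E v y. wk M u j y)" .
  show ?thesis
  proof (cases "v \<in> M")
    case True
    then show ?thesis using m t2 assms(3)
      by (simp add: walk_cell_def sem_frame mods_defs)
  next
    case False
    then show ?thesis using m assms(3) by (simp add: walk_cell_def)
  qed
qed

lemma sem_walk:
  assumes g: "glob w s" and m: "mask_m s M" and u: "s ''u'' 0 = u" "u < n" and v: "v < n"
  shows "sem walk s ''a'' v = W M u v"
proof -
  let ?z = "FFor ''v'' ''n'' (FAsg ''a'' (sc ''v'') (Const 0))"
  let ?b = "FAsg ''a'' (sc ''u'') (Read ''m'' (sc ''u''))"
  let ?cells = "FFor ''v'' ''n'' walk_cell"
  let ?copy = "FFor ''v'' ''n'' (FAsg ''a'' (sc ''v'') (Read ''c'' (sc ''v'')))"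
  define s1 where "s1 = sem ?b (sem ?z s)"
  have n: "s ''n'' 0 = n" using g by (simp add: glob_def)
  have z: "sem ?z s ''a'' p = (if 0 \<le> p \<and> p < 0 + n then 0 else s ''a'' p)" for p
    by (rule sem_For_array) (use n in auto)
  have a1: "\<forall>v<n. s1 ''a'' v = wk M u 0 v"
    using z m u by (auto simp: s1_def sem_frame mask_m_def)
  have fr1: "s1 z = s z" if "z \<notin> {''v'', ''a''}" for z
    using that by (simp add: s1_def sem_frame)
  have g1: "glob w s1" by (rule glob_frame[OF g]) (auto simp: fr1)
  have m1: "mask_m s1 M" using m by (simp add: mask_m_def fr1)
  have "\<forall>v<n. sem (FFor ''j'' ''n'' (?cells ;; ?copy)) s1 ''a'' v = wk M u n v"
  proof (rule sem_For[where I = "\<lambda>j s'. \<forall>v<n. s' ''a'' v = wk M u j v"])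
    fix j s'
    assume s': "j < n" "\<forall>v<n. s' ''a'' v = wk M u j v" "s' ''j'' 0 = j"
      "\<And>z. z \<notin> insert ''j'' (mods (?cells ;; ?copy)) \<Longrightarrow> s' z = s1 z"
    have g': "glob w s'" by (rule glob_frame[OF g1]) (rule s'(4), auto simp: mods_defs)
    have n': "s' ''n'' 0 = n" using g' by (simp add: glob_def)
    have m': "mask_m s' M"
    proof -
      have "s' ''m'' = s1 ''m''" by (rule s'(4)) (simp add: mods_defs)
      then show ?thesis using m1 by (simp add: mask_m_def)
    qed
    have c: "sem ?cells s' ''c'' p = (if 0 \<le> p \<and> p < 0 + n then wk M u (Suc j) (p - 0) else s' ''c'' p)" for p
    proof (rule sem_For_array)
      fix i r
      assume r: "i < n" "r ''v'' 0 = i" "\<And>z. z \<notin> insert ''v'' (mods walk_cell) \<Longrightarrow> r z = s' z"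
      have "glob w r" by (rule glob_frame[OF g']) (rule r(3), auto simp: mods_defs)
      moreover have "mask_m r M" "\<forall>y<n. r ''a'' y = wk M u j y"
        using m' s'(2) r(3) by (auto simp: mask_m_def mods_defs)
      ultimately show "sem walk_cell r ''c'' = (r ''c'')(0 + i := wk M u (Suc j) i)"
        using sem_walk_cell r(1,2) by simp
    qed (use n' in \<open>auto simp: mods_defs\<close>)
    have "sem ?copy (sem ?cells s') ''a'' p =
      (if 0 \<le> p \<and> p < 0 + n then sem ?cells s' ''c'' (p - 0) else sem ?cells s' ''a'' p)" for p
      by (rule sem_For_array) (use n' in \<open>auto simp: sem_frame mods_defs\<close>)
    then show "\<forall>v<n. ((sem (?cells ;; ?copy) s')(''j'' := (s' ''j'')(0 := Suc j))) ''a'' v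
        = wk M u (Suc j) v"
      using c by (simp del: wk.simps)
  qed (use n a1 fr1 in \<open>auto simp: mods_defs simp del: wk.simps\<close>)
  then show ?thesis using v by (simp add: walk_def s1_def)
qed

lemma sem_load_mask:
  assumes "glob w s" "s ''d'' 0 = d" "d \<le> n" "mask d s C"
  shows "mask_m (sem load_mask s) C"
proof -
  have "sem load_mask s ''m'' p =
    (if 0 \<le> p \<and> p < 0 + n then s ''U'' (d * n + (p - 0)) else s ''m'' p)" for p
    unfolding load_mask_def
    by (rule sem_For_array) (use assms in \<open>auto simp: glob_def\<close>)
  then show ?thesis using assms(4) by (simp add: mask_m_def mask_def)
qed

lemma sem_load_mask_nbh:
  assumes "glob w s" "s ''d'' 0 = d" "d \<le> n" "mask d s C" "s ''x'' 0 = x" "x < n"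
  shows "mask_m (sem load_mask_nbh s) (C - nbh x)"
proof -
  let ?l = "FFor ''v'' ''n''
     (FIf (Const 0) (Read ''adj'' (at_row (sc ''x'') (sc ''v'')))
       (FAsg ''m'' (sc ''v'') (Const 0))
       (FAsg ''m'' (sc ''v'') (Read ''U'' (at_row (sc ''d'') (sc ''v'')))))"
  have "sem ?l s ''m'' p =
    (if 0 \<le> p \<and> p < 0 + n then if E x (p - 0) then 0 else s ''U'' (d * n + (p - 0)) else s ''m'' p)" for p
    by (rule sem_For_array) (use assms in \<open>auto simp: glob_def\<close>)
  then show ?thesis using assms(4,5,6)
    by (auto simp: load_mask_nbh_def sem_frame mask_m_def mask_def nbh_def)
qed

lemma sem_add_gain:
  assumes N: "s ''N'' 0 = N" and le: "s ''e'' (s ''v'' 0) \<le> s ''a'' (s ''v'' 0)"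
    and pos: "0 < s ''a'' (s ''v'' 0)"
  shows "sem add_gain s ''g'' 0 = s ''g'' 0 + (N - N * s ''e'' (s ''v'' 0) div s ''a'' (s ''v'' 0))"
proof -
  let ?a = "s ''a'' (s ''v'' 0)" and ?e = "s ''e'' (s ''v'' 0)"
  let ?b = "set_sc ''t'' (Plus (sc ''t'') (Read ''e'' (sc ''v''))) ;;
       FIf (sc ''t'') (Read ''a'' (sc ''v'')) (set_sc ''g'' (inc_sc ''g''))
         (set_sc ''t'' (Minus (sc ''t'') (Read ''a'' (sc ''v''))))"
  let ?s0 = "s(''t'' := (s ''t'')(0 := 0))"
  \<comment> \<open>\<open>q\<close> counts the subtractions, so \<open>t\<close> is the remainder
    of \<open>i * e\<close> modulo \<open>a\<close>. At the end \<open>q \<le> N\<close> makes the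
    truncated difference exact.\<close>
  define I where "I i s' \<longleftrightarrow> (\<exists>q\<le>i. s' ''t'' 0 + q * ?a = i * ?e \<and> s' ''t'' 0 < ?a \<and>
     s' ''g'' 0 + q = s ''g'' 0 + i)" for i and s' :: state
  have "I N (sem (FFor ''i'' ''N'' ?b) ?s0)"
  proof (rule sem_For[where I = I])
    fix i s'
    assume s': "i < N" "I i s'" "s' ''i'' 0 = i" "\<And>z. z \<notin> insert ''i'' (mods ?b) \<Longrightarrow> s' z = ?s0 z"
    have eqs: "s' ''a'' = s ''a''" "s' ''e'' = s ''e''" "s' ''v'' = s ''v''"
      using s'(4)[of "''a''"] s'(4)[of "''e''"] s'(4)[of "''v''"] by auto
    obtain q where q: "q \<le> i" "s' ''t'' 0 + q * ?a = i * ?e" "s' ''t'' 0 < ?a"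
      "s' ''g'' 0 + q = s ''g'' 0 + i" using s'(2) by (auto simp: I_def)
    show "I (Suc i) ((sem ?b s')(''i'' := (s' ''i'')(0 := Suc i)))"
    proof (cases "s' ''t'' 0 + ?e < ?a")
      case True
      then show ?thesis unfolding I_def
        by (intro exI[of _ q]) (use q in \<open>auto simp: eqs\<close>)
    next
      case False
      then show ?thesis unfolding I_def
        by (intro exI[of _ "Suc q"]) (use q le in \<open>auto simp: eqs\<close>)
    qed
  next
    show "I 0 (?s0(''i'' := (?s0 ''i'')(0 := 0)))" using pos by (auto simp: I_def)
  qed (use N in auto)
  then obtain q t where q: "q \<le> N" "t + q * ?a = N * ?e" "t < ?a"
    "sem add_gain s ''g'' 0 + q = s ''g'' 0 + N" by (auto simp: I_def add_gain_def)
  have "N * ?e div ?a = q" unfolding q(2)[symmetric] using q(3) by simp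
  then show ?thesis using q(1,4) by simp
qed

lemma sem_source_gain:
  assumes g: "glob w s" and d: "s ''d'' 0 = d" "d \<le> n" and C: "mask d s C"
    and x: "s ''x'' 0 = x" "x < n" and u: "s ''u'' 0 = u" "u \<in> C"
    and pos: "\<And>v. v \<in> C \<Longrightarrow> 0 < W C u v"
  shows "sem source_gain s ''g'' 0 =
    s ''g'' 0 + (\<Sum>v\<in>C. N - N * W (C - nbh x) u v div W C u v)"
proof -
  have un: "u < n" and Cn: "C \<subseteq> {..<n}" using C u by (auto simp: mask_def)
  then have finC: "finite C" using finite_subset by blast
  let ?copy = "FFor ''v'' ''n'' (FAsg ''e'' (sc ''v'') (Read ''a'' (sc ''v'')))"
  let ?body = "FIf (Const 0) (Read ''U'' (at_row (sc ''d'') (sc ''v''))) add_gain FSkip"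
  define s1 where "s1 = sem load_mask_nbh s"
  define s2 where "s2 = sem walk s1"
  define s3 where "s3 = sem ?copy s2"
  define s4 where "s4 = sem load_mask s3"
  define s5 where "s5 = sem walk s4"
  have f1: "z \<notin> {''v'', ''m''} \<Longrightarrow> s1 z = s z" for z
    by (simp add: s1_def sem_frame mods_defs)
  have f2: "z \<notin> {''v'', ''a'', ''j'', ''t'', ''i'', ''y'', ''c''} \<Longrightarrow> s2 z = s1 z" for z
    by (simp add: s2_def sem_frame mods_defs)
  have f3: "z \<notin> {''v'', ''e''} \<Longrightarrow> s3 z = s2 z" for z
    by (simp add: s3_def sem_frame)
  have f4: "z \<notin> {''v'', ''m''} \<Longrightarrow> s4 z = s3 z" for z
    by (simp add: s4_def sem_frame mods_defs)
  have f5: "z \<notin> {''v'', ''a'', ''j'', ''t'', ''i'', ''y'', ''c''} \<Longrightarrow> s5 z = s4 z" for z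
    by (simp add: s5_def sem_frame mods_defs)
  have g1: "glob w s1" by (rule glob_frame[OF g]) (auto simp: f1)
  have g2: "glob w s2" by (rule glob_frame[OF g1]) (auto simp: f2)
  have g3: "glob w s3" by (rule glob_frame[OF g2]) (auto simp: f3)
  have g4: "glob w s4" by (rule glob_frame[OF g3]) (auto simp: f4)
  have g5: "glob w s5" by (rule glob_frame[OF g4]) (auto simp: f5)
  have m1: "mask_m s1 (C - nbh x)" unfolding s1_def by (rule sem_load_mask_nbh[OF g d C x])
  have a2: "s2 ''a'' v = W (C - nbh x) u v" if "v < n" for v
    unfolding s2_def by (rule sem_walk[OF g1 m1 _ un that]) (simp add: f1 u)
  have "s3 ''e'' p = (if 0 \<le> p \<and> p < 0 + n then s2 ''a'' (p - 0) else s2 ''e'' p)" for p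
    unfolding s3_def by (rule sem_For_array) (use g2 in \<open>auto simp: glob_def\<close>)
  then have e3: "s3 ''e'' v = W (C - nbh x) u v" if "v < n" for v using a2 that by simp
  have d3: "s3 ''d'' 0 = d" using d by (simp add: f1 f2 f3)
  have C3: "mask d s3 C" using C by (simp add: mask_def f1 f2 f3)
  have m4: "mask_m s4 C" unfolding s4_def by (rule sem_load_mask[OF g3 d3 d(2) C3])
  have a5: "s5 ''a'' v = W C u v" if "v < n" for v
    unfolding s5_def by (rule sem_walk[OF g4 m4 _ un that]) (simp add: f1 f2 f3 f4 u)
  have e5: "s5 ''e'' v = W (C - nbh x) u v" if "v < n" for v using e3 that by (simp add: f4 f5)
  have d5: "s5 ''d'' 0 = d" using d by (simp add: f1 f2 f3 f4 f5)
  have C5: "mask d s5 C" using C by (simp add: mask_def f1 f2 f3 f4 f5)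
  let ?q = "\<lambda>v. N - N * W (C - nbh x) u v div W C u v"
  have "sem (FFor ''v'' ''n'' ?body) s5 ''g'' 0 = s5 ''g'' 0 + (\<Sum>v | v \<in> C \<and> v < n. ?q v)"
  proof (rule sem_For[where I = "\<lambda>i s'. s' ''g'' 0 = s5 ''g'' 0 + (\<Sum>v | v \<in> C \<and> v < i. ?q v)"])
    fix i s'
    assume s': "i < n" "s' ''g'' 0 = s5 ''g'' 0 + (\<Sum>v | v \<in> C \<and> v < i. ?q v)" "s' ''v'' 0 = i"
      "\<And>z. z \<notin> insert ''v'' (mods ?body) \<Longrightarrow> s' z = s5 z"
    have eqs: "s' ''a'' = s5 ''a''" "s' ''e'' = s5 ''e''" "s' ''N'' = s5 ''N''" "s' ''d'' = s5 ''d''"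
      "s' ''row'' = s5 ''row''" "s' ''U'' = s5 ''U''"
      by (rule s'(4); simp add: mods_defs)+
    have U: "s5 ''U'' (d * n + i) = (if i \<in> C then 1 else 0)" "s5 ''row'' d = d * n"
      using C5 s'(1) g5 d by (auto simp: mask_def glob_def)
    have "sem add_gain s' ''g'' 0 = s' ''g'' 0 + ?q i" if "i \<in> C"
      using sem_add_gain[of s'] pos[OF that] wk_mono[of "C - nbh x" C u n i] s'(1,3) g5
      by (simp add: eqs a5 e5 glob_def)
    then show "((sem ?body s')(''v'' := (s' ''v'')(0 := Suc i))) ''g'' 0
        = s5 ''g'' 0 + (\<Sum>v | v \<in> C \<and> v < Suc i. ?q v)"
      using s'(2,3) U d5 by (simp add: eqs sum_less_Suc[OF finC])
  qed (use g5 in \<open>auto simp: glob_def mods_defs\<close>)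
  then show ?thesis
    by (simp add: source_gain_def s1_def[symmetric] s2_def[symmetric] s3_def[symmetric]
        s4_def[symmetric] s5_def[symmetric] sum_less_n[OF Cn])
      (simp add: f1 f2 f3 f4 f5)
qed

lemma sem_vertex_gain:
  assumes g: "glob w s" and d: "s ''d'' 0 = d" "d \<le> n" and C: "mask d s C"
    and x: "s ''x'' 0 = x" "x < n"
    and pos: "\<And>u v. u \<in> C \<Longrightarrow> v \<in> C \<Longrightarrow> 0 < W C u v"
  shows "sem vertex_gain s ''g'' 0 = gain C x"
proof -
  have Cn: "C \<subseteq> {..<n}" using C by (auto simp: mask_def)
  then have finC: "finite C" using finite_subset by blast
  let ?body = "FIf (Const 0) (Read ''U'' (at_row (sc ''d'') (sc ''u''))) source_gain FSkip"
  let ?s0 = "s(''g'' := (s ''g'')(0 := 0))"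
  let ?q = "\<lambda>u. \<Sum>v\<in>C. N - N * W (C - nbh x) u v div W C u v"
  have "sem (FFor ''u'' ''n'' ?body) ?s0 ''g'' 0 = (\<Sum>u | u \<in> C \<and> u < n. ?q u)"
  proof (rule sem_For[where I = "\<lambda>i s'. s' ''g'' 0 = (\<Sum>u | u \<in> C \<and> u < i. ?q u)"])
    fix i s'
    assume s': "i < n" "s' ''g'' 0 = (\<Sum>u | u \<in> C \<and> u < i. ?q u)" "s' ''u'' 0 = i"
      "\<And>z. z \<notin> insert ''u'' (mods ?body) \<Longrightarrow> s' z = ?s0 z"
    have fr: "s' z = s z" if "z \<notin> insert ''u'' (mods ?body)" for z
      using s'(4)[OF that] that by (auto simp: mods_defs)
    have eqs: "s' ''d'' = s ''d''" "s' ''row'' = s ''row''" "s' ''U'' = s ''U''" "s' ''x'' = s ''x''"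
      by (rule fr; simp add: mods_defs)+
    have g': "glob w s'" by (rule glob_frame[OF g]) (rule fr, auto simp: mods_defs)
    have U: "s ''U'' (d * n + i) = (if i \<in> C then 1 else 0)" "s ''row'' d = d * n"
      using C s'(1) g d by (auto simp: mask_def glob_def)
    have "sem source_gain s' ''g'' 0 = s' ''g'' 0 + ?q i" if "i \<in> C"
      by (rule sem_source_gain[OF g' _ d(2) _ _ x(2) s'(3) that pos])
        (use that d C x in \<open>auto simp: eqs mask_def\<close>)
    then show "((sem ?body s')(''u'' := (s' ''u'')(0 := Suc i))) ''g'' 0
        = (\<Sum>u | u \<in> C \<and> u < Suc i. ?q u)"
      using s'(2,3) U d by (simp add: eqs sum_less_Suc[OF finC])
  qed (use g in \<open>auto simp: glob_def mods_defs\<close>)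
  then show ?thesis by (simp add: vertex_gain_def gain_def sum_less_n[OF Cn])
qed

lemma sem_select:
  assumes g: "glob w s" and d: "s ''d'' 0 = d" "d \<le> n" and C: "mask d s C" "C \<noteq> {}"
    and pos: "\<And>u v. u \<in> C \<Longrightarrow> v \<in> C \<Longrightarrow> 0 < W C u v"
  shows "sem select s ''bx'' 0 \<in> C \<and> (\<forall>y\<in>C. gain C y \<le> gain C (sem select s ''bx'' 0))"
proof -
  have Cn: "C \<subseteq> {..<n}" using C by (auto simp: mask_def)
  let ?upd = "FIf (sc ''best'') (inc_sc ''g'')
          (set_sc ''best'' (sc ''g'') ;; set_sc ''bx'' (sc ''x'')) FSkip"
  let ?body = "FIf (Const 0) (Read ''U'' (at_row (sc ''d'') (sc ''x''))) (vertex_gain ;; ?upd) FSkip"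
  let ?s0 = "s(''best'' := (s ''best'')(0 := 0))"
  \<comment> \<open>At first \<open>bx\<close> may hold a leftover of an earlier call. If that is
    outside \<open>C\<close>, the second conjunct says that \<open>best\<close> is 0, so a positive
    \<open>best\<close> proves \<open>bx \<in> C\<close>.\<close>
  define I where "I i s' \<longleftrightarrow> (\<forall>y\<in>C. y < i \<longrightarrow> gain C y \<le> s' ''best'' 0 \<and> s' ''bx'' 0 \<in> C) \<and>
     s' ''best'' 0 \<le> (if s' ''bx'' 0 \<in> C then gain C (s' ''bx'' 0) else 0)" for i and s' :: state
  have "I n (sem (FFor ''x'' ''n'' ?body) ?s0)"
  proof (rule sem_For[where I = I])
    fix i s'
    assume s': "i < n" "I i s'" "s' ''x'' 0 = i" "\<And>z. z \<notin> insert ''x'' (mods ?body) \<Longrightarrow> s' z = ?s0 z"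
    have fr: "s' z = s z" if "z \<notin> insert ''x'' (mods ?body)" for z
      using s'(4)[OF that] that by (auto simp: mods_defs)
    have eqs: "s' ''d'' = s ''d''" "s' ''row'' = s ''row''" "s' ''U'' = s ''U''"
      by (rule fr; simp add: mods_defs)+
    have g': "glob w s'" by (rule glob_frame[OF g]) (rule fr, auto simp: mods_defs)
    have U: "s ''U'' (d * n + i) = (if i \<in> C then 1 else 0)" "s ''row'' d = d * n"
      using C s'(1) g d by (auto simp: mask_def glob_def)
    show "I (Suc i) ((sem ?body s')(''x'' := (s' ''x'')(0 := Suc i)))"
    proof (cases "i \<in> C")
      case False
      then show ?thesis using s'(2,3) U d by (auto simp: I_def eqs less_Suc_eq)
    next
      case True
      let ?s1 = "sem vertex_gain s'"
      have gn: "?s1 ''g'' 0 = gain C i"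
        by (rule sem_vertex_gain[OF g' _ d(2) _ s'(3,1) pos])
          (use d C in \<open>auto simp: eqs mask_def\<close>)
      have f1: "?s1 ''best'' = s' ''best''" "?s1 ''bx'' = s' ''bx''" "?s1 ''x'' = s' ''x''"
        by (simp_all add: sem_frame mods_defs)
      show ?thesis
      proof (cases "s' ''best'' 0 < Suc (gain C i)")
        case True
        then show ?thesis using \<open>i \<in> C\<close> s'(2,3) U d gn
          by (auto simp: I_def eqs f1 less_Suc_eq less_Suc_eq_le)
      next
        case False
        then have "s' ''bx'' 0 \<in> C" using s'(2) by (auto simp: I_def split: if_splits)
        then show ?thesis using False \<open>i \<in> C\<close> s'(2,3) U d gn
          by (auto simp: I_def eqs f1 less_Suc_eq)
      qed
    qed
  qed (use g in \<open>auto simp: glob_def mods_defs I_def\<close>)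
  then have I: "I n (sem select s)" by (simp add: select_def)
  obtain z where "z \<in> C" "z < n" using C Cn by blast
  then have bx: "sem select s ''bx'' 0 \<in> C" using I unfolding I_def by blast
  have "gain C y \<le> gain C (sem select s ''bx'' 0)" if "y \<in> C" for y
  proof -
    have "gain C y \<le> sem select s ''best'' 0" using I that Cn unfolding I_def by blast
    also have "\<dots> \<le> gain C (sem select s ''bx'' 0)" using I bx unfolding I_def by simp
    finally show ?thesis .
  qed
  then show ?thesis using bx by blast
qed

end

section \<open>The recursive procedure\<close>

text \<open>The value \<open>n\<close> is no vertex and signals the empty set.\<close>

definition find_source :: fcom where
  "find_source = set_sc ''u'' (sc ''n'') ;;
     FFor ''v'' ''n'' (FIf (Const 0) (Read ''U'' (at_row (sc ''d'') (sc ''v'')))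
       (set_sc ''u'' (sc ''v'')) FSkip)"

text \<open>The row of the child is filled first, since it is read off row \<open>d\<close>, which
  is cut down to the component only afterwards.\<close>

definition split_component :: fcom where
  "split_component = load_mask ;; walk ;;
     FFor ''v'' ''n'' (FIf (Const 0) (Read ''a'' (sc ''v''))
       (FAsg ''U'' (at_row (inc_sc ''d'') (sc ''v'')) (Const 0))
       (FAsg ''U'' (at_row (inc_sc ''d'') (sc ''v'')) (Read ''U'' (at_row (sc ''d'') (sc ''v''))))) ;;
     FFor ''v'' ''n'' (FIf (Const 0) (Read ''a'' (sc ''v''))
       (FAsg ''U'' (at_row (sc ''d'') (sc ''v'')) (Read ''U'' (at_row (sc ''d'') (sc ''v''))))
       (FAsg ''U'' (at_row (sc ''d'') (sc ''v'')) (Const 0))) ;;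
     set_sc ''d'' (inc_sc ''d'')"

text \<open>
  Each recursive call gets its argument in the row above the current one. Its result overwrites
  \<open>ret\<close> and all scratch arrays, so what survives a call is saved in \<open>r1\<close>, \<open>r2\<close>, \<open>sx\<close> at the depth.
\<close>

definition enter_with :: fcom where
  "enter_with = set_sc ''d'' (Minus (sc ''d'') (Const 1)) ;;
     FAsg ''r1'' (sc ''d'') (sc ''ret'') ;;
     select ;;
     FAsg ''sx'' (sc ''d'') (sc ''bx'') ;;
     FFor ''v'' ''n'' (FIf (Const 0) (Read ''adj'' (at_row (sc ''bx'') (sc ''v'')))
       (FAsg ''U'' (at_row (inc_sc ''d'') (sc ''v'')) (Const 0))
       (FAsg ''U'' (at_row (inc_sc ''d'') (sc ''v'')) (Read ''U'' (at_row (sc ''d'') (sc ''v''))))) ;;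
     FAsg ''U'' (at_row (inc_sc ''d'') (sc ''bx'')) (Const 0) ;;
     set_sc ''d'' (inc_sc ''d'')"

definition enter_without :: fcom where
  "enter_without = set_sc ''d'' (Minus (sc ''d'') (Const 1)) ;;
     FAsg ''r2'' (sc ''d'') (Plus (Read ''w'' (Read ''sx'' (sc ''d''))) (sc ''ret'')) ;;
     FFor ''v'' ''n'' (FAsg ''U'' (at_row (inc_sc ''d'') (sc ''v''))
       (Read ''U'' (at_row (sc ''d'') (sc ''v'')))) ;;
     FAsg ''U'' (at_row (inc_sc ''d'') (Read ''sx'' (sc ''d''))) (Const 0) ;;
     set_sc ''d'' (inc_sc ''d'')"

definition combine :: fcom where
  "combine = set_sc ''d'' (Minus (sc ''d'') (Const 1)) ;;
     FIf (sc ''ret'') (Read ''r2'' (sc ''d''))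
       (set_sc ''ret'' (Plus (Read ''r1'' (sc ''d'')) (Read ''r2'' (sc ''d''))))
       (set_sc ''ret'' (Plus (Read ''r1'' (sc ''d'')) (sc ''ret'')))"

definition init :: fcom where
  "init = FFor ''i'' ''n'' (FAsg ''row'' (inc_sc ''i'') (Plus (Read ''row'' (sc ''i'')) (sc ''n''))) ;;
     FFor ''i'' ''n'' (set_sc ''N'' (Plus (sc ''N'') (sc ''n''))) ;;
     set_sc ''N'' (Plus (sc ''N'') (sc ''N'')) ;;
     set_sc ''N'' (Plus (sc ''N'') (sc ''N'')) ;;
     FFor ''i'' ''n'' (FAsg ''U'' (sc ''i'') (Const 1))"

definition solve :: com where
  "solve = Seq (compile find_source) (IfLess (sc ''u'') (sc ''n'')
     (Seq (compile split_component) (Seq (Call 1) (Seq (compile enter_with) (Seq (Call 1)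
       (Seq (compile enter_without) (Seq (Call 1) (compile combine)))))))
     (compile (set_sc ''ret'' (Const 0))))"

definition mwis :: program where
  "mwis = [Seq (compile init) (Seq (Call 1) (compile (set_sc ''out'' (sc ''ret'')))), solve]"

text \<open>Covers the code of one call outside its recursive calls, and \<open>init\<close>; the 20
  is slack for the tests, assignments and \<open>Call\<close> steps between the blocks.\<close>

definition step_time :: "nat \<Rightarrow> nat" where
  "step_time K = ftime K (init ;; find_source ;; split_component ;; enter_with ;; enter_without ;;
     combine) + 20"

lemma mods_solve:
  "mods find_source = {''u'', ''v''}"
  "mods split_component = {''v'', ''m'', ''a'', ''j'', ''t'', ''i'', ''y'', ''c'', ''U'', ''d''}"
  "mods enter_with = {''d'', ''r1'', ''sx'', ''U'', ''x'', ''best'', ''bx'', ''u'', ''v'', ''m'',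
     ''a'', ''j'', ''t'', ''i'', ''y'', ''c'', ''e'', ''g''}"
  "mods enter_without = {''d'', ''r2'', ''v'', ''U''}"
  "mods combine = {''d'', ''ret''}"
  "mods init = {''i'', ''row'', ''N'', ''U''}"
  by (auto simp: find_source_def split_component_def enter_with_def enter_without_def
      combine_def init_def mods_defs)

lemmas code_defs = add_loops_def add_neighbours_def walk_cell_def walk_def load_mask_def
  load_mask_nbh_def add_gain_def source_gain_def vertex_gain_def select_def find_source_def
  split_component_def enter_with_def enter_without_def combine_def init_def

lemma wf_solve:
  "wf_for find_source" "wf_for split_component" "wf_for enter_with" "wf_for enter_without"
  "wf_for combine" "wf_for init"
  by (simp_all add: code_defs)

lemma bounds_solve:
  "bounds find_source \<subseteq> {''n'', ''N''}" "bounds split_component \<subseteq> {''n'', ''N''}"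
  "bounds enter_with \<subseteq> {''n'', ''N''}" "bounds enter_without \<subseteq> {''n'', ''N''}"
  "bounds combine \<subseteq> {''n'', ''N''}" "bounds init = {''n''}"
  by (simp_all add: code_defs)

section \<open>Correctness of the recursion on the stack of vertex sets\<close>

context nat_graph
begin

text \<open>What a call at depth \<open>d\<close> owes to the calls still waiting below it. It may
  destroy row \<open>d\<close>; a caller at depth \<open>d\<close> finds its own row intact because
  its recursive calls run at depth \<open>Suc d\<close>.\<close>

definition keep :: "nat \<Rightarrow> state \<Rightarrow> state \<Rightarrow> bool" where
  "keep d s s' \<longleftrightarrow> (\<forall>p<d * n. s' ''U'' p = s ''U'' p) \<and>
     (\<forall>i<d. s' ''r1'' i = s ''r1'' i \<and> s' ''r2'' i = s ''r2'' i \<and> s' ''sx'' i = s ''sx'' i)"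

lemma keep_trans: "keep d s s' \<Longrightarrow> keep d s' s'' \<Longrightarrow> keep d s s''"
  by (simp add: keep_def)

lemma keep_le:
  assumes "keep (Suc d) s s'"
  shows "keep d s s'"
proof -
  have "d * n \<le> Suc d * n" by (rule mult_le_mono1) simp
  then show ?thesis using assms unfolding keep_def by (meson less_SucI order_less_le_trans)
qed

lemma mask_keep:
  assumes "mask d s C" "keep (Suc d) s s'"
  shows "mask d s' C"
  using assms by (simp add: mask_def keep_def)

lemma sem_find_source:
  assumes g: "glob w s" and d: "s ''d'' 0 = d" "d \<le> n" and U: "mask d s U"
  shows "sem find_source s ''u'' 0 = n \<and> U = {} \<or> sem find_source s ''u'' 0 \<in> U"
proof -
  let ?body = "FIf (Const 0) (Read ''U'' (at_row (sc ''d'') (sc ''v''))) (set_sc ''u'' (sc ''v'')) FSkip"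
  let ?s0 = "s(''u'' := (s ''u'')(0 := n))"
  define I where "I i s' \<longleftrightarrow> s' ''u'' 0 = n \<and> (\<forall>v\<in>U. \<not> v < i) \<or> s' ''u'' 0 \<in> U"
    for i :: nat and s' :: state
  have "I n (sem (FFor ''v'' ''n'' ?body) ?s0)"
  proof (rule sem_For[where I = I])
    fix i s'
    assume s': "i < n" "I i s'" "s' ''v'' 0 = i" "\<And>z. z \<notin> insert ''v'' (mods ?body) \<Longrightarrow> s' z = ?s0 z"
    have eqs: "s' ''d'' = s ''d''" "s' ''row'' = s ''row''" "s' ''U'' = s ''U''"
      using s'(4)[of "''d''"] s'(4)[of "''row''"] s'(4)[of "''U''"] by auto
    have "s ''U'' (d * n + i) = (if i \<in> U then 1 else 0)" "s ''row'' d = d * n"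
      using U s'(1) g d by (auto simp: mask_def glob_def)
    then show "I (Suc i) ((sem ?body s')(''v'' := (s' ''v'')(0 := Suc i)))"
      using s'(2,3) d by (auto simp: I_def eqs less_Suc_eq)
  qed (use g in \<open>auto simp: glob_def I_def\<close>)
  moreover have "s ''n'' 0 = n" using g by (simp add: glob_def)
  ultimately have "I n (sem find_source s)" by (simp add: find_source_def)
  then show ?thesis using U by (auto simp: I_def mask_def)
qed

lemma sem_split_component:
  assumes g: "glob w s" and d: "s ''d'' 0 = d" "Suc d \<le> n" and U: "mask d s U"
    and u: "s ''u'' 0 = u" "u \<in> U"
  defines "s' \<equiv> sem split_component s"
  shows "glob w s'" "s' ''d'' 0 = Suc d" "mask (Suc d) s' (U - comp U u)" "mask d s' (comp U u)"
    "keep d s s'"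
proof -
  have Un: "U \<subseteq> {..<n}" "u < n" using U u by (auto simp: mask_def)
  define s1 where "s1 = sem load_mask s"
  define s2 where "s2 = sem walk s1"
  let ?child = "FFor ''v'' ''n'' (FIf (Const 0) (Read ''a'' (sc ''v''))
       (FAsg ''U'' (at_row (inc_sc ''d'') (sc ''v'')) (Const 0))
       (FAsg ''U'' (at_row (inc_sc ''d'') (sc ''v'')) (Read ''U'' (at_row (sc ''d'') (sc ''v'')))))"
  let ?own = "FFor ''v'' ''n'' (FIf (Const 0) (Read ''a'' (sc ''v''))
       (FAsg ''U'' (at_row (sc ''d'') (sc ''v'')) (Read ''U'' (at_row (sc ''d'') (sc ''v''))))
       (FAsg ''U'' (at_row (sc ''d'') (sc ''v'')) (Const 0)))"
  define s3 where "s3 = sem ?child s2"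
  define s4 where "s4 = sem ?own s3"
  have s': "s' = s4(''d'' := (s4 ''d'')(0 := Suc (s4 ''d'' 0)))"
    by (simp add: s'_def split_component_def s1_def s2_def s3_def s4_def)
  have f1: "z \<notin> {''v'', ''m''} \<Longrightarrow> s1 z = s z" for z
    by (simp add: s1_def sem_frame mods_defs)
  have f2: "z \<notin> {''v'', ''a'', ''j'', ''t'', ''i'', ''y'', ''c''} \<Longrightarrow> s2 z = s1 z" for z
    by (simp add: s2_def sem_frame mods_defs)
  have f3: "z \<notin> {''v'', ''U''} \<Longrightarrow> s3 z = s2 z" for z
    by (simp add: s3_def sem_frame)
  have f4: "z \<notin> {''v'', ''U''} \<Longrightarrow> s4 z = s3 z" for z
    by (simp add: s4_def sem_frame)
  have g1: "glob w s1" by (rule glob_frame[OF g]) (auto simp: f1)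
  have g2: "glob w s2" by (rule glob_frame[OF g1]) (auto simp: f2)
  have g3: "glob w s3" by (rule glob_frame[OF g2]) (auto simp: f3)
  have m1: "mask_m s1 U" unfolding s1_def by (rule sem_load_mask[OF g d(1) _ U]) (use d in simp)
  have a2: "s2 ''a'' v = W U u v" if "v < n" for v
    unfolding s2_def by (rule sem_walk[OF g1 m1 _ Un(2) that]) (simp add: f1 u)
  have d2: "s2 ''d'' 0 = d" "s2 ''U'' = s ''U''" using d by (simp_all add: f1 f2)
  have d3: "s3 ''d'' 0 = d" "s3 ''a'' = s2 ''a''" using d2 by (simp_all add: f3)
  have row: "s2 ''row'' d = d * n" "s2 ''row'' (Suc d) = Suc d * n" "s3 ''row'' d = d * n"
    using g2 g3 d(2) by (simp_all add: glob_def)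
  have U3: "s3 ''U'' p = (if Suc d * n \<le> p \<and> p < Suc d * n + n
      then if 0 < s2 ''a'' (p - Suc d * n) then 0 else s2 ''U'' (d * n + (p - Suc d * n))
      else s2 ''U'' p)" for p
    unfolding s3_def
  proof (rule sem_For_array)
    fix i r
    assume r: "i < n" "r ''v'' 0 = i"
      and fr: "\<And>z. z \<notin> insert ''v'' (mods (FIf (Const 0) (Read ''a'' (sc ''v''))
       (FAsg ''U'' (at_row (inc_sc ''d'') (sc ''v'')) (Const 0))
       (FAsg ''U'' (at_row (inc_sc ''d'') (sc ''v'')) (Read ''U'' (at_row (sc ''d'') (sc ''v''))))))
         \<Longrightarrow> r z = s2 z"
      and arr: "\<And>p. p < Suc d * n \<or> Suc d * n + i \<le> p \<Longrightarrow> r ''U'' p = s2 ''U'' p"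
    have eqs: "r ''a'' = s2 ''a''" "r ''d'' = s2 ''d''" "r ''row'' = s2 ''row''"
      by (rule fr; simp)+
    have "r ''U'' (d * n + i) = s2 ''U'' (d * n + i)" using r by (intro arr) simp
    then show "sem (FIf (Const 0) (Read ''a'' (sc ''v''))
       (FAsg ''U'' (at_row (inc_sc ''d'') (sc ''v'')) (Const 0))
       (FAsg ''U'' (at_row (inc_sc ''d'') (sc ''v'')) (Read ''U'' (at_row (sc ''d'') (sc ''v'')))))
       r ''U'' = (r ''U'')(Suc d * n + i := if 0 < s2 ''a'' i then 0 else s2 ''U'' (d * n + i))"
      using r row d2 by (simp add: eqs)
  qed (use g2 in \<open>auto simp: glob_def\<close>)
  have U4: "s4 ''U'' p = (if d * n \<le> p \<and> p < d * n + n
      then if 0 < s3 ''a'' (p - d * n) then s3 ''U'' (d * n + (p - d * n)) else 0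
      else s3 ''U'' p)" for p
    unfolding s4_def
  proof (rule sem_For_array)
    fix i r
    assume r: "i < n" "r ''v'' 0 = i"
      and fr: "\<And>z. z \<notin> insert ''v'' (mods (FIf (Const 0) (Read ''a'' (sc ''v''))
       (FAsg ''U'' (at_row (sc ''d'') (sc ''v'')) (Read ''U'' (at_row (sc ''d'') (sc ''v''))))
       (FAsg ''U'' (at_row (sc ''d'') (sc ''v'')) (Const 0)))) \<Longrightarrow> r z = s3 z"
      and arr: "\<And>p. p < d * n \<or> d * n + i \<le> p \<Longrightarrow> r ''U'' p = s3 ''U'' p"
    have eqs: "r ''a'' = s3 ''a''" "r ''d'' = s3 ''d''" "r ''row'' = s3 ''row''"
      by (rule fr; simp)+
    have "r ''U'' (d * n + i) = s3 ''U'' (d * n + i)" by (intro arr) simp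
    then show "sem (FIf (Const 0) (Read ''a'' (sc ''v''))
       (FAsg ''U'' (at_row (sc ''d'') (sc ''v'')) (Read ''U'' (at_row (sc ''d'') (sc ''v''))))
       (FAsg ''U'' (at_row (sc ''d'') (sc ''v'')) (Const 0)))
       r ''U'' = (r ''U'')(d * n + i := if 0 < s3 ''a'' i then s3 ''U'' (d * n + i) else 0)"
      using r row d3 by (simp add: eqs)
  qed (use g3 in \<open>auto simp: glob_def\<close>)
  have comp: "v \<in> comp U u \<longleftrightarrow> v \<in> U \<and> 0 < W U u v" for v
    using comp_W[OF u(2) Un(1)] by simp
  have UU: "s ''U'' (d * n + v) = (if v \<in> U then 1 else 0)" if "v < n" for v
    using U that by (simp add: mask_def)
  show "glob w s'" by (rule glob_frame[OF g3]) (auto simp: s' f4)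
  show "s' ''d'' 0 = Suc d" using d3 by (simp add: s' f4)
  show "mask (Suc d) s' (U - comp U u)"
    unfolding mask_def
  proof (intro conjI allI impI)
    fix v assume v: "v < n"
    have "s' ''U'' (Suc d * n + v) = s3 ''U'' (Suc d * n + v)" using v by (simp add: s' U4)
    also have "\<dots> = (if 0 < W U u v then 0 else s ''U'' (d * n + v))"
      unfolding U3 using v a2 d2 by simp
    finally show "s' ''U'' (Suc d * n + v) = (if v \<in> U - comp U u then 1 else 0)"
      using UU[OF v] comp[of v] by simp
  qed (use Un in auto)
  show "mask d s' (comp U u)"
    unfolding mask_def
  proof (intro conjI allI impI)
    fix v assume v: "v < n"
    have "s3 ''U'' (d * n + v) = s ''U'' (d * n + v)" using v d2 by (simp add: U3)
    then have "s' ''U'' (d * n + v) = (if 0 < W U u v then s ''U'' (d * n + v) else 0)"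
      using v a2[OF v] d3 by (simp add: s' U4)
    then show "s' ''U'' (d * n + v) = (if v \<in> comp U u then 1 else 0)"
      using UU[OF v] comp[of v] by simp
  qed (use comp Un in auto)
  show "keep d s s'"
    unfolding keep_def
  proof (intro conjI allI impI)
    fix p assume p: "p < d * n"
    then show "s' ''U'' p = s ''U'' p" using d2 by (simp add: s' U4 U3)
  qed (simp_all add: s' f1 f2 f3 f4)
qed

lemma sem_enter_with:
  assumes g: "glob w s" and d: "s ''d'' 0 = Suc d" "Suc d \<le> n" and C: "mask d s C" "C \<noteq> {}"
    and pos: "\<forall>u\<in>C. \<forall>v\<in>C. 0 < W C u v"
  defines "s' \<equiv> sem enter_with s"
  shows "glob w s'" "s' ''d'' 0 = Suc d" "s' ''sx'' d \<in> C"
    "\<And>y. y \<in> C \<Longrightarrow> gain C y \<le> gain C (s' ''sx'' d)" "mask d s' C"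
    "mask (Suc d) s' (C - nbh (s' ''sx'' d))" "s' ''r1'' d = s ''ret'' 0" "keep d s s'"
proof -
  have Cn: "C \<subseteq> {..<n}" using C by (simp add: mask_def)
  define s1 where "s1 = s(''d'' := (s ''d'')(0 := d), ''r1'' := (s ''r1'')(d := s ''ret'' 0))"
  define s2 where "s2 = sem select s1"
  define x where "x = s2 ''bx'' 0"
  define s3 where "s3 = s2(''sx'' := (s2 ''sx'')(d := x))"
  let ?child = "FFor ''v'' ''n'' (FIf (Const 0) (Read ''adj'' (at_row (sc ''bx'') (sc ''v'')))
       (FAsg ''U'' (at_row (inc_sc ''d'') (sc ''v'')) (Const 0))
       (FAsg ''U'' (at_row (inc_sc ''d'') (sc ''v'')) (Read ''U'' (at_row (sc ''d'') (sc ''v'')))))"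
  define s4 where "s4 = sem ?child s3"
  define s5 where "s5 = s4(''U'' := (s4 ''U'')(Suc d * n + x := 0))"
  have g1: "glob w s1" by (rule glob_frame[OF g]) (auto simp: s1_def)
  have C1: "mask d s1 C" using C by (simp add: mask_def s1_def)
  have d1: "s1 ''d'' 0 = d" by (simp add: s1_def)
  have f2: "z \<notin> mods select \<Longrightarrow> s2 z = s1 z" for z by (simp add: s2_def sem_frame)
  have x: "x \<in> C" "\<And>y. y \<in> C \<Longrightarrow> gain C y \<le> gain C x"
    using sem_select[OF g1 d1 _ C1 C(2)] pos d(2) unfolding x_def s2_def by auto
  then have xn: "x < n" using Cn by blast
  have g2: "glob w s2" by (rule glob_frame[OF g1]) (auto simp: f2 mods_defs)
  have g3: "glob w s3" by (rule glob_frame[OF g2]) (auto simp: s3_def)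
  have f4: "z \<notin> {''v'', ''U''} \<Longrightarrow> s4 z = s3 z" for z
    by (simp add: s4_def sem_frame)
  have d3: "s3 ''d'' 0 = d" "s3 ''bx'' 0 = x" "s3 ''U'' = s ''U''"
    using d1 by (simp_all add: s3_def x_def f2 mods_defs) (simp add: s1_def)
  have row: "s3 ''row'' d = d * n" "s3 ''row'' (Suc d) = Suc d * n" "s3 ''row'' x = x * n"
    using g3 d(2) xn by (simp_all add: glob_def)
  have row4: "s4 ''row'' (Suc d) = Suc d * n" using row by (simp add: f4)
  have s': "s' = s5(''d'' := (s5 ''d'')(0 := Suc d))"
  proof -
    have "s' = sem (set_sc ''d'' (inc_sc ''d'')) (sem (FAsg ''U'' (at_row (inc_sc ''d'') (sc ''bx'')) (Const 0))
        (sem ?child (sem (FAsg ''sx'' (sc ''d'') (sc ''bx'')) (sem select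
          (sem (FAsg ''r1'' (sc ''d'') (sc ''ret'')) (sem (set_sc ''d'' (Minus (sc ''d'') (Const 1))) s))))))"
      unfolding s'_def enter_with_def sem.simps(3) ..
    also have "sem (FAsg ''r1'' (sc ''d'') (sc ''ret'')) (sem (set_sc ''d'' (Minus (sc ''d'') (Const 1))) s) = s1"
      using d by (simp add: s1_def)
    also have "sem select s1 = s2" by (simp add: s2_def)
    also have "sem (FAsg ''sx'' (sc ''d'') (sc ''bx'')) s2 = s3"
      using d1 by (simp add: s3_def x_def f2 mods_defs)
    also have "sem ?child s3 = s4" unfolding s4_def ..
    also have "sem (FAsg ''U'' (at_row (inc_sc ''d'') (sc ''bx'')) (Const 0)) s4 = s5"
      using d3 row4 by (simp add: s5_def f4)
    also have "sem (set_sc ''d'' (inc_sc ''d'')) s5 = s5(''d'' := (s5 ''d'')(0 := Suc d))"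
      using d3 by (simp add: s5_def f4)
    finally show ?thesis .
  qed
  have adj: "0 < s3 ''adj'' (x * n + v) \<longleftrightarrow> E x v" if "v < n" for v
    using g3 xn that by (simp add: glob_def)
  have U4: "s4 ''U'' p = (if Suc d * n \<le> p \<and> p < Suc d * n + n
      then if E x (p - Suc d * n) then 0 else s3 ''U'' (d * n + (p - Suc d * n))
      else s3 ''U'' p)" for p
    unfolding s4_def
  proof (rule sem_For_array)
    fix i r
    assume r: "i < n" "r ''v'' 0 = i"
      and fr: "\<And>z. z \<notin> insert ''v'' (mods (FIf (Const 0) (Read ''adj'' (at_row (sc ''bx'') (sc ''v'')))
       (FAsg ''U'' (at_row (inc_sc ''d'') (sc ''v'')) (Const 0))
       (FAsg ''U'' (at_row (inc_sc ''d'') (sc ''v'')) (Read ''U'' (at_row (sc ''d'') (sc ''v''))))))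
         \<Longrightarrow> r z = s3 z"
      and arr: "\<And>p. p < Suc d * n \<or> Suc d * n + i \<le> p \<Longrightarrow> r ''U'' p = s3 ''U'' p"
    have eqs: "r ''adj'' = s3 ''adj''" "r ''d'' = s3 ''d''" "r ''row'' = s3 ''row''" "r ''bx'' = s3 ''bx''"
      by (rule fr; simp)+
    have "r ''U'' (d * n + i) = s3 ''U'' (d * n + i)" using r by (intro arr) simp
    then show "sem (FIf (Const 0) (Read ''adj'' (at_row (sc ''bx'') (sc ''v'')))
       (FAsg ''U'' (at_row (inc_sc ''d'') (sc ''v'')) (Const 0))
       (FAsg ''U'' (at_row (inc_sc ''d'') (sc ''v'')) (Read ''U'' (at_row (sc ''d'') (sc ''v'')))))
       r ''U'' = (r ''U'')(Suc d * n + i := if E x i then 0 else s3 ''U'' (d * n + i))"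
      using r row d3 adj[OF r(1)] by (simp add: eqs)
  qed (use g3 in \<open>auto simp: glob_def\<close>)
  have CU: "s ''U'' (d * n + v) = (if v \<in> C then 1 else 0)" if "v < n" for v
    using C that by (simp add: mask_def)
  have sx: "s' ''sx'' d = x" by (simp add: s' s5_def f4 s3_def)
  show "glob w s'" by (rule glob_frame[OF g3]) (auto simp: s' s5_def f4)
  show "s' ''d'' 0 = Suc d" by (simp add: s')
  show "s' ''sx'' d \<in> C" "\<And>y. y \<in> C \<Longrightarrow> gain C y \<le> gain C (s' ''sx'' d)"
    using x by (simp_all add: sx)
  have low: "s' ''U'' p = s ''U'' p" if "p < Suc d * n" for p
  proof -
    have "s5 ''U'' p = s4 ''U'' p" using that by (simp add: s5_def)
    also have "\<dots> = s3 ''U'' p" using that by (simp add: U4)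
    finally show ?thesis using d3 by (simp add: s')
  qed
  show "mask d s' C" using C low by (simp add: mask_def)
  show "mask (Suc d) s' (C - nbh (s' ''sx'' d))"
    unfolding mask_def sx
  proof (intro conjI allI impI)
    fix v assume v: "v < n"
    have "s' ''U'' (Suc d * n + v) = (if v = x then 0 else s4 ''U'' (Suc d * n + v))"
      by (simp add: s' s5_def)
    also have "s4 ''U'' (Suc d * n + v) = (if E x v then 0 else s ''U'' (d * n + v))"
      unfolding U4 using v d3 by simp
    finally show "s' ''U'' (Suc d * n + v) = (if v \<in> C - nbh x then 1 else 0)"
      using CU[OF v] by (auto simp: nbh_def)
  qed (use Cn in auto)
  show "s' ''r1'' d = s ''ret'' 0" by (simp add: s' s5_def f4 s3_def f2 mods_defs s1_def)
  have "p < Suc d * n" if "p < d * n" for p using that by simp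
  then show "keep d s s'"
    unfolding keep_def using low
    by (auto simp: s' s5_def f4 s3_def f2 mods_defs s1_def)
qed

lemma sem_enter_without:
  assumes g: "glob w s" and d: "s ''d'' 0 = Suc d" "Suc d \<le> n" and C: "mask d s C"
    and x: "s ''sx'' d = x" "x \<in> C"
  defines "s' \<equiv> sem enter_without s"
  shows "glob w s'" "s' ''d'' 0 = Suc d" "mask (Suc d) s' (C - {x})"
    "s' ''r2'' d = w x + s ''ret'' 0" "s' ''r1'' d = s ''r1'' d" "keep d s s'"
proof -
  have Cn: "C \<subseteq> {..<n}" using C by (simp add: mask_def)
  then have xn: "x < n" using x by blast
  have wx: "s ''w'' x = w x" using g xn by (simp add: glob_def)
  define s1 where "s1 = s(''d'' := (s ''d'')(0 := d), ''r2'' := (s ''r2'')(d := w x + s ''ret'' 0))"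
  let ?child = "FFor ''v'' ''n'' (FAsg ''U'' (at_row (inc_sc ''d'') (sc ''v''))
       (Read ''U'' (at_row (sc ''d'') (sc ''v''))))"
  define s4 where "s4 = sem ?child s1"
  define s5 where "s5 = s4(''U'' := (s4 ''U'')(Suc d * n + x := 0))"
  have g1: "glob w s1" by (rule glob_frame[OF g]) (auto simp: s1_def)
  have d1: "s1 ''d'' 0 = d" "s1 ''U'' = s ''U''" "s1 ''sx'' d = x" using x by (simp_all add: s1_def)
  have f4: "z \<notin> {''v'', ''U''} \<Longrightarrow> s4 z = s1 z" for z
    by (simp add: s4_def sem_frame)
  have row: "s1 ''row'' d = d * n" "s1 ''row'' (Suc d) = Suc d * n"
    using g1 d(2) by (simp_all add: glob_def)
  have s': "s' = s5(''d'' := (s5 ''d'')(0 := Suc d))"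
  proof -
    have "s' = sem (set_sc ''d'' (inc_sc ''d'')) (sem (FAsg ''U'' (at_row (inc_sc ''d'') (Read ''sx'' (sc ''d''))) (Const 0))
        (sem ?child (sem (FAsg ''r2'' (sc ''d'') (Plus (Read ''w'' (Read ''sx'' (sc ''d''))) (sc ''ret'')))
          (sem (set_sc ''d'' (Minus (sc ''d'') (Const 1))) s))))"
      unfolding s'_def enter_without_def sem.simps(3) ..
    also have "sem (FAsg ''r2'' (sc ''d'') (Plus (Read ''w'' (Read ''sx'' (sc ''d''))) (sc ''ret'')))
          (sem (set_sc ''d'' (Minus (sc ''d'') (Const 1))) s) = s1"
      using d x wx by (simp add: s1_def)
    also have "sem ?child s1 = s4" unfolding s4_def ..
    also have "sem (FAsg ''U'' (at_row (inc_sc ''d'') (Read ''sx'' (sc ''d''))) (Const 0)) s4 = s5"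
      using d1 row by (simp add: s5_def f4)
    also have "sem (set_sc ''d'' (inc_sc ''d'')) s5 = s5(''d'' := (s5 ''d'')(0 := Suc d))"
      using d1 by (simp add: s5_def f4)
    finally show ?thesis .
  qed
  have U4: "s4 ''U'' p = (if Suc d * n \<le> p \<and> p < Suc d * n + n
      then s1 ''U'' (d * n + (p - Suc d * n)) else s1 ''U'' p)" for p
    unfolding s4_def
  proof (rule sem_For_array)
    fix i r
    assume r: "i < n" "r ''v'' 0 = i"
      and fr: "\<And>z. z \<notin> insert ''v'' (mods (FAsg ''U'' (at_row (inc_sc ''d'') (sc ''v''))
       (Read ''U'' (at_row (sc ''d'') (sc ''v''))))) \<Longrightarrow> r z = s1 z"
      and arr: "\<And>p. p < Suc d * n \<or> Suc d * n + i \<le> p \<Longrightarrow> r ''U'' p = s1 ''U'' p"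
    have eqs: "r ''d'' = s1 ''d''" "r ''row'' = s1 ''row''"
      by (rule fr; simp)+
    have "r ''U'' (d * n + i) = s1 ''U'' (d * n + i)" using r by (intro arr) simp
    then show "sem (FAsg ''U'' (at_row (inc_sc ''d'') (sc ''v''))
       (Read ''U'' (at_row (sc ''d'') (sc ''v'')))) r ''U'' =
       (r ''U'')(Suc d * n + i := s1 ''U'' (d * n + i))"
      using r row d1 by (simp add: eqs)
  qed (use g1 in \<open>auto simp: glob_def\<close>)
  have CU: "s ''U'' (d * n + v) = (if v \<in> C then 1 else 0)" if "v < n" for v
    using C that by (simp add: mask_def)
  show "glob w s'" by (rule glob_frame[OF g1]) (auto simp: s' s5_def f4)
  show "s' ''d'' 0 = Suc d" by (simp add: s')
  show "mask (Suc d) s' (C - {x})"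
    unfolding mask_def
  proof (intro conjI allI impI)
    fix v assume v: "v < n"
    have "s' ''U'' (Suc d * n + v) = (if v = x then 0 else s4 ''U'' (Suc d * n + v))"
      by (simp add: s' s5_def)
    also have "s4 ''U'' (Suc d * n + v) = s ''U'' (d * n + v)"
      unfolding U4 using v d1 by simp
    finally show "s' ''U'' (Suc d * n + v) = (if v \<in> C - {x} then 1 else 0)"
      using CU[OF v] by auto
  qed (use Cn in auto)
  show "s' ''r2'' d = w x + s ''ret'' 0" "s' ''r1'' d = s ''r1'' d"
    by (simp_all add: s' s5_def f4 s1_def)
  have "s' ''U'' p = s ''U'' p" if "p < d * n" for p
    using that d1 by (simp add: s' s5_def U4)
  then show "keep d s s'"
    unfolding keep_def by (auto simp: s' s5_def f4 s1_def)
qed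

lemma sem_combine:
  assumes g: "glob w s" and d: "s ''d'' 0 = Suc d"
  defines "s' \<equiv> sem combine s"
  shows "glob w s'" "s' ''d'' 0 = d" "s' ''ret'' 0 = s ''r1'' d + max (s ''ret'' 0) (s ''r2'' d)"
    "keep d s s'"
proof -
  show "glob w s'" unfolding s'_def by (rule glob_frame[OF g]) (auto simp: sem_frame mods_solve)
  show "s' ''d'' 0 = d" "s' ''ret'' 0 = s ''r1'' d + max (s ''ret'' 0) (s ''r2'' d)"
    using d by (simp_all add: s'_def combine_def)
  show "keep d s s'" by (simp add: keep_def s'_def sem_frame mods_solve)
qed

section \<open>Optimal independent sets under splitting and branching\<close>

definition indep :: "nat set \<Rightarrow> bool" where
  "indep S \<longleftrightarrow> (\<forall>a\<in>S. \<forall>b\<in>S. \<not> E a b)"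

definition max_indep :: "(nat \<Rightarrow> nat) \<Rightarrow> nat set \<Rightarrow> nat \<Rightarrow> bool" where
  "max_indep w U r \<longleftrightarrow> (\<exists>S\<subseteq>U. indep S \<and> sum w S = r) \<and> (\<forall>S\<subseteq>U. indep S \<longrightarrow> sum w S \<le> r)"

lemma max_indepD: "max_indep w U r \<Longrightarrow> S \<subseteq> U \<Longrightarrow> indep S \<Longrightarrow> sum w S \<le> r"
  by (simp add: max_indep_def)

text \<open>No edge joins the component to the rest, so the optima add. Within the component an
  independent set either contains \<open>x\<close> and has its other vertices outside
  \<open>nbh x\<close>, or it avoids \<open>x\<close>.\<close>

lemma max_indep_step:
  assumes U: "finite U" "u \<in> U" and x: "x \<in> comp U u"
    and a: "max_indep w (U - comp U u) a" and b: "max_indep w (comp U u - nbh x) b"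
    and c: "max_indep w (comp U u - {x}) c"
  shows "max_indep w U (a + max c (w x + b))"
proof -
  let ?C = "comp U u"
  have CU: "?C \<subseteq> U" using comp_subset[OF U(2)] .
  have cross: "\<not> E p q" "\<not> E q p" if "p \<in> ?C" "q \<in> U - ?C" for p q
    using comp_closed[OF U(2) that(1)] that(2) sym by blast+
  obtain A where A: "A \<subseteq> U - ?C" "indep A" "sum w A = a"
    using a unfolding max_indep_def by auto
  obtain B where B: "B \<subseteq> ?C - nbh x" "indep B" "sum w B = b"
    using b unfolding max_indep_def by auto
  obtain D where D: "D \<subseteq> ?C - {x}" "indep D" "sum w D = c"
    using c unfolding max_indep_def by auto
  have fin: "finite A" "finite B" "finite D"
    by (rule finite_subset[OF _ U(1)], use A(1) B(1) D(1) CU in blast)+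
  have glue: "indep (A \<union> S) \<and> sum w (A \<union> S) = a + sum w S" if "S \<subseteq> ?C" "indep S" for S
  proof
    show "indep (A \<union> S)"
      unfolding indep_def
    proof (intro ballI)
      fix p q assume pq: "p \<in> A \<union> S" "q \<in> A \<union> S"
      then consider "p \<in> A" "q \<in> A" | "p \<in> S" "q \<in> S" | "p \<in> A" "q \<in> S" | "p \<in> S" "q \<in> A"
        by blast
      then show "\<not> E p q"
      proof cases
        case 1
        then show ?thesis using A(2) by (simp add: indep_def)
      next
        case 2
        then show ?thesis using that(2) by (simp add: indep_def)
      next
        case 3
        then have "q \<in> ?C" "p \<in> U - ?C" using A(1) that(1) by blast+
        then show ?thesis by (rule cross)
      next
        case 4
        then have "p \<in> ?C" "q \<in> U - ?C" using A(1) that(1) by blast+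
        then show ?thesis by (rule cross)
      qed
    qed
    have "finite S" by (rule finite_subset[OF subset_trans[OF that(1) CU] U(1)])
    moreover have "A \<inter> S = {}" using A(1) that(1) by blast
    ultimately show "sum w (A \<union> S) = a + sum w S"
      using sum.union_disjoint[OF fin(1), of S w] A(3) by simp
  qed
  have xB: "indep (insert x B)" "x \<notin> B"
  proof -
    show "x \<notin> B" using B(1) by (auto simp: nbh_def)
    have "\<not> E x p" "\<not> E p x" if "p \<in> B" for p
      using B(1) that sym by (auto simp: nbh_def)
    then show "indep (insert x B)" using B(2) irrefl unfolding indep_def by simp
  qed
  have "\<exists>S\<subseteq>U. indep S \<and> sum w S = a + max c (w x + b)"
  proof (cases "c \<le> w x + b")
    case True
    have "insert x B \<subseteq> ?C" using B(1) x by blast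
    moreover from glue[OF this xB(1)] have "indep (A \<union> insert x B)" "sum w (A \<union> insert x B) = a + (w x + b)"
      using B(3) xB(2) fin(2) by simp_all
    moreover have "max c (w x + b) = w x + b" using True by simp
    ultimately show ?thesis using A(1) CU
      by (intro exI[of _ "A \<union> insert x B"]) (simp; blast)
  next
    case False
    have "D \<subseteq> ?C" using D(1) by blast
    moreover from glue[OF this D(2)] have "indep (A \<union> D)" "sum w (A \<union> D) = a + c"
      using D(3) by simp_all
    moreover have "max c (w x + b) = c" using False by simp
    ultimately show ?thesis using A(1) CU
      by (intro exI[of _ "A \<union> D"]) (simp; blast)
  qed
  moreover have "sum w S \<le> a + max c (w x + b)" if S: "S \<subseteq> U" "indep S" for S
  proof -
    have finS: "finite S" by (rule finite_subset[OF S(1) U(1)])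
    have sub: "indep T" if "T \<subseteq> S" for T using S(2) that unfolding indep_def by blast
    have "S - ?C \<subseteq> U - ?C" using S(1) by (rule Diff_mono) simp
    then have "sum w (S - ?C) \<le> a" by (rule max_indepD[OF a _ sub[OF Diff_subset]])
    moreover have "sum w (S \<inter> ?C) \<le> max c (w x + b)"
    proof (cases "x \<in> S")
      case True
      have "\<not> E x p" if "p \<in> S" for p using True S(2) that by (simp add: indep_def)
      then have "S \<inter> ?C - {x} \<subseteq> ?C - nbh x" by (auto simp: nbh_def)
      moreover have "indep (S \<inter> ?C - {x})" by (rule sub) blast
      ultimately have "sum w (S \<inter> ?C - {x}) \<le> b" by (rule max_indepD[OF b])
      moreover have "sum w (S \<inter> ?C) = w x + sum w (S \<inter> ?C - {x})"
        using True x finS by (intro sum.remove) auto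
      ultimately show ?thesis by simp
    next
      case False
      then have "S \<inter> ?C \<subseteq> ?C - {x}" by blast
      then have "sum w (S \<inter> ?C) \<le> c" by (rule max_indepD[OF c _ sub[OF Int_lower1]])
      then show ?thesis by simp
    qed
    moreover have "sum w S = sum w (S \<inter> ?C) + sum w (S - ?C)"
      using finS by (simp add: sum.Int_Diff)
    ultimately show ?thesis by linarith
  qed
  ultimately show ?thesis unfolding max_indep_def by simp
qed

lemma exec_code:
  assumes "glob w s" "wf_for c" "bounds c \<subseteq> {''n'', ''N''}" "''n'' \<notin> mods c" "''N'' \<notin> mods c"
  shows "\<exists>t\<le>ftime N c. exec P (compile c) s t (sem c s)"
proof (rule exec_compile)
  have "n \<le> N" by (simp add: N_def)
  then show "s y 0 \<le> N" if "y \<in> bounds c" for y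
    using that assms(1,3) by (auto simp: glob_def)
qed (use assms in auto)

text \<open>A run has one step count while \<open>k\<close> is arbitrary, so the time clause speaks
  of all dominating functions; \<open>cost_bound k\<close> is inserted only at the end.\<close>

definition solved :: "(nat \<Rightarrow> nat) \<Rightarrow> nat set \<Rightarrow> nat \<Rightarrow> state \<Rightarrow> nat \<Rightarrow> state \<Rightarrow> bool" where
  "solved w U d s t s' \<longleftrightarrow> exec mwis (Call 1) s t s' \<and> glob w s' \<and> s' ''d'' 0 = d \<and> keep d s s' \<and>
    max_indep w U (s' ''ret'' 0) \<and> (\<forall>g :: nat set \<Rightarrow> real. dominates g \<longrightarrow> real t \<le> step_time N * g U)"

lemma solvedD:
  fixes g :: "nat set \<Rightarrow> real"
  assumes "solved w U d s t s'"
  shows "exec mwis (Call 1) s t s'" "glob w s'" "s' ''d'' 0 = d" "keep d s s'"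
    "max_indep w U (s' ''ret'' 0)" "dominates g \<Longrightarrow> real t \<le> step_time N * g U"
  using assms by (simp_all add: solved_def)

lemma dominatesD:
  fixes g :: "nat set \<Rightarrow> real"
  assumes "dominates g" "U \<subseteq> {..<n}" "u \<in> U" "x \<in> comp U u"
    "\<And>y. y \<in> comp U u \<Longrightarrow> gain (comp U u) y \<le> gain (comp U u) x"
  shows "1 + g (U - comp U u) + g (comp U u - {x}) + g (comp U u - nbh x) \<le> g U"
  using assms unfolding dominates_def by simp

text \<open>Each argument of a recursive call is smaller than \<open>U\<close>: the first misses
  \<open>u\<close>, the others miss \<open>x\<close>. As the depth grows by 1 meanwhile,
  \<open>d + card U \<le> n\<close> persists and keeps all rows within the table.\<close>

lemma exec_solve:
  assumes "glob w s" "s ''d'' 0 = d" "d + card U \<le> n" "mask d s U"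
  shows "\<exists>t s'. solved w U d s t s'"
  using assms
proof (induction "card U" arbitrary: U d s rule: less_induct)
  case less
  note g = less.prems(1) and d = less.prems(2) and dU = less.prems(3) and U = less.prems(4)
  have Un: "U \<subseteq> {..<n}" using U by (simp add: mask_def)
  then have finU: "finite U" using finite_subset by blast
  have dn: "d \<le> n" using dU by simp
  have solve: "mwis ! 1 = solve" "1 < length mwis" by (simp_all add: mwis_def)
  define s1 where "s1 = sem find_source s"
  have g1: "glob w s1" unfolding s1_def
    by (rule glob_frame[OF g]) (auto simp: sem_frame mods_solve)
  have n1: "s1 ''n'' 0 = n" using g1 by (simp add: glob_def)
  have f1: "s1 ''d'' = s ''d''" "s1 ''U'' = s ''U''" "keep d s s1"
    by (simp_all add: s1_def sem_frame mods_solve keep_def)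
  obtain t1 where t1: "t1 \<le> ftime N find_source" "exec mwis (compile find_source) s t1 s1"
    using exec_code[OF g wf_solve(1) bounds_solve(1), of mwis] unfolding s1_def
    by (auto simp: mods_solve)
  consider "s1 ''u'' 0 = n" "U = {}" | "s1 ''u'' 0 \<in> U"
    using sem_find_source[OF g d dn U] unfolding s1_def by blast
  then show ?case
  proof cases
    case 1
    let ?s = "s1(''ret'' := (s1 ''ret'')(0 := 0))"
    have "\<not> aval (sc ''u'') s1 < aval (sc ''n'') s1" using 1 n1 by simp
    note ex = exec.IfFalse[OF this exec.Assign[of mwis "''ret''" "Const 0" "Const 0"]]
    \<comment> \<open>5 steps for the test and 3 for clearing \<open>ret\<close>.\<close>
    have "exec mwis solve s (t1 + 8) ?s"
      using exec.Seq[OF t1(2) ex] unfolding solve_def by (simp add: eval_nat_numeral)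
    then have "exec mwis (Call 1) s (t1 + 8 + 1) ?s"
      using exec.Call[of 1 mwis s "t1 + 8" ?s] solve by simp
    moreover have "glob w ?s" by (rule glob_frame[OF g1]) auto
    moreover have "keep d s ?s" using f1(3) by (simp add: keep_def)
    moreover have "max_indep w U 0" using 1 by (auto simp: max_indep_def indep_def)
    moreover have "real (t1 + 8 + 1) \<le> step_time N * g U" if "dominates g" for g :: "nat set \<Rightarrow> real"
    proof -
      have "1 \<le> g U" using that 1 by (simp add: dominates_def)
      then have "real (step_time N) \<le> step_time N * g U"
        using mult_left_mono[of 1 "g U" "real (step_time N)"] by simp
      moreover have "t1 + 8 + 1 \<le> step_time N" using t1(1) by (simp add: step_time_def)
      ultimately show ?thesis by linarith
    qed
    ultimately have "solved w U d s (t1 + 8 + 1) ?s"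
      using d f1 unfolding solved_def by simp
    then show ?thesis by blast
  next
    case 2
    define u where "u = s1 ''u'' 0"
    define C where "C = comp U u"
    have u: "s1 ''u'' 0 = u" "u \<in> U" "u < n" using 2 Un by (auto simp: u_def)
    have CU: "C \<subseteq> U" using comp_subset[OF u(2)] by (simp add: C_def)
    have uC: "u \<in> C" by (simp add: C_def comp_refl)
    have finC: "finite C" using CU finU finite_subset by blast
    have Upos: "0 < card U" using u finU card_gt_0_iff by blast
    have Cn: "C \<subseteq> {..<n}" using CU Un by simp
    have conn: "conn C" unfolding C_def by (rule conn_comp[OF u(2)])
    have pos: "\<forall>p\<in>C. \<forall>q\<in>C. 0 < W C p q"
      using W_bounds(1)[OF conn_reach[OF conn] _ Cn] by simp
    have Sd: "Suc d \<le> n" using dU Upos by simp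
    have U1: "mask d s1 U" using U by (simp add: mask_def f1)
    have d1: "s1 ''d'' 0 = d" using d f1 by simp
    define s2 where "s2 = sem split_component s1"
    note seg1 = sem_split_component[OF g1 d1 Sd U1 u(1,2), folded s2_def C_def]
    obtain t2 where t2: "t2 \<le> ftime N split_component"
      "exec mwis (compile split_component) s1 t2 s2"
      using exec_code[OF g1 wf_solve(2) bounds_solve(2), of mwis] unfolding s2_def
      by (auto simp: mods_solve)
    have "card (U - C) < card U" using uC u(2) finU by (intro psubset_card_mono) auto
    moreover from this have "Suc d + card (U - C) \<le> n" using dU by simp
    ultimately obtain t3 s3 where r3: "solved w (U - C) (Suc d) s2 t3 s3"
      using less.hyps[OF _ seg1(1,2) _ seg1(3)] by blast
    note t3 = solvedD(1)[OF r3] and s3 = solvedD(2-5)[OF r3] and T3 = solvedD(6)[OF r3]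
    have C3: "mask d s3 C" by (rule mask_keep[OF seg1(4) s3(3)])
    define s4 where "s4 = sem enter_with s3"
    define x where "x = s4 ''sx'' d"
    have "C \<noteq> {}" using uC by blast
    note seg2 = sem_enter_with[OF s3(1,2) Sd C3 this pos, folded s4_def, folded x_def]
    obtain t4 where t4: "t4 \<le> ftime N enter_with" "exec mwis (compile enter_with) s3 t4 s4"
      using exec_code[OF s3(1) wf_solve(3) bounds_solve(3), of mwis] unfolding s4_def
      by (auto simp: mods_solve)
    note x = seg2(3,4)
    have "C - nbh x \<subset> C" using x by (auto simp: nbh_def)
    then have "card (C - nbh x) < card C" using finC by (rule psubset_card_mono[rotated])
    moreover have cCU: "card C \<le> card U" using CU finU by (rule card_mono[rotated])
    ultimately have lt: "card (C - nbh x) < card U" "Suc d + card (C - nbh x) \<le> n" using dU by simp_all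
    obtain t5 s5 where r5: "solved w (C - nbh x) (Suc d) s4 t5 s5"
      using less.hyps[OF lt(1) seg2(1,2) lt(2) seg2(6)] by blast
    note t5 = solvedD(1)[OF r5] and s5 = solvedD(2-5)[OF r5] and T5 = solvedD(6)[OF r5]
    have C5: "mask d s5 C" by (rule mask_keep[OF seg2(5) s5(3)])
    have x5: "s5 ''sx'' d = x" "s5 ''r1'' d = s3 ''ret'' 0"
      using s5(3) seg2(7) by (simp_all add: keep_def x_def)
    define s6 where "s6 = sem enter_without s5"
    note seg3 = sem_enter_without[OF s5(1,2) Sd C5 x5(1) x(1), folded s6_def]
    obtain t6 where t6: "t6 \<le> ftime N enter_without" "exec mwis (compile enter_without) s5 t6 s6"
      using exec_code[OF s5(1) wf_solve(4) bounds_solve(4), of mwis] unfolding s6_def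
      by (auto simp: mods_solve)
    have "card (C - {x}) < card C" using x(1) finC by (intro psubset_card_mono) auto
    then have lt': "card (C - {x}) < card U" "Suc d + card (C - {x}) \<le> n" using dU cCU by simp_all
    obtain t7 s7 where r7: "solved w (C - {x}) (Suc d) s6 t7 s7"
      using less.hyps[OF lt'(1) seg3(1,2) lt'(2) seg3(3)] by blast
    note t7 = solvedD(1)[OF r7] and s7 = solvedD(2-5)[OF r7] and T7 = solvedD(6)[OF r7]
    have r: "s7 ''r1'' d = s3 ''ret'' 0" "s7 ''r2'' d = w x + s5 ''ret'' 0"
      using s7(3) seg3(4,5) x5 by (simp_all add: keep_def)
    define s8 where "s8 = sem combine s7"
    note seg4 = sem_combine[OF s7(1,2), folded s8_def]
    obtain t8 where t8: "t8 \<le> ftime N combine" "exec mwis (compile combine) s7 t8 s8"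
      using exec_code[OF s7(1) wf_solve(5) bounds_solve(5), of mwis] unfolding s8_def
      by (auto simp: mods_solve)
    define T where "T = t2 + (t3 + (t4 + (t5 + (t6 + (t7 + t8)))))"
    have "aval (sc ''u'') s1 < aval (sc ''n'') s1" using u n1 by simp
    note ex = exec.IfTrue[OF this exec.Seq[OF t2(2) exec.Seq[OF t3 exec.Seq[OF t4(2) exec.Seq[OF t5
      exec.Seq[OF t6(2) exec.Seq[OF t7 t8(2)]]]]]], folded T_def]
    have "exec mwis solve s (t1 + (5 + T)) s8"
      using exec.Seq[OF t1(2) ex] unfolding solve_def by (simp add: eval_nat_numeral)
    then have "exec mwis (Call 1) s (t1 + (5 + T) + 1) s8"
      using exec.Call[of 1 mwis s "t1 + (5 + T)" s8] solve by simp
    moreover have "keep d s s8"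
      using f1(3) seg1(5) keep_le[OF s3(3)] seg2(8) keep_le[OF s5(3)] seg3(6) keep_le[OF s7(3)] seg4(4)
      by (meson keep_trans)
    moreover have "max_indep w U (s8 ''ret'' 0)"
    proof -
      have "s8 ''ret'' 0 = s3 ''ret'' 0 + max (s7 ''ret'' 0) (w x + s5 ''ret'' 0)"
        using seg4(3) r by simp
      then show ?thesis
        using max_indep_step[OF finU u(2), of x w] x(1) s3(4) s5(4) s7(4) unfolding C_def by simp
    qed
    moreover have "real (t1 + (5 + T) + 1) \<le> step_time N * g U" if dom: "dominates g" for g :: "nat set \<Rightarrow> real"
    proof -
      have "1 + g (U - C) + g (C - {x}) + g (C - nbh x) \<le> g U"
        by (rule dominatesD[OF dom Un u(2), folded C_def, OF x(1)]) (rule x(2))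
      then have "step_time N * (1 + g (U - C) + g (C - {x}) + g (C - nbh x)) \<le> step_time N * g U"
        by (intro mult_left_mono) auto
      moreover have "real t3 \<le> step_time N * g (U - C)" "real t5 \<le> step_time N * g (C - nbh x)"
        "real t7 \<le> step_time N * g (C - {x})" by (rule T3[OF dom] T5[OF dom] T7[OF dom])+
      moreover have "t1 + t2 + t4 + t6 + t8 + 6 \<le> step_time N"
        using t1(1) t2(1) t4(1) t6(1) t8(1) by (simp add: step_time_def)
      then have "real t1 + t2 + t4 + t6 + t8 + 6 \<le> step_time N" by linarith
      ultimately show ?thesis unfolding T_def by (simp add: algebra_simps)
    qed
    ultimately have "solved w U d s (t1 + (5 + T) + 1) s8"
      using seg4(1,2) unfolding solved_def by simp
    then show ?thesis by blast
  qed
qed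

end

section \<open>The running time\<close>

definition adjacent :: "'a ugraph \<Rightarrow> 'a \<Rightarrow> 'a \<Rightarrow> bool" where
  "adjacent G u v \<longleftrightarrow> {u, v} \<in> edges G"

lemma nat_graph_adjacent:
  assumes "simple_graph G"
  shows "nat_graph (adjacent G)"
proof
  show "adjacent G v u" if "adjacent G u v" for u v
    using that by (simp add: adjacent_def insert_commute)
  show "\<not> adjacent G u u" for u
  proof
    assume "adjacent G u u"
    then have "card {u, u} = 2" using assms unfolding adjacent_def simple_graph_def by blast
    then show False by simp
  qed
qed

text \<open>\<open>induced_path\<close> enumerates the vertices from \<open>{..<k}\<close>, so the
  isomorphism onto \<open>path_graph k\<close> is the inverse of \<open>f\<close>.\<close>

lemma path_free_no_path:
  assumes "simple_graph G" "vertices G = {..<n}" "path_free k G"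
  shows "nat_graph.no_path n (adjacent G) k"
proof -
  interpret nat_graph n "adjacent G" by (rule nat_graph_adjacent[OF assms(1)])
  have False if f: "f ` {..<k} \<subseteq> {..<n}" "induced_path (adjacent G) f k" for f
  proof -
    let ?W = "f ` {..<k}"
    have inj: "inj_on f {..<k}" using f(2) by (simp add: induced_path_def)
    have inv: "the_inv_into {..<k} f (f i) = i" if "i < k" for i
      using the_inv_into_f_f[OF inj] that by simp
    have "bij_betw (the_inv_into {..<k} f) ?W {..<k}"
      by (rule bij_betw_the_inv_into) (use inj in \<open>simp add: bij_betw_def\<close>)
    moreover have "{u, v} \<in> edges (induced_subgraph G ?W) \<longleftrightarrow>
        {the_inv_into {..<k} f u, the_inv_into {..<k} f v} \<in> edges (path_graph k)"
      if uv: "u \<in> ?W" "v \<in> ?W" for u v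
    proof -
      obtain i j where ij: "u = f i" "i < k" "v = f j" "j < k" using uv by auto
      have "{u, v} \<in> edges (induced_subgraph G ?W) \<longleftrightarrow> adjacent G (f i) (f j)"
        using uv ij by (simp add: induced_subgraph_def adjacent_def)
      also have "\<dots> \<longleftrightarrow> j = Suc i \<or> i = Suc j"
        using f(2) ij(2,4) unfolding induced_path_def by blast
      also have "\<dots> \<longleftrightarrow> {i, j} \<in> edges (path_graph k)"
        using ij by (auto simp: path_graph_def doubleton_eq_iff)
      finally show ?thesis using ij inv by simp
    qed
    ultimately have "isomorphic (induced_subgraph G ?W) (path_graph k)"
      unfolding isomorphic_def
      by (intro exI[of _ "the_inv_into {..<k} f"]) (simp add: induced_subgraph_def path_graph_def)
    then show False using assms(2,3) f(1) unfolding path_free_def by metis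
  qed
  then show ?thesis unfolding no_path_def by metis
qed

lemma max_indep_weight:
  assumes "simple_graph G" "vertices G = {..<n}"
    and r: "nat_graph.max_indep (adjacent G) w {..<n} r"
  shows "max_weight_independent_set G w = r"
proof -
  interpret nat_graph n "adjacent G" by (rule nat_graph_adjacent[OF assms(1)])
  have ind: "independent_set G S \<longleftrightarrow> S \<subseteq> {..<n} \<and> indep S" for S
    using assms(2) by (simp add: independent_set_def indep_def adjacent_def)
  have "{sum w S | S. independent_set G S} \<subseteq> sum w ` Pow {..<n}"
    unfolding ind by auto
  then have "finite {sum w S | S. independent_set G S}"
    by (rule finite_subset) simp
  moreover have "y \<le> r" if "y \<in> {sum w S | S. independent_set G S}" for y
    using that max_indepD[OF r] unfolding ind by auto
  moreover have "r \<in> {sum w S | S. independent_set G S}"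
    using r unfolding max_indep_def ind by auto
  ultimately show ?thesis unfolding max_weight_independent_set_def by (rule Max_eqI)
qed

section \<open>The complete run and its explicit time bound\<close>

context nat_graph
begin

lemma sem_init:
  fixes w :: "nat \<Rightarrow> nat"
  assumes s: "s ''n'' 0 = n" "\<And>i. s ''row'' i = 0" "s ''N'' 0 = 0" "s ''d'' 0 = 0"
    "\<And>v y. v < n \<Longrightarrow> y < n \<Longrightarrow> 0 < s ''adj'' (v * n + y) \<longleftrightarrow> E v y" "\<And>v. v < n \<Longrightarrow> s ''w'' v = w v"
  shows "glob w (sem init s)" "sem init s ''d'' 0 = 0" "mask 0 (sem init s) {..<n}"
proof -
  let ?row = "FFor ''i'' ''n'' (FAsg ''row'' (inc_sc ''i'') (Plus (Read ''row'' (sc ''i'')) (sc ''n'')))"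
  let ?sum = "FFor ''i'' ''n'' (set_sc ''N'' (Plus (sc ''N'') (sc ''n'')))"
  let ?mask = "FFor ''i'' ''n'' (FAsg ''U'' (sc ''i'') (Const 1))"
  define s1 where "s1 = sem ?row s"
  define s2 where "s2 = sem ?sum s1"
  define s3 where "s3 = s2(''N'' := (s2 ''N'')(0 := N))"
  have f1: "z \<notin> {''i'', ''row''} \<Longrightarrow> s1 z = s z" for z by (simp add: s1_def sem_frame)
  have f2: "z \<notin> {''i'', ''N''} \<Longrightarrow> s2 z = s1 z" for z by (simp add: s2_def sem_frame)
  have row: "\<forall>p\<le>n. s1 ''row'' p = p * n"
    unfolding s1_def
  proof (rule sem_For[where I = "\<lambda>i s'. \<forall>p\<le>i. s' ''row'' p = p * n"])
    fix i s'
    assume s': "i < n" "\<forall>p\<le>i. s' ''row'' p = p * n" "s' ''i'' 0 = i"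
      "\<And>z. z \<notin> insert ''i'' (mods (FAsg ''row'' (inc_sc ''i'') (Plus (Read ''row'' (sc ''i'')) (sc ''n''))))
        \<Longrightarrow> s' z = s z"
    have "s' ''n'' 0 = n" using s'(4)[of "''n''"] s by simp
    then show "\<forall>p\<le>Suc i. ((sem (FAsg ''row'' (inc_sc ''i'') (Plus (Read ''row'' (sc ''i'')) (sc ''n''))) s')
        (''i'' := (s' ''i'')(0 := Suc i))) ''row'' p = p * n"
      using s' by (auto simp: le_Suc_eq)
  qed (use s in auto)
  have "s2 ''N'' 0 = n * n"
    unfolding s2_def
  proof (rule sem_For[where I = "\<lambda>i s'. s' ''N'' 0 = i * n"])
    fix i s'
    assume s': "i < n" "s' ''N'' 0 = i * n" "s' ''i'' 0 = i"
      "\<And>z. z \<notin> insert ''i'' (mods (set_sc ''N'' (Plus (sc ''N'') (sc ''n'')))) \<Longrightarrow> s' z = s1 z"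
    have "s' ''n'' 0 = n" using s'(4)[of "''n''"] s f1 by simp
    then show "((sem (set_sc ''N'' (Plus (sc ''N'') (sc ''n''))) s')(''i'' := (s' ''i'')(0 := Suc i)))
        ''N'' 0 = Suc i * n"
      using s' by simp
  qed (use s f1 in auto)
  moreover have "N = n * n + n * n + (n * n + n * n)" by (simp add: N_def)
  ultimately have "sem (set_sc ''N'' (Plus (sc ''N'') (sc ''N'')))
      (sem (set_sc ''N'' (Plus (sc ''N'') (sc ''N''))) s2) = s3"
    by (simp add: s3_def)
  then have init: "sem init s = sem ?mask s3"
    unfolding init_def sem.simps(3) s1_def[symmetric] s2_def[symmetric] by simp
  have "glob w s3"
    using row s by (simp add: glob_def s3_def f1 f2)
  then show "glob w (sem init s)"
    unfolding init by (rule glob_frame) (auto simp: sem_frame)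
  show "sem init s ''d'' 0 = 0" using s by (simp add: sem_frame mods_solve)
  have n3: "s3 ''n'' 0 = n" using s by (simp add: s3_def f1 f2)
  have "sem ?mask s3 ''U'' p = (if 0 \<le> p \<and> p < 0 + n then 1 else s3 ''U'' p)" for p
    by (rule sem_For_array) (use n3 in auto)
  then show "mask 0 (sem init s) {..<n}" unfolding init by (simp add: mask_def)
qed

lemma run_mwis:
  assumes "s ''n'' 0 = n" "\<And>i. s ''row'' i = 0" "s ''N'' 0 = 0" "s ''d'' 0 = 0"
    "\<And>v y. v < n \<Longrightarrow> y < n \<Longrightarrow> 0 < s ''adj'' (v * n + y) \<longleftrightarrow> E v y" "\<And>v. v < n \<Longrightarrow> s ''w'' v = w v"
  obtains t s' where "run mwis s t s'" "max_indep w {..<n} (result s')"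
    "\<And>k. no_path k \<Longrightarrow> real t \<le> 2 * step_time N * cost_bound k {..<n}"
proof -
  define s1 where "s1 = sem init s"
  note s1 = sem_init[of s w, OF assms, folded s1_def]
  have "\<exists>t\<le>ftime N init. exec mwis (compile init) s t (sem init s)"
  proof (rule exec_compile)
    show "s y 0 \<le> N" if "y \<in> bounds init" for y
      using that assms(1) by (simp add: bounds_solve N_def)
  qed (simp_all add: wf_solve bounds_solve mods_solve)
  then obtain t1 where t1: "t1 \<le> ftime N init" "exec mwis (compile init) s t1 s1"
    unfolding s1_def by blast
  obtain t2 s2 where r2: "solved w {..<n} 0 s1 t2 s2"
    using exec_solve[OF s1(1,2) _ s1(3)] by auto
  let ?s = "s2(''out'' := (s2 ''out'')(0 := s2 ''ret'' 0))"
  have "exec mwis (mwis ! 0) s (t1 + (t2 + 4)) ?s"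
    using exec.Seq[OF t1(2) exec.Seq[OF solvedD(1)[OF r2]
      exec.Assign[of mwis "''out''" "Const 0" "sc ''ret''"]]]
    by (simp add: mwis_def eval_nat_numeral)
  then have "run mwis s (t1 + (t2 + 4) + 1) ?s"
    unfolding run_def by (intro exec.Call) (simp_all add: mwis_def)
  moreover have "max_indep w {..<n} (result ?s)"
    using solvedD(5)[OF r2] by (simp add: result_def)
  moreover have "real (t1 + (t2 + 4) + 1) \<le> 2 * step_time N * cost_bound k {..<n}"
    if k: "no_path k" for k
  proof -
    have "real t2 \<le> step_time N * cost_bound k {..<n}"
      by (rule solvedD(6)[OF r2 dominates_cost_bound[OF k]])
    moreover have "1 \<le> cost_bound k {..<n}" by (simp add: cost_bound_def)
    then have "real (step_time N) \<le> step_time N * cost_bound k {..<n}"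
      using mult_left_mono[of 1 "cost_bound k {..<n}" "real (step_time N)"] by simp
    moreover have "t1 + 5 \<le> step_time N" using t1(1) by (simp add: step_time_def)
    then have "real t1 + 5 \<le> step_time N" by linarith
    moreover have "2 * step_time N * cost_bound k {..<n} =
        step_time N * cost_bound k {..<n} + step_time N * cost_bound k {..<n}" by simp
    ultimately show ?thesis by linarith
  qed
  ultimately show ?thesis by (rule that)
qed

text \<open>\<open>ln N \<le> 4 * l\<close> gives \<open>L \<le> 6 * (k * l)\<close>, and
  \<open>lev + 1 \<le> 3 * l\<close>; the product is 18 and the exponent \<open>x\<close> gets
  \<open>16 * 18 = 288\<close>. Since \<open>4 * n \<le> m powr 3\<close>, the cost is at most
  \<open>m powr (4 + 3 * x)\<close>, and \<open>868 = 4 + 3 * 288\<close>.\<close>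

lemma cost_bound_upper:
  assumes k: "no_path k"
  defines "m \<equiv> real (max 2 n)"
  shows "cost_bound k {..<n} \<le> m powr (868 * (real k)\<^sup>2 * (log 2 m)\<^sup>2)"
proof -
  define l where "l = log 2 m"
  have m: "2 \<le> m" "real n \<le> m" by (auto simp: m_def)
  have l: "1 \<le> l" using m by (simp add: l_def le_log_iff)
  have k1: "1 \<le> real k" using no_path_pos[OF k] by simp
  have kl: "1 \<le> real k * l" using mult_mono[OF k1 l] by simp
  have lnm: "ln m \<le> l"
  proof -
    have "ln m = l * ln 2" using m by (simp add: l_def log_def)
    also have "\<dots> \<le> l * 1" using l ln_le_minus_one[of "2::real"] by (intro mult_left_mono) auto
    finally show ?thesis by simp
  qed
  have lnN: "ln N \<le> 4 * l"
  proof (cases "n = 0")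
    case True
    then have "N = 0" unfolding N_def by simp
    then show ?thesis using l by simp
  next
    case False
    have "real N = 4 * (real n * real n)" by (simp add: N_def)
    also have "\<dots> \<le> (m * m) * (m * m)"
      using m mult_mono[of 2 m 2 m] by (intro mult_mono) auto
    also have "\<dots> = m ^ 4" by (simp add: power4_eq_xxxx)
    finally have "ln N \<le> ln (m ^ 4)" using False m by (subst ln_le_cancel_iff) (auto simp: N_def)
    also have "\<dots> = 4 * ln m" using m by (simp add: ln_realpow)
    finally show ?thesis using lnm by simp
  qed
  define L where "L = k * ln N + 2"
  have L: "0 \<le> L" "L \<le> 6 * (k * l)"
  proof -
    show "0 \<le> L" using ln_N_nonneg by (simp add: L_def)
    have "real k * ln N \<le> k * (4 * l)" using lnN by (intro mult_left_mono) auto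
    then show "L \<le> 6 * (k * l)" using kl by (simp add: L_def)
  qed
  have lev: "real (lev {..<n}) \<le> l + 1"
  proof -
    have "real n \<le> 2 powr l" using m by (simp add: l_def)
    also have "\<dots> \<le> 2 powr real (nat \<lceil>l\<rceil>)" by (intro powr_mono) (auto simp: real_nat_ceiling_ge)
    also have "\<dots> = real (2 ^ nat \<lceil>l\<rceil>)" by (simp add: powr_realpow)
    finally have "card {..<n} \<le> 2 ^ nat \<lceil>l\<rceil>" by (simp only: of_nat_le_iff card_lessThan)
    then have "lev {..<n} \<le> nat \<lceil>l\<rceil>" by (rule lev_le)
    moreover have "real (nat \<lceil>l\<rceil>) \<le> l + 1" using l by linarith
    ultimately show ?thesis by linarith
  qed
  have "rho k {..<n} \<le> L * lev {..<n} + L"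
    using pot_scaled[OF k, of "{..<n}"] by (simp add: rho_def L_def)
  also have "\<dots> = L * (real (lev {..<n}) + 1)" by (simp add: algebra_simps)
  also have "\<dots> \<le> (6 * (k * l)) * (3 * l)"
    using L lev l by (intro mult_mono) auto
  finally have rho: "rho k {..<n} \<le> 18 * k * l\<^sup>2" by (simp add: power2_eq_square algebra_simps)
  define x where "x = 16 * k * rho k {..<n}"
  have x0: "0 \<le> x" using rho_nonneg[OF k, of "{..<n}"] by (simp add: x_def)
  have "x \<le> 16 * k * (18 * k * l\<^sup>2)" unfolding x_def using rho by (intro mult_left_mono) auto
  then have x: "x \<le> 288 * (k\<^sup>2 * l\<^sup>2)" by (simp add: power2_eq_square algebra_simps)
  have kl2: "1 \<le> (real k)\<^sup>2 * l\<^sup>2"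
    using kl by (metis one_le_power power_mult_distrib)
  have m3: "m powr 3 = m * m * m" using m by (simp add: powr_numeral power3_eq_cube)
  have "4 * real n \<le> 2 * 2 * m" using m by simp
  also have "\<dots> \<le> m * m * m" using m by (intro mult_right_mono mult_mono) auto
  finally have n3: "4 * real n \<le> m powr 3" using m3 by simp
  have "cost_bound k {..<n} = 4 * real n * (4 * real n) powr x + 1"
    by (simp add: cost_bound_def x_def)
  also have "\<dots> \<le> m powr 3 * (m powr 3) powr x + 1"
    using n3 x0 by (intro add_right_mono mult_mono powr_mono2) auto
  also have "\<dots> = m powr (3 + 3 * x) + 1" by (simp add: powr_powr powr_add)
  also have "\<dots> \<le> m powr (3 + 3 * x) + m powr (3 + 3 * x)"
    using m x0 by (intro add_left_mono ge_one_powr_ge_zero) auto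
  also have "\<dots> \<le> m powr 1 * m powr (3 + 3 * x)" using m by simp
  also have "\<dots> = m powr (4 + 3 * x)" unfolding powr_add[symmetric] by simp
  also have "\<dots> \<le> m powr (868 * (k\<^sup>2 * l\<^sup>2))"
    using m x kl2 by (intro powr_mono) auto
  finally show ?thesis by (simp add: l_def mult.assoc)
qed

lemma step_time_upper:
  assumes e: "\<And>K. step_time K \<le> (K + 2) ^ e"
  shows "real (step_time N) \<le> real (max 2 n) powr (5 * e)"
proof -
  define m where "m = max 2 n"
  have m: "2 \<le> m" "n \<le> m" by (auto simp: m_def)
  have "N + 2 \<le> m ^ 5"
  proof -
    have "N \<le> (2 * 2) * (m * m)" unfolding N_def using m by (simp add: mult_le_mono)
    also have "\<dots> \<le> (m * m) * (m * m)" using m by (intro mult_le_mono) auto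
    finally have "N \<le> m ^ 4" by (simp add: power4_eq_xxxx)
    moreover have "2 \<le> m ^ 4" using m power_mono[of 2 m 4] by simp
    ultimately have "N + 2 \<le> 2 * m ^ 4" by simp
    also have "\<dots> \<le> m * m ^ 4" using m by (intro mult_le_mono1)
    finally show ?thesis by (simp flip: power_Suc)
  qed
  then have "(N + 2) ^ e \<le> (m ^ 5) ^ e" by (rule power_mono) simp
  then have "step_time N \<le> m ^ (5 * e)" using e[of N] by (simp add: power_mult)
  then have "real (step_time N) \<le> real m ^ (5 * e)" by (metis of_nat_le_iff of_nat_power)
  also have "\<dots> = real m powr (5 * e)" using m by (subst powr_realpow) auto
  finally show ?thesis by (simp add: m_def)
qed

end

lemma step_time_poly: "\<exists>e. \<forall>K. step_time K \<le> (K + 2) ^ e"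
proof -
  obtain e where e: "\<And>K. ftime K (init ;; find_source ;; split_component ;; enter_with ;;
      enter_without ;; combine) \<le> (K + 2) ^ e" using ftime_poly by blast
  have "step_time K \<le> (K + 2) ^ (5 + e)" for K
  proof -
    have "1 \<le> (K + 2) ^ e" by simp
    then have "step_time K \<le> 32 * (K + 2) ^ e"
      using e[of K] unfolding step_time_def by linarith
    also have "\<dots> = 2 ^ 5 * (K + 2) ^ e" by simp
    also have "\<dots> \<le> (K + 2) ^ 5 * (K + 2) ^ e" by (intro mult_le_mono1 power_mono) auto
    finally show ?thesis by (simp only: power_add)
  qed
  then show ?thesis by blast
qed

theorem theorem1:
  "\<exists>(P :: program) (c :: real).
     \<forall>(n :: nat) (G :: nat ugraph) (w :: nat \<Rightarrow> nat).
       simple_graph G \<and> vertices G = {..<n} \<longrightarrow>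
       (\<exists>t s. run P (input_state n G w) t s \<and>
              result s = max_weight_independent_set G w \<and>
              (\<forall>k. path_free k G \<longrightarrow> real t \<le> time_bound c k n))"
proof -
  obtain e where e: "\<And>K. step_time K \<le> (K + 2) ^ e" using step_time_poly by blast
  \<comment> \<open>\<open>5 * e\<close> comes from \<open>N + 2 \<le> m ^ 5\<close>; 869 is 868
    from the recursion plus 1 for the factor 2, which is at most \<open>m\<close>.\<close>
  define c :: real where "c = 5 * e + 869"
  have "\<exists>t s. run mwis (input_state n G w) t s \<and> result s = max_weight_independent_set G w \<and>
      (\<forall>k. path_free k G \<longrightarrow> real t \<le> time_bound c k n)"
    if G: "simple_graph G" "vertices G = {..<n}" for n G and w :: "nat \<Rightarrow> nat"
  proof -
    interpret nat_graph n "adjacent G" by (rule nat_graph_adjacent[OF G(1)])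
    let ?s = "input_state n G w"
    have adj: "0 < ?s ''adj'' (v * n + y) \<longleftrightarrow> adjacent G v y" if "v < n" "y < n" for v y
    proof -
      have "v * n + y < Suc v * n" using that by simp
      also have "\<dots> \<le> n * n" using that by (intro mult_le_mono1) simp
      finally show ?thesis using that by (simp add: input_state_def adjacent_def)
    qed
    obtain t s where r: "run mwis ?s t s" "max_indep w {..<n} (result s)"
      and t: "\<And>k. no_path k \<Longrightarrow> real t \<le> 2 * step_time N * cost_bound k {..<n}"
      by (rule run_mwis[of ?s w, OF _ _ _ _ adj]) (simp_all add: input_state_def)
    have "real t \<le> time_bound c k n" if "path_free k G" for k
    proof -
      have k: "no_path k" by (rule path_free_no_path[OF G that])
      define m where "m = real (max 2 n)"
      define l where "l = log 2 m"
      have m: "2 \<le> m" by (simp add: m_def)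
      have l: "1 \<le> l" using m by (simp add: l_def le_log_iff)
      have k1: "1 \<le> real k" using no_path_pos[OF k] by simp
      have "real t \<le> 2 * step_time N * cost_bound k {..<n}" by (rule t[OF k])
      also have "\<dots> \<le> (m powr 1 * m powr (5 * e)) * m powr (868 * (real k)\<^sup>2 * l\<^sup>2)"
      proof (rule mult_mono)
        have "2 * real (step_time N) \<le> m powr 1 * m powr (5 * e)"
          using step_time_upper[OF e] m unfolding m_def[symmetric] by (intro mult_mono) auto
        then show "real (2 * step_time N) \<le> m powr 1 * m powr (5 * e)" by simp
        show "cost_bound k {..<n} \<le> m powr (868 * (real k)\<^sup>2 * l\<^sup>2)"
          using cost_bound_upper[OF k] unfolding m_def[symmetric] l_def[symmetric] .
      qed (auto simp: cost_bound_def)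
      also have "\<dots> = m powr (1 + 5 * e + 868 * (real k)\<^sup>2 * l\<^sup>2)" by (simp add: powr_add)
      \<comment> \<open>The maximum with 2 ensures \<open>l \<ge> 1\<close>, and
        \<open>k \<ge> 1\<close> holds, so the constants and the square of \<open>l\<close> are
        absorbed by \<open>k^2 * l^3\<close>.\<close>
      also have "\<dots> \<le> m powr (c * (real k)\<^sup>2 * l ^ 3)"
      proof (rule powr_mono)
        have "l\<^sup>2 \<le> l ^ 3" "1 \<le> l ^ 3" using l by (auto intro: power_increasing)
        moreover have k2: "1 \<le> (real k)\<^sup>2" using k1 by simp
        ultimately have "1 \<le> (real k)\<^sup>2 * l ^ 3" "(real k)\<^sup>2 * l\<^sup>2 \<le> (real k)\<^sup>2 * l ^ 3"
          using mult_mono[of 1 "(real k)\<^sup>2" 1 "l ^ 3"] by (auto intro: mult_left_mono)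
        moreover from this(1) have "1 + 5 * real e \<le> (1 + 5 * real e) * ((real k)\<^sup>2 * l ^ 3)"
          using mult_left_mono[of 1 "(real k)\<^sup>2 * l ^ 3" "1 + 5 * real e"] by simp
        ultimately have "1 + 5 * real e + 868 * ((real k)\<^sup>2 * l\<^sup>2) \<le>
            (1 + 5 * real e) * ((real k)\<^sup>2 * l ^ 3) + 868 * ((real k)\<^sup>2 * l ^ 3)"
          by (intro add_mono mult_left_mono[of "(real k)\<^sup>2 * l\<^sup>2"]) auto
        also have "\<dots> = c * (real k)\<^sup>2 * l ^ 3" by (simp add: c_def algebra_simps)
        finally show "1 + 5 * e + 868 * (real k)\<^sup>2 * l\<^sup>2 \<le> c * (real k)\<^sup>2 * l ^ 3"
          by (simp add: mult.assoc)
      qed (use m in simp)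
      finally show ?thesis by (simp add: time_bound_def m_def l_def Let_def)
    qed
    then show ?thesis using r max_indep_weight[OF G r(2)] by (intro exI[of _ t] exI[of _ s]) simp
  qed
  then show ?thesis by (intro exI[of _ mwis] exI[of _ c]) simp
qed

end
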